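(* Let $G$ be a subcubic graph (i.e. $\Delta(G)\le 3$). \begin{enumerate} \item If $G$ does not contain $S_3$, $S_4$, or $S_7$ as a subgraph and $\mathrm{mad}(G) < 2 + \frac{1}{7}$, then $\chi_{s}'(G) \leq 5$. \item If $G$ is planar and has girth at least $30$, then $\chi_{s}'(G) \leq 5$. \end{enumerate}
   Context: All graphs are simple and finite. A strong edge-coloring of $G$ is an assignment of colors to the edges such that any two edges at distance at most two (i.e. two distinct edges that share an endpoint or are joined by an edge) receive distinct colors; $\chi_s'(G)$, the strong chromatic index, is the minimum number of colors in a strong edge-coloring of $G$. The maximum average degree $\mathrm{mad}(G)$ is the maximum of the average degree $2|E(H)|/|V(H)|$ over all (nonempty) subgraphs $H$ of $G$. The girth is the length of a shortest cycle. $S_3$ is a triangle with one pendant edge attached at each vertex; $S_4$ is a $4$-cycle with one pendant edge attached at each of two adjacent vertices; $S_7$ is a $7$-cycle with one pendant edge attached at each vertex. *)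

theory Defs
  imports "HOL-Analysis.Analysis" "HOL-Library.Extended_Nat"
begin

record 'a ugraph =
  verts :: "'a set"
  edges :: "'a set set"

definition simple_graph :: "'a ugraph \<Rightarrow> bool" where
  "simple_graph G \<longleftrightarrow> finite (verts G) \<and> (\<forall>e\<in>edges G. e \<subseteq> verts G \<and> card e = 2)"

definition degree :: "'a ugraph \<Rightarrow> 'a \<Rightarrow> nat" where
  "degree G v = card {e \<in> edges G. v \<in> e}"

(* On nat, SUP over a finite set is the maximum, and 0 for the empty set. *)
definition max_degree :: "'a ugraph \<Rightarrow> nat" where
  "max_degree G = (SUP v\<in>verts G. degree G v)"

definition subcubic :: "'a ugraph \<Rightarrow> bool" where
  "subcubic G \<longleftrightarrow> max_degree G \<le> 3"

definition subgraph :: "'a ugraph \<Rightarrow> 'a ugraph \<Rightarrow> bool" where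
  "subgraph H G \<longleftrightarrow> simple_graph H \<and> verts H \<subseteq> verts G \<and> edges H \<subseteq> edges G"

definition isomorphic :: "'a ugraph \<Rightarrow> 'b ugraph \<Rightarrow> bool" where
  "isomorphic G H \<longleftrightarrow>
     (\<exists>f. bij_betw f (verts G) (verts H) \<and> edges H = (\<lambda>e. f ` e) ` edges G)"

(* Subgraphs here are not required to be induced. *)
definition contains_subgraph :: "'a ugraph \<Rightarrow> 'b ugraph \<Rightarrow> bool" where
  "contains_subgraph G S \<longleftrightarrow> (\<exists>H. subgraph H G \<and> isomorphic S H)"


(* Distance at most two: e and f share an endpoint or some edge of G joins them. *)
definition edges_close :: "'a ugraph \<Rightarrow> 'a set \<Rightarrow> 'a set \<Rightarrow> bool" where
  "edges_close G e f \<longleftrightarrow> e \<noteq> f \<and> (e \<inter> f \<noteq> {} \<or> (\<exists>u\<in>e. \<exists>v\<in>f. {u, v} \<in> edges G))"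

definition strong_edge_coloring :: "'a ugraph \<Rightarrow> ('a set \<Rightarrow> 'c) \<Rightarrow> bool" where
  "strong_edge_coloring G c \<longleftrightarrow>
     (\<forall>e\<in>edges G. \<forall>f\<in>edges G. edges_close G e f \<longrightarrow> c e \<noteq> c f)"

definition strong_chromatic_index :: "'a ugraph \<Rightarrow> nat" where
  "strong_chromatic_index G =
     (LEAST k. \<exists>c :: 'a set \<Rightarrow> nat. strong_edge_coloring G c \<and> c ` edges G \<subseteq> {..<k})"

definition average_degree :: "'a ugraph \<Rightarrow> real" where
  "average_degree G = 2 * real (card (edges G)) / real (card (verts G))"

(* Meaningful for simple graphs with at least one vertex: the set is then finite and nonempty. *)
definition mad :: "'a ugraph \<Rightarrow> real" where
  "mad G = Max {average_degree H | H. subgraph H G \<and> verts H \<noteq> {}}"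


definition cycle_graph :: "nat \<Rightarrow> nat ugraph" where
  "cycle_graph n = \<lparr>verts = {..<n}, edges = {{i, Suc i mod n} | i. i < n}\<rparr>"

(* The infimum is infinity for acyclic graphs. *)
definition girth :: "'a ugraph \<Rightarrow> enat" where
  "girth G = (INF n\<in>{n. 3 \<le> n \<and> contains_subgraph G (cycle_graph n)}. enat n)"

(* The n-cycle on 0, ..., n - 1 with a pendant edge from i to the new vertex n + i
   for each i < k. *)
definition cycle_with_pendants :: "nat \<Rightarrow> nat \<Rightarrow> nat ugraph" where
  "cycle_with_pendants n k =
     \<lparr>verts = {..<n + k}, edges = edges (cycle_graph n) \<union> {{i, n + i} | i. i < k}\<rparr>"

definition S3 :: "nat ugraph" where "S3 = cycle_with_pendants 3 3"

definition S4 :: "nat ugraph" where "S4 = cycle_with_pendants 4 2"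

definition S7 :: "nat ugraph" where "S7 = cycle_with_pendants 7 7"


(* A drawing in the plane without crossings, the plane being the type complex: vertices go to
   distinct points, an edge to an arc joining the points of its two ends, an arc meets no other
   vertex point, and two arcs meet only at the points of common ends. *)
definition plane_drawing ::
  "'a ugraph \<Rightarrow> ('a \<Rightarrow> complex) \<Rightarrow> ('a set \<Rightarrow> real \<Rightarrow> complex) \<Rightarrow> bool" where
  "plane_drawing G p \<gamma> \<longleftrightarrow>
     inj_on p (verts G) \<and>
     (\<forall>e\<in>edges G. arc (\<gamma> e) \<and> {pathstart (\<gamma> e), pathfinish (\<gamma> e)} = p ` e \<and>
        path_image (\<gamma> e) \<inter> p ` verts G = p ` e) \<and>
     (\<forall>e\<in>edges G. \<forall>f\<in>edges G. e \<noteq> f \<longrightarrow>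
        path_image (\<gamma> e) \<inter> path_image (\<gamma> f) = p ` (e \<inter> f))"

definition planar :: "'a ugraph \<Rightarrow> bool" where
  "planar G \<longleftrightarrow> (\<exists>p \<gamma>. plane_drawing G p \<gamma>)"

end

theory Submission
  imports Defs
begin

text \<open>A minimal set of edges without a strong 5-coloring consists of a core of minimum degree two and of
  pendant edges, at most one at each core vertex of core degree two. Strong 5-colorings extending those of the
  core correspond to locally injective maps from the core to the Petersen graph (the Kneser graph on pairs of
  colors): a vertex is mapped to the pair of colors that its edges avoid. Along a thread of core vertices of
  degree two such a map is a non-backtracking walk; the walks with a given first arc reach every arc in
  8 steps and, in fewer steps, enough arcs to recolor around branch vertices with too long incident threads.
  Core cycles with at most one branch vertex are recolored directly; this is where \<open>S\<^sub>3\<close>, \<open>S\<^sub>4\<close> and \<open>S\<^sub>7\<close>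
  have to be excluded. After discharging, the numbers of internal vertices of the threads at a branch vertex
  add up to at most 12, so that the core has at least 15/14 as many edges as vertices.

  For plane graphs of girth \<open>g\<close>, the bound \<open>(g - 2) |E| + g \<le> g |V|\<close> contradicts this density when
  \<open>g = 30\<close>. It is proved for the part of the graph inside a cycle, by induction along ears and the Jordan
  curve theorem; an inversion of the plane exchanges inside and outside of a cycle, which gives the bound for
  the whole graph.\<close>

section \<open>Walks in the Petersen graph\<close>

text \<open>Around an edge uv of a cubic graph a strong 5-coloring uses each color once: the two
  colors missing at u are those of the other two edges at v, and conversely. So the missing pairs at
  u and v are disjoint, and uv carries the fifth color. Core vertices of degree two are treated as
  if they carried a pendant edge. This fails on some short cycles: the Petersen graph has cycles of
  length 5, 6, 8 and 9, but none of length 3, 4 or 7. There a coloring has to exploit missing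
  pendant edges, of which \<open>S3\<close>, \<open>S4\<close> and \<open>S7\<close> have too few.

  As 8 steps reach every arc, a thread has at most 7 interior vertices. Six length triples of sum 13
  or 14 at a branch vertex cannot be recolored on their own; their excess is sent along the shortest
  thread, since recoloring both of its ends together limits the other two threads at the far end to
  7 interior vertices.

  The constants fit together: a load of 12 gives at most 6 core vertices of degree two per branch
  vertex, at equality 7 vertices and 15/2 edges, thus the ratio 15/14 and the average degree 2 +
  1/7; and (g - 2) / g = 14/15 for g = 30.\<close>

datatype color = C0 | C1 | C2 | C3 | C4
datatype pvert = P01 | P02 | P03 | P04 | P12 | P13 | P14 | P23 | P24 | P34

text \<open>The Petersen graph, as the Kneser graph on the pairs of colors. An edge is labelled by the color
  missing from its two disjoint ends, so that the edges at a vertex carry the three colors outside it.\<close>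

primrec pnbrs :: "pvert \<Rightarrow> (pvert \<times> color) list" where
    "pnbrs P01 = [(P23, C4), (P24, C3), (P34, C2)]"
  | "pnbrs P02 = [(P13, C4), (P14, C3), (P34, C1)]"
  | "pnbrs P03 = [(P12, C4), (P14, C2), (P24, C1)]"
  | "pnbrs P04 = [(P12, C3), (P13, C2), (P23, C1)]"
  | "pnbrs P12 = [(P03, C4), (P04, C3), (P34, C0)]"
  | "pnbrs P13 = [(P02, C4), (P04, C2), (P24, C0)]"
  | "pnbrs P14 = [(P02, C3), (P03, C2), (P23, C0)]"
  | "pnbrs P23 = [(P01, C4), (P04, C1), (P14, C0)]"
  | "pnbrs P24 = [(P01, C3), (P03, C1), (P13, C0)]"
  | "pnbrs P34 = [(P01, C2), (P02, C1), (P12, C0)]"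

text \<open>A set of arcs, that is, of ordered pairs of adjacent vertices, as a vector of 30 bits in
  the order fixed by \<open>arcs_of\<close>: three arcs for each starting vertex. With a single
  constructor of fixed arity the finite checks by \<open>code_simp\<close> are Boolean rewriting;
  the \<open>_arcs_of\<close> lemmas recover their meaning.\<close>

datatype arcset = Arcs bool bool bool bool bool bool bool bool bool bool bool bool bool bool bool bool bool bool bool bool bool bool bool bool bool bool bool bool bool bool

definition arcs_of :: "(pvert \<Rightarrow> pvert \<Rightarrow> bool) \<Rightarrow> arcset" where
  "arcs_of f = Arcs
       (f P01 P23) (f P01 P24) (f P01 P34)
       (f P02 P13) (f P02 P14) (f P02 P34)
       (f P03 P12) (f P03 P14) (f P03 P24)
       (f P04 P12) (f P04 P13) (f P04 P23)
       (f P12 P03) (f P12 P04) (f P12 P34)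
       (f P13 P02) (f P13 P04) (f P13 P24)
       (f P14 P02) (f P14 P03) (f P14 P23)
       (f P23 P01) (f P23 P04) (f P23 P14)
       (f P24 P01) (f P24 P03) (f P24 P13)
       (f P34 P01) (f P34 P02) (f P34 P12)"

text \<open>One step of a non-backtracking walk: the arc from q to r is obtained iff the set
  contains one of the two arcs into q that do not start at r.\<close>

primrec advance :: "arcset \<Rightarrow> arcset" where
  "advance (Arcs x0 x1 x2 x3 x4 x5 x6 x7 x8 x9 x10 x11 x12 x13 x14 x15 x16 x17 x18 x19 x20 x21 x22 x23 x24 x25 x26 x27 x28 x29) = Arcs
       (x24 \<or> x27) (x21 \<or> x27) (x21 \<or> x24)
       (x18 \<or> x28) (x15 \<or> x28) (x15 \<or> x18)
       (x19 \<or> x25) (x12 \<or> x25) (x12 \<or> x19)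
       (x16 \<or> x22) (x13 \<or> x22) (x13 \<or> x16)
       (x9 \<or> x29) (x6 \<or> x29) (x6 \<or> x9)
       (x10 \<or> x26) (x3 \<or> x26) (x3 \<or> x10)
       (x7 \<or> x23) (x4 \<or> x23) (x4 \<or> x7)
       (x11 \<or> x20) (x0 \<or> x20) (x0 \<or> x11)
       (x8 \<or> x17) (x1 \<or> x17) (x1 \<or> x8)
       (x5 \<or> x14) (x2 \<or> x14) (x2 \<or> x5)"

primrec flip :: "arcset \<Rightarrow> arcset" where
  "flip (Arcs x0 x1 x2 x3 x4 x5 x6 x7 x8 x9 x10 x11 x12 x13 x14 x15 x16 x17 x18 x19 x20 x21 x22 x23 x24 x25 x26 x27 x28 x29) = Arcs
       x21 x24 x27
       x15 x18 x28
       x12 x19 x25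
       x13 x16 x22
       x6 x9 x29
       x3 x10 x26
       x4 x7 x23
       x0 x11 x20
       x1 x8 x17
       x2 x5 x14"

text \<open>Recoloring at a branch vertex p: the arc from q3 to p is obtained iff the arcs into p
  from its other two neighbours lie in the two sets, one in each. The result is what a third thread
  has to meet.\<close>

fun join :: "arcset \<Rightarrow> arcset \<Rightarrow> arcset" where
  "join (Arcs x0 x1 x2 x3 x4 x5 x6 x7 x8 x9 x10 x11 x12 x13 x14 x15 x16 x17 x18 x19 x20 x21 x22 x23 x24 x25 x26 x27 x28 x29)
        (Arcs y0 y1 y2 y3 y4 y5 y6 y7 y8 y9 y10 y11 y12 y13 y14 y15 y16 y17 y18 y19 y20 y21 y22 y23 y24 y25 y26 y27 y28 y29) = Arcs
       (x11 \<and> y20 \<or> x20 \<and> y11) (x8 \<and> y17 \<or> x17 \<and> y8) (x5 \<and> y14 \<or> x14 \<and> y5)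
       (x10 \<and> y26 \<or> x26 \<and> y10) (x7 \<and> y23 \<or> x23 \<and> y7) (x2 \<and> y14 \<or> x14 \<and> y2)
       (x9 \<and> y29 \<or> x29 \<and> y9) (x4 \<and> y23 \<or> x23 \<and> y4) (x1 \<and> y17 \<or> x17 \<and> y1)
       (x6 \<and> y29 \<or> x29 \<and> y6) (x3 \<and> y26 \<or> x26 \<and> y3) (x0 \<and> y20 \<or> x20 \<and> y0)
       (x19 \<and> y25 \<or> x25 \<and> y19) (x16 \<and> y22 \<or> x22 \<and> y16) (x2 \<and> y5 \<or> x5 \<and> y2)
       (x18 \<and> y28 \<or> x28 \<and> y18) (x13 \<and> y22 \<or> x22 \<and> y13) (x1 \<and> y8 \<or> x8 \<and> y1)
       (x15 \<and> y28 \<or> x28 \<and> y15) (x12 \<and> y25 \<or> x25 \<and> y12) (x0 \<and> y11 \<or> x11 \<and> y0)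
       (x24 \<and> y27 \<or> x27 \<and> y24) (x13 \<and> y16 \<or> x16 \<and> y13) (x4 \<and> y7 \<or> x7 \<and> y4)
       (x21 \<and> y27 \<or> x27 \<and> y21) (x12 \<and> y19 \<or> x19 \<and> y12) (x3 \<and> y10 \<or> x10 \<and> y3)
       (x21 \<and> y24 \<or> x24 \<and> y21) (x15 \<and> y18 \<or> x18 \<and> y15) (x6 \<and> y9 \<or> x9 \<and> y6)"

fun arcs_union :: "arcset \<Rightarrow> arcset \<Rightarrow> arcset" where
  "arcs_union (Arcs x0 x1 x2 x3 x4 x5 x6 x7 x8 x9 x10 x11 x12 x13 x14 x15 x16 x17 x18 x19 x20 x21 x22 x23 x24 x25 x26 x27 x28 x29)
        (Arcs y0 y1 y2 y3 y4 y5 y6 y7 y8 y9 y10 y11 y12 y13 y14 y15 y16 y17 y18 y19 y20 y21 y22 y23 y24 y25 y26 y27 y28 y29) = Arcs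
       (x0 \<or> y0) (x1 \<or> y1) (x2 \<or> y2)
       (x3 \<or> y3) (x4 \<or> y4) (x5 \<or> y5)
       (x6 \<or> y6) (x7 \<or> y7) (x8 \<or> y8)
       (x9 \<or> y9) (x10 \<or> y10) (x11 \<or> y11)
       (x12 \<or> y12) (x13 \<or> y13) (x14 \<or> y14)
       (x15 \<or> y15) (x16 \<or> y16) (x17 \<or> y17)
       (x18 \<or> y18) (x19 \<or> y19) (x20 \<or> y20)
       (x21 \<or> y21) (x22 \<or> y22) (x23 \<or> y23)
       (x24 \<or> y24) (x25 \<or> y25) (x26 \<or> y26)
       (x27 \<or> y27) (x28 \<or> y28) (x29 \<or> y29)"

fun meets :: "arcset \<Rightarrow> arcset \<Rightarrow> bool" where
  "meets (Arcs x0 x1 x2 x3 x4 x5 x6 x7 x8 x9 x10 x11 x12 x13 x14 x15 x16 x17 x18 x19 x20 x21 x22 x23 x24 x25 x26 x27 x28 x29)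
        (Arcs y0 y1 y2 y3 y4 y5 y6 y7 y8 y9 y10 y11 y12 y13 y14 y15 y16 y17 y18 y19 y20 y21 y22 y23 y24 y25 y26 y27 y28 y29) \<longleftrightarrow>
       x0 \<and> y0 \<or> x1 \<and> y1 \<or> x2 \<and> y2 \<or>
       x3 \<and> y3 \<or> x4 \<and> y4 \<or> x5 \<and> y5 \<or>
       x6 \<and> y6 \<or> x7 \<and> y7 \<or> x8 \<and> y8 \<or>
       x9 \<and> y9 \<or> x10 \<and> y10 \<or> x11 \<and> y11 \<or>
       x12 \<and> y12 \<or> x13 \<and> y13 \<or> x14 \<and> y14 \<or>
       x15 \<and> y15 \<or> x16 \<and> y16 \<or> x17 \<and> y17 \<or>
       x18 \<and> y18 \<or> x19 \<and> y19 \<or> x20 \<and> y20 \<or>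
       x21 \<and> y21 \<or> x22 \<and> y22 \<or> x23 \<and> y23 \<or>
       x24 \<and> y24 \<or> x25 \<and> y25 \<or> x26 \<and> y26 \<or>
       x27 \<and> y27 \<or> x28 \<and> y28 \<or> x29 \<and> y29"

primrec rows :: "(bool \<Rightarrow> bool \<Rightarrow> bool \<Rightarrow> bool) \<Rightarrow> arcset \<Rightarrow> bool list" where
  "rows g (Arcs x0 x1 x2 x3 x4 x5 x6 x7 x8 x9 x10 x11 x12 x13 x14 x15 x16 x17 x18 x19 x20 x21 x22 x23 x24 x25 x26 x27 x28 x29) =
       [g x0 x1 x2, g x3 x4 x5, g x6 x7 x8, g x9 x10 x11, g x12 x13 x14, g x15 x16 x17, g x18 x19 x20, g x21 x22 x23, g x24 x25 x26, g x27 x28 x29]"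

definition padj :: "pvert \<Rightarrow> pvert \<Rightarrow> bool" where
  "padj p q \<longleftrightarrow> q \<in> fst ` set (pnbrs p)"

definition pcol :: "pvert \<Rightarrow> pvert \<Rightarrow> color" where
  "pcol p q = the (map_of (pnbrs p) q)"

definition fan :: "pvert \<Rightarrow> pvert \<Rightarrow> pvert \<Rightarrow> pvert \<Rightarrow> bool" where
  "fan p q1 q2 q3 \<longleftrightarrow> padj q1 p \<and> padj q2 p \<and> padj q3 p \<and> q1 \<noteq> q2 \<and> q1 \<noteq> q3 \<and> q2 \<noteq> q3"

definition pverts :: "pvert list" where
  "pverts = [P01, P02, P03, P04, P12, P13, P14, P23, P24, P34]"

lemma set_pverts: "set pverts = UNIV"
proof -
  have "p \<in> set pverts" for p
    by (cases p) (simp_all add: pverts_def)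
  then show ?thesis by auto
qed

lemma ex_pvert:
  "(\<exists>p. Q p) \<longleftrightarrow> Q P01 \<or> Q P02 \<or> Q P03 \<or> Q P04 \<or> Q P12 \<or> Q P13 \<or> Q P14 \<or> Q P23 \<or> Q P24 \<or> Q P34"
proof -
  have "(\<exists>p. Q p) \<longleftrightarrow> (\<exists>p \<in> set pverts. Q p)"
    by (simp add: set_pverts)
  then show ?thesis by (simp add: pverts_def)
qed

lemma all_pvert:
  "(\<forall>p. Q p) \<longleftrightarrow> Q P01 \<and> Q P02 \<and> Q P03 \<and> Q P04 \<and> Q P12 \<and> Q P13 \<and> Q P14 \<and> Q P23 \<and> Q P24 \<and> Q P34"
proof -
  have "(\<forall>p. Q p) \<longleftrightarrow> (\<forall>p \<in> set pverts. Q p)"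
    by (simp add: set_pverts)
  then show ?thesis by (simp add: pverts_def)
qed

lemma padj_sym: "padj p q \<Longrightarrow> padj q p"
proof -
  have "\<forall>p q. padj p q \<longrightarrow> padj q p"
    by (simp add: all_pvert padj_def)
  then show "padj p q \<Longrightarrow> padj q p" by blast
qed

lemma pcol_sym: "padj p q \<Longrightarrow> pcol p q = pcol q p"
proof -
  have "\<forall>p q. padj p q \<longrightarrow> pcol p q = pcol q p"
    by (simp add: all_pvert padj_def pcol_def)
  then show "padj p q \<Longrightarrow> pcol p q = pcol q p" by blast
qed

lemma pcol_inj: "padj p q \<Longrightarrow> padj p r \<Longrightarrow> pcol p q = pcol p r \<Longrightarrow> q = r"
  by (cases p) (auto simp: padj_def pcol_def)

lemma mem_pnbrs: "padj p q \<Longrightarrow> (q, pcol p q) \<in> set (pnbrs p)"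
  by (cases p) (auto simp: padj_def pcol_def)

text \<open>As p and q are disjoint pairs of colors, the edges at p other than pq carry the two
  elements of q, and those at q the two elements of p. This is why local injectivity yields strong
  colorings.\<close>

lemma pcol_across:
  assumes "padj p q" "padj p r" "padj q s" "r \<noteq> q" "s \<noteq> p"
  shows "pcol p r \<noteq> pcol q s"
proof -
  have "list_all (\<lambda>p. list_all (\<lambda>q. list_all (\<lambda>r. fst r = fst q \<or>
      list_all (\<lambda>s. fst s = p \<or> snd r \<noteq> snd s) (pnbrs (fst q))) (pnbrs p)) (pnbrs p)) pverts"
    by code_simp
  then have "\<forall>p. \<forall>q \<in> set (pnbrs p). \<forall>r \<in> set (pnbrs p). fst r = fst q \<or>
      (\<forall>s \<in> set (pnbrs (fst q)). fst s = p \<or> snd r \<noteq> snd s)"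
    by (simp only: list_all_iff set_pverts UNIV_I ball_UNIV)
  from bspec[OF bspec[OF spec[OF this, of p] mem_pnbrs[OF assms(1)]] mem_pnbrs[OF assms(2)]]
  show ?thesis
    using mem_pnbrs[OF assms(3)] assms(4,5) by auto
qed

lemma third_pnbr:
  assumes "padj p q" "padj p r" "q \<noteq> r"
  obtains s where "padj p s" "s \<noteq> q" "s \<noteq> r"
  using assms by (cases p) (auto simp: padj_def)

definition colors :: "color list" where
  "colors = [C0, C1, C2, C3, C4]"

lemma set_colors: "set colors = UNIV"
proof -
  have "c \<in> set colors" for c
    by (cases c) (simp_all add: colors_def)
  then show ?thesis by auto
qed

text \<open>Any pair of colors outside \<open>A\<close> serves as p. In this way a Petersen vertex
  is read off at a vertex with given edge colors, even if it has fewer than three edges.\<close>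

lemma pvert_with_colors:
  assumes "card (A :: color set) \<le> 3"
  obtains p where "\<And>c. c \<in> A \<Longrightarrow> \<exists>q. padj p q \<and> pcol p q = c"
proof -
  have fin: "finite (UNIV :: color set)" and "card (UNIV :: color set) = 5"
    unfolding set_colors[symmetric] by (simp_all add: colors_def)
  then have "card (- A) \<ge> 2"
    using assms by (simp add: Compl_eq_Diff_UNIV card_Diff_subset finite_subset[OF subset_UNIV fin])
  then obtain B where "B \<subseteq> - A" "card B = 2"
    by (meson obtain_subset_with_card_n)
  then obtain a b where ab: "a \<noteq> b" "a \<notin> A" "b \<notin> A"
    by (auto simp: card_2_iff)
  have "list_all (\<lambda>a. list_all (\<lambda>b. a = b \<or> list_ex (\<lambda>p. list_all (\<lambda>c. c = a \<or> c = b \<or> c \<in> snd ` set (pnbrs p))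
      colors) pverts) colors) colors"
    by code_simp
  then have "\<forall>a b. a = b \<or> (\<exists>p. \<forall>c. c = a \<or> c = b \<or> c \<in> snd ` set (pnbrs p))"
    by (simp only: list_all_iff list_ex_iff set_pverts set_colors ball_UNIV bex_UNIV simp_thms)
  then obtain p where "\<forall>c. c = a \<or> c = b \<or> c \<in> snd ` set (pnbrs p)"
    using ab by blast
  moreover have "(q, c) \<in> set (pnbrs p) \<Longrightarrow> padj p q \<and> pcol p q = c" for p q c
    by (cases p) (auto simp: padj_def pcol_def)
  ultimately show ?thesis
    using that[of p] ab by (metis imageE prod.collapse)
qed

lemma fan_permute:
  "fan p q1 q2 q3 \<Longrightarrow> fan p q2 q1 q3" "fan p q1 q2 q3 \<Longrightarrow> fan p q1 q3 q2" "fan p q1 q2 q3 \<Longrightarrow> fan p q3 q2 q1"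
  by (auto simp: fan_def)


text \<open>A walk with first arc p q and last arc r s, where k counts the vertices strictly between
  p and s. It thus fits a thread with k interior vertices; for k = 0 both arcs coincide.\<close>

primrec reach :: "nat \<Rightarrow> pvert \<Rightarrow> pvert \<Rightarrow> pvert \<Rightarrow> pvert \<Rightarrow> bool" where
  "reach 0 p q = (\<lambda>r s. padj p q \<and> r = p \<and> s = q)"
| "reach (Suc k) p q = (\<lambda>r s. padj r s \<and> (\<exists>t. t \<noteq> s \<and> reach k p q t r))"

lemma reach_padj: "reach k p q r s \<Longrightarrow> padj p q \<and> padj r s"
  by (induction k arbitrary: r s) auto

lemma reach_Suc_left:
  "padj p q \<Longrightarrow> padj q r \<Longrightarrow> p \<noteq> r \<Longrightarrow> reach k q r s t \<Longrightarrow> reach (Suc k) p q s t"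
  by (induction k arbitrary: s t) auto

lemma arcs_of_cong: "(\<And>p q. padj p q \<Longrightarrow> f p q \<longleftrightarrow> g p q) \<Longrightarrow> arcs_of f = arcs_of g"
  by (simp add: arcs_of_def padj_def)

lemma ex_padj: "(\<exists>q. padj p q \<and> Q q) \<longleftrightarrow> (\<exists>x \<in> set (pnbrs p). Q (fst x))"
  by (auto simp: padj_def)

lemma advance_arcs_of:
  "advance (arcs_of f) = arcs_of (\<lambda>q r. padj q r \<and> (\<exists>p. padj q p \<and> p \<noteq> r \<and> f p q))"
  unfolding ex_padj by (simp add: arcs_of_def padj_def)

lemma flip_arcs_of: "flip (arcs_of f) = arcs_of (\<lambda>p q. f q p)"
  by (simp add: arcs_of_def)

lemma join_arcs_of:
  "join (arcs_of f) (arcs_of g) = arcs_of (\<lambda>q3 p. padj p q3 \<and> 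
    (\<exists>q1. padj p q1 \<and> q1 \<noteq> q3 \<and> f q1 p \<and> (\<exists>q2. padj p q2 \<and> q2 \<noteq> q3 \<and> q1 \<noteq> q2 \<and> g q2 p)))"
  unfolding ex_padj by (simp add: arcs_of_def padj_def)

lemma arcs_union_arcs_of:
  "arcs_union (arcs_of f) (arcs_of g) = arcs_of (\<lambda>p q. f p q \<or> g p q)"
  by (simp add: arcs_of_def)

lemma meets_arcs_of: "meets (arcs_of f) (arcs_of g) \<longleftrightarrow> (\<exists>p. \<exists>q. padj p q \<and> f p q \<and> g p q)"
  unfolding ex_padj ex_pvert by (simp add: arcs_of_def)
definition arc_singletons :: "arcset list" where
  "arc_singletons = concat (map (\<lambda>p. map (\<lambda>x. arcs_of (\<lambda>r s. r = p \<and> s = fst x)) (pnbrs p)) pverts)"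

definition reached :: "nat \<Rightarrow> arcset list" where
  "reached k = map (advance ^^ k) arc_singletons"

lemma funpow_advance_arcs_of:
  assumes "padj p q"
  shows "(advance ^^ k) (arcs_of (\<lambda>r s. r = p \<and> s = q)) = arcs_of (reach k p q)"
proof (induction k)
  case 0
  show ?case
    using assms by (auto intro: arcs_of_cong)
next
  case (Suc k)
  show ?case
    by (auto simp: Suc advance_arcs_of intro!: arcs_of_cong dest: reach_padj padj_sym)
qed

lemma reached_mem:
  assumes "padj p q"
  shows "arcs_of (reach k p q) \<in> set (reached k)"
proof -
  have "arcs_of (\<lambda>r s. r = p \<and> s = q) \<in> set arc_singletons"
    unfolding arc_singletons_def set_concat set_map set_pverts image_image
    using mem_pnbrs[OF assms] by (intro UN_I[of p] rev_image_eqI[of "(q, pcol p q)"]) auto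
  then have "(advance ^^ k) (arcs_of (\<lambda>r s. r = p \<and> s = q)) \<in> set (reached k)"
    by (simp add: reached_def)
  then show ?thesis
    by (simp add: funpow_advance_arcs_of[OF assms])
qed

text \<open>Every arc can be continued without backtracking, so the first l - k steps may be taken
  in any way. Hence additional interior vertices never hurt, which gives the monotonicity of all
  configurations.\<close>

lemma reach_shift:
  assumes "padj p q" "k \<le> l"
  obtains p' q' where "padj p' q'" "\<And>r s. reach k p' q' r s \<Longrightarrow> reach l p q r s"
proof -
  have "\<exists>p' q'. padj p' q' \<and> (\<forall>r s. reach k p' q' r s \<longrightarrow> reach (k + n) p q r s)" for n
    using assms(1)
  proof (induction n arbitrary: p q)
    case (Suc n)
    obtain r where r: "padj q r" "r \<noteq> p"
      using Suc.prems by (cases q) (auto simp: padj_def)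
    from Suc.IH[OF this(1)] obtain p' q' where
      "padj p' q'" "\<And>t s. reach k p' q' t s \<Longrightarrow> reach (k + n) q r t s" by blast
    then show ?case
      using reach_Suc_left[OF Suc.prems r(1)] r(2) by (metis add_Suc_right)
  qed auto
  from this[of "l - k"] show ?thesis using assms(2) that by auto
qed

text \<open>The configurations, in terms of the Petersen graph alone. The arcs s t are prescribed by
  the old coloring at the ends that are kept; nothing is known about them, hence the universal
  quantifiers. A tripod recolors one branch vertex; the others recolor two, joined by one thread
  (\<open>dumbbell\<close>), two (\<open>twin\<close>) or three (\<open>theta\<close>).\<close>

definition tripod :: "nat \<Rightarrow> nat \<Rightarrow> nat \<Rightarrow> bool" where
  "tripod a b c \<longleftrightarrow> (\<forall>s1 t1 s2 t2 s3 t3. padj s1 t1 \<longrightarrow> padj s2 t2 \<longrightarrow> padj s3 t3 \<longrightarrow>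
    (\<exists>p q1 q2 q3. fan p q1 q2 q3 \<and> reach a s1 t1 q1 p \<and> reach b s2 t2 q2 p \<and> reach c s3 t3 q3 p))"

definition dumbbell :: "nat \<Rightarrow> nat \<Rightarrow> nat \<Rightarrow> nat \<Rightarrow> nat \<Rightarrow> bool" where
  "dumbbell k a b c d \<longleftrightarrow> (\<forall>s1 t1 s2 t2 s3 t3 s4 t4. padj s1 t1 \<longrightarrow> padj s2 t2 \<longrightarrow> padj s3 t3 \<longrightarrow> padj s4 t4 \<longrightarrow>
    (\<exists>p q1 q2 q3 p' q1' q2' q3'. fan p q1 q2 q3 \<and> fan p' q1' q2' q3' \<and> reach k p q3 q3' p' \<and>
      reach a s1 t1 q1 p \<and> reach b s2 t2 q2 p \<and> reach c s3 t3 q1' p' \<and> reach d s4 t4 q2' p'))"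

definition twin :: "nat \<Rightarrow> nat \<Rightarrow> nat \<Rightarrow> nat \<Rightarrow> bool" where
  "twin k a b d \<longleftrightarrow> (\<forall>s1 t1 s2 t2. padj s1 t1 \<longrightarrow> padj s2 t2 \<longrightarrow>
    (\<exists>p q1 q2 q3 p' q1' q2' q3'. fan p q1 q2 q3 \<and> fan p' q1' q2' q3' \<and> reach k p' q1' q1 p \<and> reach a p' q2' q2 p \<and>
      reach b s1 t1 q3 p \<and> reach d s2 t2 q3' p'))"

definition theta :: "nat \<Rightarrow> nat \<Rightarrow> nat \<Rightarrow> bool" where
  "theta a b c \<longleftrightarrow> (\<exists>p q1 q2 q3 p' q1' q2' q3'. fan p q1 q2 q3 \<and> fan p' q1' q2' q3' \<and>
    reach a p' q1' q1 p \<and> reach b p' q2' q2 p \<and> reach c p' q3' q3 p)"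

lemma tripod_mono:
  assumes "tripod a b c" "a \<le> a'" "b \<le> b'" "c \<le> c'"
  shows "tripod a' b' c'"
  unfolding tripod_def
proof (intro allI impI)
  fix s1 t1 s2 t2 s3 t3
  assume "padj s1 t1" "padj s2 t2" "padj s3 t3"
  obtain u1 v1 where r1: "padj u1 v1" "\<And>r s. reach a u1 v1 r s \<Longrightarrow> reach a' s1 t1 r s"
    using reach_shift[OF \<open>padj s1 t1\<close> \<open>a \<le> a'\<close>] by blast
  obtain u2 v2 where r2: "padj u2 v2" "\<And>r s. reach b u2 v2 r s \<Longrightarrow> reach b' s2 t2 r s"
    using reach_shift[OF \<open>padj s2 t2\<close> \<open>b \<le> b'\<close>] by blast
  obtain u3 v3 where r3: "padj u3 v3" "\<And>r s. reach c u3 v3 r s \<Longrightarrow> reach c' s3 t3 r s"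
    using reach_shift[OF \<open>padj s3 t3\<close> \<open>c \<le> c'\<close>] by blast
  from assms(1)[unfolded tripod_def, rule_format, OF r1(1) r2(1) r3(1)]
  show "\<exists>p q1 q2 q3. fan p q1 q2 q3 \<and> reach a' s1 t1 q1 p \<and> reach b' s2 t2 q2 p \<and> reach c' s3 t3 q3 p"
    using r1(2) r2(2) r3(2) by blast
qed

lemma dumbbell_mono:
  assumes "dumbbell k a b c d" "a \<le> a'" "b \<le> b'" "c \<le> c'" "d \<le> d'"
  shows "dumbbell k a' b' c' d'"
  unfolding dumbbell_def
proof (intro allI impI)
  fix s1 t1 s2 t2 s3 t3 s4 t4
  assume "padj s1 t1" "padj s2 t2" "padj s3 t3" "padj s4 t4"
  obtain u1 v1 where r1: "padj u1 v1" "\<And>r s. reach a u1 v1 r s \<Longrightarrow> reach a' s1 t1 r s"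
    using reach_shift[OF \<open>padj s1 t1\<close> \<open>a \<le> a'\<close>] by blast
  obtain u2 v2 where r2: "padj u2 v2" "\<And>r s. reach b u2 v2 r s \<Longrightarrow> reach b' s2 t2 r s"
    using reach_shift[OF \<open>padj s2 t2\<close> \<open>b \<le> b'\<close>] by blast
  obtain u3 v3 where r3: "padj u3 v3" "\<And>r s. reach c u3 v3 r s \<Longrightarrow> reach c' s3 t3 r s"
    using reach_shift[OF \<open>padj s3 t3\<close> \<open>c \<le> c'\<close>] by blast
  obtain u4 v4 where r4: "padj u4 v4" "\<And>r s. reach d u4 v4 r s \<Longrightarrow> reach d' s4 t4 r s"
    using reach_shift[OF \<open>padj s4 t4\<close> \<open>d \<le> d'\<close>] by blast
  from assms(1)[unfolded dumbbell_def, rule_format, OF r1(1) r2(1) r3(1) r4(1)] 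
  show "\<exists>p q1 q2 q3 p' q1' q2' q3'. fan p q1 q2 q3 \<and> fan p' q1' q2' q3' \<and> reach k p q3 q3' p' \<and>
      reach a' s1 t1 q1 p \<and> reach b' s2 t2 q2 p \<and> reach c' s3 t3 q1' p' \<and> reach d' s4 t4 q2' p'"
    using r1(2) r2(2) r3(2) r4(2) by blast
qed

lemma twin_mono:
  assumes "twin k a b d" "b \<le> b'" "d \<le> d'"
  shows "twin k a b' d'"
  unfolding twin_def
proof (intro allI impI)
  fix s1 t1 s2 t2
  assume "padj s1 t1" "padj s2 t2"
  obtain u1 v1 where r1: "padj u1 v1" "\<And>r s. reach b u1 v1 r s \<Longrightarrow> reach b' s1 t1 r s"
    using reach_shift[OF \<open>padj s1 t1\<close> \<open>b \<le> b'\<close>] by blast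
  obtain u2 v2 where r2: "padj u2 v2" "\<And>r s. reach d u2 v2 r s \<Longrightarrow> reach d' s2 t2 r s"
    using reach_shift[OF \<open>padj s2 t2\<close> \<open>d \<le> d'\<close>] by blast
  from assms(1)[unfolded twin_def, rule_format, OF r1(1) r2(1)] 
  show "\<exists>p q1 q2 q3 p' q1' q2' q3'. fan p q1 q2 q3 \<and> fan p' q1' q2' q3' \<and> reach k p' q1' q1 p \<and> reach a p' q2' q2 p \<and>
      reach b' s1 t1 q3 p \<and> reach d' s2 t2 q3' p'"
    using r1(2) r2(2) by blast
qed

text \<open>If the arcs missed by \<open>f\<close> all leave one vertex, \<open>f\<close> meets every \<open>g\<close> having arcs leaving two.\<close>

definition one_row_short :: "arcset \<Rightarrow> bool" where
  "one_row_short S \<longleftrightarrow> length (filter Not (rows (\<lambda>x y z. x \<and> y \<and> z) S)) \<le> 1"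

definition two_rows :: "arcset \<Rightarrow> bool" where
  "two_rows S \<longleftrightarrow> length (filter id (rows (\<lambda>x y z. x \<or> y \<or> z) S)) > 1"

lemma distinct_pverts: "distinct pverts"
  by (simp add: pverts_def)

lemma rows_all: "rows (\<lambda>x y z. x \<and> y \<and> z) (arcs_of f) = map (\<lambda>p. \<forall>q. padj p q \<longrightarrow> f p q) pverts"
proof -
  have "(\<forall>q. padj p q \<longrightarrow> f p q) \<longleftrightarrow> (\<forall>x \<in> set (pnbrs p). f p (fst x))" for p
    by (auto simp: padj_def)
  then show ?thesis by (simp add: arcs_of_def pverts_def)
qed

lemma rows_ex: "rows (\<lambda>x y z. x \<or> y \<or> z) (arcs_of f) = map (\<lambda>p. \<exists>q. padj p q \<and> f p q) pverts"
  unfolding ex_padj by (simp add: arcs_of_def pverts_def)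

lemma one_row_short_meets_two_rows:
  assumes "one_row_short (arcs_of f)" "two_rows (arcs_of g)"
  shows "\<exists>p q. padj p q \<and> f p q \<and> g p q"
proof -
  define F where "F = filter (\<lambda>p. \<not> (\<forall>q. padj p q \<longrightarrow> f p q)) pverts"
  define G where "G = filter (\<lambda>p. \<exists>q. padj p q \<and> g p q) pverts"
  have "length F \<le> 1"
    using assms(1) by (simp add: one_row_short_def rows_all F_def filter_map comp_def)
  moreover have "length G > 1"
    using assms(2) by (simp add: two_rows_def rows_ex G_def filter_map comp_def)
  moreover have "distinct F" "distinct G"
    by (simp_all add: F_def G_def distinct_pverts)
  ultimately have "card (set F) < card (set G)"
    by (simp add: distinct_card)
  then obtain p where "p \<in> set G" "p \<notin> set F"
    by (meson List.finite_set card_mono not_le subsetI)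
  then show ?thesis
    by (auto simp: F_def G_def set_pverts)
qed

text \<open>Eight is optimal: seven steps from an arc back to itself would close up to a cycle of
  length seven in the Petersen graph. After seven steps at most one vertex has leaving arcs that are
  not reached, which is used in \<open>tripods\<close>.\<close>

lemma reach_8:
  assumes "padj p q" "padj r s"
  shows "reach 8 p q r s"
proof -
  have "list_all (\<lambda>S. list_all id (rows (\<lambda>x y z. x \<and> y \<and> z) S)) (reached 8)"
    by code_simp
  then have "list_all id (rows (\<lambda>x y z. x \<and> y \<and> z) (arcs_of (reach 8 p q)))"
    using reached_mem[OF assms(1), of 8] unfolding list_all_iff[of _ "reached 8"] by blast
  then have "list_all id (map (\<lambda>r. \<forall>s. padj r s \<longrightarrow> reach 8 p q r s) pverts)"
    unfolding rows_all .
  then show ?thesis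
    using assms(2) by (simp add: list_all_iff set_pverts)
qed

definition all_joins :: "(arcset \<Rightarrow> bool) \<Rightarrow> arcset list \<Rightarrow> arcset list \<Rightarrow> bool" where
  "all_joins P As Bs \<longleftrightarrow> list_all (\<lambda>S. list_all (\<lambda>T. P (join S T)) Bs) As"

lemma all_joinsD:
  assumes "all_joins P (reached a) (reached b)" "padj s1 t1" "padj s2 t2"
  shows "P (arcs_of (\<lambda>q3 p. \<exists>q1 q2. fan p q1 q2 q3 \<and> reach a s1 t1 q1 p \<and> reach b s2 t2 q2 p))"
proof -
  have "P (join (arcs_of (reach a s1 t1)) (arcs_of (reach b s2 t2)))"
    using assms reached_mem unfolding all_joins_def list_all_iff by blast
  also have "join (arcs_of (reach a s1 t1)) (arcs_of (reach b s2 t2)) =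
      arcs_of (\<lambda>q3 p. \<exists>q1 q2. fan p q1 q2 q3 \<and> reach a s1 t1 q1 p \<and> reach b s2 t2 q2 p)"
    unfolding join_arcs_of by (rule arcs_of_cong) (auto simp: fan_def dest: padj_sym)
  finally show ?thesis .
qed

definition all_tripods :: "arcset list \<Rightarrow> arcset list \<Rightarrow> arcset list \<Rightarrow> bool" where
  "all_tripods As Bs Cs \<longleftrightarrow> all_joins (\<lambda>S. list_all (meets S) Cs) As Bs"

lemma tripodI:
  assumes "all_tripods (reached a) (reached b) (reached c)"
  shows "tripod a b c"
  unfolding tripod_def
proof (intro allI impI)
  fix s1 t1 s2 t2 s3 t3
  assume "padj s1 t1" "padj s2 t2" "padj s3 t3"
  then have "meets (arcs_of (\<lambda>q3 p. \<exists>q1 q2. fan p q1 q2 q3 \<and> reach a s1 t1 q1 p \<and> reach b s2 t2 q2 p))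
      (arcs_of (reach c s3 t3))"
    using all_joinsD[OF assms[unfolded all_tripods_def]] reached_mem by (simp only: list_all_iff)
  then show "\<exists>p q1 q2 q3. fan p q1 q2 q3 \<and> reach a s1 t1 q1 p \<and> reach b s2 t2 q2 p \<and> reach c s3 t3 q3 p"
    unfolding meets_arcs_of by blast
qed

lemma funpow_advance:
  "(advance ^^ k) (arcs_of f) = arcs_of (\<lambda>r s. \<exists>p q. padj p q \<and> f p q \<and> reach k p q r s)"
proof (induction k)
  case 0
  show ?case by (auto intro!: arcs_of_cong)
next
  case (Suc k)
  show ?case
    by (auto simp: Suc advance_arcs_of intro!: arcs_of_cong dest: reach_padj padj_sym)
qed

text \<open>Cutting at the end of the middle thread decouples the halves: 900 pairs of starting arcs
  are checked for each, instead of all quadruples. As \<open>join\<close> yields arcs into p, they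
  are flipped before walking on along the middle thread.\<close>

lemma dumbbellI:
  assumes "all_joins (\<lambda>S. one_row_short ((advance ^^ k) (flip S))) (reached a) (reached b)"
    and "all_joins two_rows (reached c) (reached d)"
  shows "dumbbell k a b c d"
  unfolding dumbbell_def
proof (intro allI impI)
  fix s1 t1 s2 t2 s3 t3 s4 t4
  assume p: "padj s1 t1" "padj s2 t2" "padj s3 t3" "padj s4 t4"
  let ?f = "\<lambda>q3 p. \<exists>q1 q2. fan p q1 q2 q3 \<and> reach a s1 t1 q1 p \<and> reach b s2 t2 q2 p"
  let ?g = "\<lambda>q3 p. \<exists>q1 q2. fan p q1 q2 q3 \<and> reach c s3 t3 q1 p \<and> reach d s4 t4 q2 p"
  have "one_row_short ((advance ^^ k) (flip (arcs_of ?f)))" "two_rows (arcs_of ?g)"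
    using all_joinsD[OF assms(1) p(1,2)] all_joinsD[OF assms(2) p(3,4)] .
  then have "\<exists>r s. padj r s \<and> (\<exists>p q. padj p q \<and> ?f q p \<and> reach k p q r s) \<and> ?g r s"
    unfolding flip_arcs_of funpow_advance by (rule one_row_short_meets_two_rows)
  then show "\<exists>p q1 q2 q3 p' q1' q2' q3'. fan p q1 q2 q3 \<and> fan p' q1' q2' q3' \<and> reach k p q3 q3' p' \<and>
      reach a s1 t1 q1 p \<and> reach b s2 t2 q2 p \<and> reach c s3 t3 q1' p' \<and> reach d s4 t4 q2' p'"
    by blast
qed

lemma one_row_short_joins:
  "all_joins (\<lambda>S. one_row_short ((advance ^^ 0) (flip S))) (reached 6) (reached 7)"
  "all_joins (\<lambda>S. one_row_short ((advance ^^ 1) (flip S))) (reached 5) (reached 7)"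
  "all_joins (\<lambda>S. one_row_short ((advance ^^ 1) (flip S))) (reached 6) (reached 6)"
  "all_joins (\<lambda>S. one_row_short ((advance ^^ 2) (flip S))) (reached 4) (reached 7)"
  "all_joins (\<lambda>S. one_row_short ((advance ^^ 3) (flip S))) (reached 3) (reached 7)"
  by code_simp+

lemma two_rows_joins:
  "all_joins two_rows (reached 1) (reached 6)" "all_joins two_rows (reached 2) (reached 5)" "all_joins two_rows (reached 3) (reached 4)"
  by code_simp+

text \<open>The alternatives for k, a, b cover the lengths at a branch vertex of load above 12, with
  k the shortest; those for c and d cover each sum of at least 8 with parts at most 7.\<close>

lemma dumbbells:
  assumes "k = 0 \<and> 6 \<le> a \<and> 7 \<le> b \<or> k = 1 \<and> 5 \<le> a \<and> 7 \<le> b \<or> k = 1 \<and> 6 \<le> a \<and> 6 \<le> b \<or>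
      k = 2 \<and> 4 \<le> a \<and> 7 \<le> b \<or> k = 3 \<and> 3 \<le> a \<and> 7 \<le> b"
    and "1 \<le> c \<and> 6 \<le> d \<or> 2 \<le> c \<and> 5 \<le> d \<or> 3 \<le> c \<and> 4 \<le> d"
  shows "dumbbell k a b c d"
  using assms
  by (elim disjE conjE) (simp_all only:, (rule dumbbell_mono[OF dumbbellI], rule one_row_short_joins, rule two_rows_joins, assumption+)+)

lemma tripods: "tripod 1 6 7" "tripod 2 5 6" "tripod 3 4 5"
proof -
  show "tripod 1 6 7"
    unfolding tripod_def
  proof (intro allI impI)
    fix s1 t1 s2 t2 s3 t3
    assume p: "padj s1 t1" "padj s2 t2" "padj s3 t3"
    \<comment> \<open>The longest thread misses arcs at one vertex at most, so a pigeonhole argument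
      replaces the check of all triples of starting arcs.\<close>
    have "list_all one_row_short (reached 7)" by code_simp
    then have "one_row_short (arcs_of (reach 7 s3 t3))"
      using reached_mem[OF p(3)] by (simp only: list_all_iff)
    from one_row_short_meets_two_rows[OF this all_joinsD[OF two_rows_joins(1) p(1,2)]]
    show "\<exists>p q1 q2 q3. fan p q1 q2 q3 \<and> reach 1 s1 t1 q1 p \<and> reach 6 s2 t2 q2 p \<and> reach 7 s3 t3 q3 p"
      by blast
  qed
  show "tripod 2 5 6" "tripod 3 4 5"
    by (rule tripodI, code_simp)+
qed

text \<open>Two threads leave p by two given arcs. Which thread takes which arc is free, so the
  results of both assignments are united.\<close>

definition twins :: "nat \<Rightarrow> nat \<Rightarrow> arcset list" where
  "twins k a = concat (map (\<lambda>p. concat (map (\<lambda>x. map (\<lambda>y.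
      let f = \<lambda>n z. (advance ^^ n) (arcs_of (\<lambda>r s. r = p \<and> s = fst z))
      in arcs_union (join (f k x) (f a y)) (join (f k y) (f a x))) (filter (\<lambda>y. fst y \<noteq> fst x) (pnbrs p))) (pnbrs p))) pverts)"

definition all_meet :: "arcset list \<Rightarrow> arcset list \<Rightarrow> bool" where
  "all_meet As Bs \<longleftrightarrow> list_all (\<lambda>S. list_all (meets S) Bs) As"

text \<open>The outer thread at p' is taken without interior vertices; \<open>twin_mono\<close> does
  the rest. Then p' and its third neighbour are given, and only the assignment of the other two arcs
  at p' to the joining threads is left to choose.\<close>

lemma twinI:
  assumes "all_meet (twins k a) (reached b)"
  shows "twin k a b 0"
  unfolding twin_def
proof (intro allI impI)
  fix s1 t1 s2 t2
  assume p: "padj s1 t1" "padj s2 t2"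
  obtain x where x: "padj t2 x" "x \<noteq> s2"
    using p(2) by (cases t2) (auto simp: padj_def)
  obtain y where y: "padj t2 y" "y \<noteq> s2" "y \<noteq> x"
    using third_pnbr[OF x(1) padj_sym[OF p(2)]] x(2) by metis
  let ?f = "\<lambda>n q. arcs_of (reach n t2 q)"
  have "arcs_union (join (?f k x) (?f a y)) (join (?f k y) (?f a x)) \<in> set (twins k a)"
    unfolding twins_def set_concat set_map set_pverts image_image Let_def
      funpow_advance_arcs_of[OF x(1), symmetric] funpow_advance_arcs_of[OF y(1), symmetric]
    using mem_pnbrs[OF x(1)] mem_pnbrs[OF y(1)] y(3)
    by (intro UN_I[of t2] UN_I[of "(x, pcol t2 x)"] rev_image_eqI[of "(y, pcol t2 y)"]) auto
  then have "meets (arcs_union (join (?f k x) (?f a y)) (join (?f k y) (?f a x))) (arcs_of (reach b s1 t1))"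
    using assms reached_mem[OF p(1)] by (simp only: all_meet_def list_all_iff)
  then obtain q3 p q1 q2 where "fan p q1 q2 q3" "reach b s1 t1 q3 p"
    "reach k t2 x q1 p \<and> reach a t2 y q2 p \<or> reach k t2 y q1 p \<and> reach a t2 x q2 p"
    unfolding join_arcs_of arcs_union_arcs_of meets_arcs_of fan_def by (metis padj_sym)
  moreover have "fan t2 x y s2" "fan t2 y x s2" "reach 0 s2 t2 s2 t2"
    using p x y by (auto simp: fan_def dest: padj_sym)
  ultimately show "\<exists>p q1 q2 q3 p' q1' q2' q3'. fan p q1 q2 q3 \<and> fan p' q1' q2' q3' \<and> reach k p' q1' q1 p \<and>
      reach a p' q2' q2 p \<and> reach b s1 t1 q3 p \<and> reach 0 s2 t2 q3' p'"
    by blast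
qed

lemma twins_meet:
  "all_meet (twins 0 6) (reached 7)"
  "all_meet (twins 0 7) (reached 6)"
  "all_meet (twins 1 5) (reached 7)"
  "all_meet (twins 1 7) (reached 5)"
  "all_meet (twins 1 6) (reached 6)"
  "all_meet (twins 2 4) (reached 7)"
  "all_meet (twins 2 7) (reached 4)"
  "all_meet (twins 3 3) (reached 7)"
  "all_meet (twins 3 7) (reached 3)"
  by code_simp+

text \<open>Nothing is prescribed from outside in a theta, so a single starting vertex
  suffices.\<close>

lemma thetaI:
  assumes "let f = \<lambda>n q. (advance ^^ n) (arcs_of (\<lambda>r s. r = P01 \<and> s = q))
    in meets (join (f a P23) (f b P24)) (f c P34)"
  shows "theta a b c"
proof -
  have "padj P01 P23" "padj P01 P24" "padj P01 P34"
    by (simp_all add: padj_def)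
  note * = this[THEN funpow_advance_arcs_of]
  have "fan P01 P23 P24 P34"
    by (simp add: fan_def padj_def)
  moreover obtain q3 p q1 q2 where "fan p q1 q2 q3" "reach a P01 P23 q1 p" "reach b P01 P24 q2 p" "reach c P01 P34 q3 p"
    using assms unfolding Let_def * join_arcs_of meets_arcs_of fan_def by (metis padj_sym)
  ultimately show ?thesis
    unfolding theta_def by blast
qed

lemma thetas: "theta 0 6 7" "theta 0 7 7" "theta 1 5 7" "theta 1 6 6" "theta 2 4 7" "theta 3 3 7"
  by (rule thetaI, code_simp)+

section \<open>Minimal uncolorable graphs\<close>

definition nbs :: "'a set set \<Rightarrow> 'a \<Rightarrow> 'a set" where
  "nbs E v = {w. {v, w} \<in> E}"

definition star :: "'a set set \<Rightarrow> 'a \<Rightarrow> 'a set set" where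
  "star E v = {e \<in> E. v \<in> e}"

text \<open>Two distinct edges are within distance two iff both touch the ends of a common edge, so
  a coloring can be checked around one edge at a time.\<close>

definition strong :: "'a set set \<Rightarrow> ('a set \<Rightarrow> 'c) \<Rightarrow> bool" where
  "strong E c \<longleftrightarrow> (\<forall>u v. {u, v} \<in> E \<longrightarrow> inj_on c (star E u \<union> star E v))"

definition colorable :: "'a set set \<Rightarrow> bool" where
  "colorable E \<longleftrightarrow> (\<exists>c :: 'a set \<Rightarrow> color. strong E c)"

definition pendant_cycle :: "'a set set \<Rightarrow> nat \<Rightarrow> nat \<Rightarrow> bool" where
  "pendant_cycle E n k \<longleftrightarrow> (\<exists>f :: nat \<Rightarrow> 'a. inj_on f {..<n + k} \<and>
    (\<forall>i<n. {f i, f (Suc i mod n)} \<in> E) \<and> (\<forall>i<k. {f i, f (n + i)} \<in> E))"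

definition nbwalk :: "('a \<Rightarrow> 'a \<Rightarrow> bool) \<Rightarrow> 'a list \<Rightarrow> bool" where
  "nbwalk R l \<longleftrightarrow> (\<forall>i. Suc i < length l \<longrightarrow> R (l ! i) (l ! Suc i)) \<and>
    (\<forall>i. Suc (Suc i) < length l \<longrightarrow> l ! i \<noteq> l ! Suc (Suc i))"

lemma nbwalk_rev:
  assumes "\<And>x y. R x y \<Longrightarrow> R y x" "nbwalk R l"
  shows "nbwalk R (rev l)"
  unfolding nbwalk_def length_rev
proof (intro conjI allI impI)
  fix i
  assume i: "Suc i < length l"
  then have "R (l ! (length l - Suc (Suc i))) (l ! Suc (length l - Suc (Suc i)))"
    using assms(2) by (simp add: nbwalk_def)
  moreover have "Suc (length l - Suc (Suc i)) = length l - Suc i"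
    using i by simp
  ultimately show "R (rev l ! i) (rev l ! Suc i)"
    using assms(1) i by (simp add: rev_nth)
next
  fix i
  assume i: "Suc (Suc i) < length l"
  then have "l ! (length l - Suc (Suc (Suc i))) \<noteq> l ! Suc (Suc (length l - Suc (Suc (Suc i))))"
    using assms(2) by (simp add: nbwalk_def)
  moreover have "Suc (Suc (length l - Suc (Suc (Suc i)))) = length l - Suc i"
    using i by simp
  ultimately show "rev l ! i \<noteq> rev l ! Suc (Suc i)"
    using i by (simp add: rev_nth)
qed

lemma nbwalk_snoc:
  assumes "nbwalk R l" "length l \<ge> 2" "R (last l) y" "l ! (length l - 2) \<noteq> y"
  shows "nbwalk R (l @ [y])"
  unfolding nbwalk_def
proof (intro conjI allI impI)
  fix i
  assume i: "Suc i < length (l @ [y])"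
  show "R ((l @ [y]) ! i) ((l @ [y]) ! Suc i)"
  proof (cases "Suc i < length l")
    case True
    then show ?thesis using assms(1) by (simp add: nbwalk_def nth_append)
  next
    case False
    then have "i = length l - 1" "l \<noteq> []" using i assms(2) by auto
    then show ?thesis using assms(3) by (simp add: nth_append last_conv_nth)
  qed
next
  fix i
  assume i: "Suc (Suc i) < length (l @ [y])"
  show "(l @ [y]) ! i \<noteq> (l @ [y]) ! Suc (Suc i)"
  proof (cases "Suc (Suc i) < length l")
    case True
    then show ?thesis using assms(1) by (simp add: nbwalk_def nth_append)
  next
    case False
    then have i': "Suc (Suc i) = length l" using i by simp
    then have "(l @ [y]) ! Suc (Suc i) = y" by (simp only: nth_append_length)
    moreover have "(l @ [y]) ! i = l ! (length l - 2)"
    proof -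
      have "i = length l - 2" "i < length l" using i' by simp_all
      then show ?thesis by (metis nth_append)
    qed
    ultimately show ?thesis using assms(4) by simp
  qed
qed

lemma nbwalk_Cons2: "nbwalk R (x # y # l) \<Longrightarrow> R x y"
  unfolding nbwalk_def by (drule conjunct1) (drule spec[of _ 0], simp)

lemma nbwalk_drop:
  assumes "nbwalk R l"
  shows "nbwalk R (drop n l)"
  unfolding nbwalk_def
proof (intro conjI allI impI)
  fix i
  show "R (drop n l ! i) (drop n l ! Suc i)" if "Suc i < length (drop n l)"
    using assms that by (simp add: nbwalk_def)
  show "drop n l ! i \<noteq> drop n l ! Suc (Suc i)" if "Suc (Suc i) < length (drop n l)"
    using assms that by (simp add: nbwalk_def)
qed

lemma reach_walk:
  assumes "reach k p q r s"
  obtains vs where "length vs = k" "nbwalk padj (p # vs @ [s])" "hd (vs @ [s]) = q" "last (p # vs) = r"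
proof -
  have "\<exists>vs. length vs = k \<and> nbwalk padj (p # vs @ [s]) \<and> hd (vs @ [s]) = q \<and> last (p # vs) = r"
    using assms
  proof (induction k arbitrary: r s)
    case 0
    then show ?case by (auto simp: nbwalk_def less_Suc_eq)
  next
    case (Suc k)
    then obtain t where t: "padj r s" "t \<noteq> s" "reach k p q t r" by auto
    then obtain vs where vs: "length vs = k" "nbwalk padj (p # vs @ [r])" "hd (vs @ [r]) = q" "last (p # vs) = t"
      using Suc.IH by blast
    have "nbwalk padj ((p # vs @ [r]) @ [s])"
    proof (rule nbwalk_snoc[OF vs(2)])
      have "(p # vs @ [r]) ! (length (p # vs @ [r]) - 2) = (p # vs) ! (length (p # vs) - 1)"
        unfolding append_Cons[symmetric] by (subst nth_append) (simp del: append_Cons)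
      also have "\<dots> = t" using vs(4) last_conv_nth[of "p # vs"] by simp
      finally show "(p # vs @ [r]) ! (length (p # vs @ [r]) - 2) \<noteq> s" using t(2) by simp
    qed (use t in auto)
    then show ?case
      using vs by (intro exI[of _ "vs @ [r]"]) (auto simp: hd_append split: if_splits)
  qed
  then show ?thesis using that by blast
qed

lemma map_override:
  assumes "distinct ks" "length ks = length vs"
  obtains T where "map T ks = vs" "\<And>x. x \<notin> set ks \<Longrightarrow> T x = B x"
proof
  let ?T = "\<lambda>x. case map_of (zip ks vs) x of Some y \<Rightarrow> y | None \<Rightarrow> B x"
  show "map ?T ks = vs"
    using assms by (intro nth_equalityI) (auto simp: map_of_zip_nth)
  show "?T x = B x" if "x \<notin> set ks" for x
  proof -
    have "map_of (zip ks vs) x = None"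
      using that assms by (simp add: map_of_zip_is_None)
    then show ?thesis by simp
  qed
qed

text \<open>An edge without an end in \<open>W\<close> sees only edges that keep their old colors,
  so only edges touching \<open>W\<close> have to be examined.\<close>

lemma strong_glue:
  assumes c': "strong {e \<in> E. \<not> e \<subseteq> W} c'"
    and agree: "\<And>e. e \<in> E \<Longrightarrow> \<not> e \<subseteq> W \<Longrightarrow> c e = c' e"
    and touch: "\<And>u v. {u, v} \<in> E \<Longrightarrow> u \<in> W \<Longrightarrow> inj_on c (star E u \<union> star E v)"
  shows "strong E c"
  unfolding strong_def
proof (intro allI impI)
  fix u v
  assume uv: "{u, v} \<in> E"
  consider "u \<in> W" | "v \<in> W" | "u \<notin> W" "v \<notin> W" by blast
  then show "inj_on c (star E u \<union> star E v)"
  proof cases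
    case 2
    then show ?thesis
      using touch[of v u] uv by (simp add: insert_commute Un_commute)
  next
    case 3
    then have "star E u \<union> star E v = star {e \<in> E. \<not> e \<subseteq> W} u \<union> star {e \<in> E. \<not> e \<subseteq> W} v"
      by (auto simp: star_def)
    moreover have "inj_on c' (star {e \<in> E. \<not> e \<subseteq> W} u \<union> star {e \<in> E. \<not> e \<subseteq> W} v)"
      using c' uv 3 by (auto simp: strong_def)
    moreover have eq: "c e = c' e" if "e \<in> star {e \<in> E. \<not> e \<subseteq> W} u \<union> star {e \<in> E. \<not> e \<subseteq> W} v" for e
    proof -
      have "e \<in> E" "\<not> e \<subseteq> W" using that by (auto simp: star_def)
      then show ?thesis using agree by simp
    qed
    ultimately show ?thesis
      by (metis (no_types, lifting) inj_on_cong)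
  qed (use touch uv in auto)
qed

section \<open>Structure of a minimal uncolorable edge set\<close>

locale minimal_uncolorable =
  fixes E :: "'a set set"
  assumes finE: "finite E"
    and card2: "\<And>e. e \<in> E \<Longrightarrow> card e = 2"
    and deg3: "\<And>v. card (nbs E v) \<le> 3"
    and uncolorable: "\<not> colorable E"
    and minimal: "\<And>F. F \<subset> E \<Longrightarrow> colorable F"
    and no_S3: "\<not> pendant_cycle E 3 3" and no_S4: "\<not> pendant_cycle E 4 2" and no_S7: "\<not> pendant_cycle E 7 7"
begin

definition core :: "'a set" where
  "core = {v. card (nbs E v) \<ge> 2}"

definition cnbs :: "'a \<Rightarrow> 'a set" where
  "cnbs v = nbs E v \<inter> core"

definition cadj :: "'a \<Rightarrow> 'a \<Rightarrow> bool" where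
  "cadj u v \<longleftrightarrow> {u, v} \<in> E \<and> u \<in> core \<and> v \<in> core"

lemma edge_neq: "{u, v} \<in> E \<Longrightarrow> u \<noteq> v"
  using card2 by force

lemma nbs_sym: "v \<in> nbs E u \<longleftrightarrow> u \<in> nbs E v"
  by (simp add: nbs_def insert_commute)

lemma star_eq: "star E v = (\<lambda>w. {v, w}) ` nbs E v"
proof -
  have "e \<in> (\<lambda>w. {v, w}) ` nbs E v" if e: "e \<in> E" "v \<in> e" for e
  proof -
    obtain w where "e = {v, w}"
      using card2[OF e(1)] e(2) by (auto simp: card_2_iff)
    then show ?thesis using e by (auto simp: nbs_def)
  qed
  then show ?thesis by (auto simp: star_def nbs_def)
qed

lemma finite_nbs: "finite (nbs E v)"
proof (rule finite_subset)
  show "nbs E v \<subseteq> \<Union>E" by (auto simp: nbs_def)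
  show "finite (\<Union>E)" using finE card2 by (intro finite_Union) (auto intro: card_ge_0_finite)
qed

lemma finite_star: "finite (star E v)"
  using finE by (simp add: star_def)

lemma card_star: "card (star E v) = card (nbs E v)"
  unfolding star_eq by (intro card_image inj_onI) (auto simp: doubleton_eq_iff)

text \<open>The edges within distance two of the pendant edge al are the edges at neighbours of a.
  With at most four of them besides al, a fifth color would extend a coloring of the remaining
  edges.\<close>

lemma leaf_dense:
  assumes "nbs E l = {a}"
  shows "card (\<Union>(star E ` nbs E a) - {{a, l}}) > 4"
proof (rule ccontr)
  let ?S = "\<Union>(star E ` nbs E a) - {{a, l}}" and ?e = "{a, l}"
  assume "\<not> ?thesis"
  then have S: "card ?S \<le> 4" by simp
  have e: "?e \<in> E" using assms by (auto simp: nbs_def insert_commute)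
  then obtain c' :: "'a set \<Rightarrow> color" where c': "strong (E - {?e}) c'"
    using minimal[of "E - {?e}"] by (auto simp: colorable_def)
  have fin: "finite ?S"
    using finite_star finite_nbs by auto
  have U: "card (UNIV :: color set) = 5"
    unfolding set_colors[symmetric] by (simp add: colors_def)
  have "c' ` ?S \<noteq> UNIV"
    using card_image_le[OF fin, of c'] S U by auto
  then obtain x where x: "x \<notin> c' ` ?S" by auto
  have "strong E (c'(?e := x))"
    unfolding strong_def
  proof (intro allI impI)
    fix u v
    assume uv: "{u, v} \<in> E"
    have starl: "star E l = {?e}" by (simp add: star_eq assms insert_commute)
    have na: "nbs E a \<noteq> {}" "l \<in> nbs E a" using assms nbs_sym[of l a] by auto
    have main: "inj_on (c'(?e := x)) (star E a \<union> star E v)" if "v \<in> nbs E a" for v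
    proof -
      have "star E a \<subseteq> \<Union>(star E ` nbs E a)"
      proof
        fix f assume "f \<in> star E a"
        then obtain w where "w \<in> nbs E a" "f = {a, w}" by (auto simp: star_eq)
        then show "f \<in> \<Union>(star E ` nbs E a)"
          using nbs_sym by (auto simp: star_eq insert_commute)
      qed
      then have sub: "star E a \<union> star E v - {?e} \<subseteq> ?S"
        using that by auto
      have "inj_on c' (star E a \<union> star E v - {?e})"
      proof (cases "v = l")
        case False
        have "{a, v} \<in> E - {?e}" using that False by (auto simp: nbs_def doubleton_eq_iff)
        then have "inj_on c' (star (E - {?e}) a \<union> star (E - {?e}) v)"
          using c' by (simp add: strong_def)
        then show ?thesis by (rule inj_on_subset) (auto simp: star_def)
      next
        case True
        show ?thesis
        proof (cases "star E a - {?e} = {}")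
          case True
          then have "star E a \<union> star E v - {?e} = {}" using starl \<open>v = l\<close> by auto
          then show ?thesis by (simp only: inj_on_empty)
        next
          case False
          then obtain w where w: "{a, w} \<in> E - {?e}" by (auto simp: star_eq nbs_def)
          then have "inj_on c' (star (E - {?e}) a \<union> star (E - {?e}) w)"
            using c' by (simp add: strong_def)
          then show ?thesis by (rule inj_on_subset) (auto simp: star_def \<open>v = l\<close> starl[unfolded star_def])
        qed
      qed
      then have "inj_on (c'(?e := x)) (insert ?e (star E a \<union> star E v - {?e}))"
      proof -
        have "inj_on (c'(?e := x)) (star E a \<union> star E v - {?e})"
          using \<open>inj_on c' _\<close> by (simp add: inj_on_def)
        moreover have "x \<notin> (c'(?e := x)) ` (star E a \<union> star E v - {?e})"
        proof
          assume "x \<in> (c'(?e := x)) ` (star E a \<union> star E v - {?e})"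
          then obtain f where "f \<in> star E a \<union> star E v - {?e}" "x = c' f" by auto
          then show False using sub x by blast
        qed
        ultimately show ?thesis
          unfolding inj_on_insert fun_upd_same Diff_idemp by blast
      qed
      then show ?thesis by (rule inj_on_subset) blast
    qed
    show "inj_on (c'(?e := x)) (star E u \<union> star E v)"
    proof (cases "?e \<in> star E u \<union> star E v")
      case True
      then consider "u = a" | "u = l" | "v = a" | "v = l" by (auto simp: star_def)
      then show ?thesis
      proof cases
        case 1
        then show ?thesis using main uv by (simp add: nbs_def)
      next
        case 2
        then have "v = a" using uv assms by (auto simp: nbs_def)
        then show ?thesis using main[of l] na 2 by (simp add: Un_commute)
      next
        case 3
        then show ?thesis using main[of u] uv by (simp add: nbs_def insert_commute Un_commute)
      next
        case 4
        then have "u \<in> nbs E l" using uv by (simp add: nbs_def insert_commute)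
        then have "u = a" using assms by simp
        then show ?thesis using main[of l] na 4 by (simp add: Un_commute)
      qed
    next
      case False
      then have "{u, v} \<in> E - {?e}" using uv by (auto simp: star_def)
      then have "inj_on c' (star (E - {?e}) u \<union> star (E - {?e}) v)"
        using c' by (simp add: strong_def)
      moreover have "star (E - {?e}) u \<union> star (E - {?e}) v = star E u \<union> star E v"
        using False by (auto simp: star_def)
      ultimately show ?thesis using False by (auto simp: inj_on_def)
    qed
  qed
  then show False using uncolorable by (auto simp: colorable_def)
qed

lemma leaf_nbr:
  assumes "l \<notin> core" "l \<in> nbs E v"
  shows "nbs E l = {v}"
proof -
  have "v \<in> nbs E l" using assms nbs_sym by metis
  moreover have "card (nbs E l) \<le> 1" using assms by (simp add: core_def)
  ultimately show ?thesis
    using finite_nbs[of l] by (auto simp: card_le_Suc0_iff_eq)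
qed

text \<open>If v had at most one core neighbour u, all edges at neighbours of v would be at v or at
  u: at most 3 + 3 - 1 = 5 edges, the pendant one included, contrary to
  \<open>leaf_dense\<close>.\<close>

lemma two_core_nbrs:
  assumes "l \<notin> core" "l \<in> nbs E v"
  shows "card (cnbs v) = 2" "nbs E v = insert l (cnbs v)" "v \<in> core"
proof -
  have leaf: "nbs E l = {v}" using leaf_nbr assms by blast
  have "2 \<le> card (cnbs v)"
  proof (rule ccontr)
    assume "\<not> ?thesis"
    then have le: "card (cnbs v) \<le> 1" by simp
    have fc: "finite (cnbs v)" using finite_nbs by (simp add: cnbs_def)
    have starleaf: "star E w \<subseteq> star E v" if "w \<in> nbs E v" "w \<notin> core" for w
      using leaf_nbr[OF that(2,1)] that by (auto simp: star_eq insert_commute)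
    have "\<exists>u. \<Union>(star E ` nbs E v) \<subseteq> star E v \<union> star E u \<and> (u \<in> cnbs v \<or> u = v)"
    proof (cases "cnbs v = {}")
      case True
      then show ?thesis using starleaf by (auto simp: cnbs_def)
    next
      case False
      then obtain u where "cnbs v = {u}" using le fc by (auto simp: card_le_Suc0_iff_eq)
      then have "star E w \<subseteq> star E v \<union> star E u" if "w \<in> nbs E v" for w
        using starleaf[OF that] that by (cases "w \<in> core") (auto simp: cnbs_def)
      then show ?thesis using \<open>cnbs v = {u}\<close> by blast
    qed
    then obtain u where u: "\<Union>(star E ` nbs E v) \<subseteq> star E v \<union> star E u" "u \<in> cnbs v \<or> u = v" by blast
    have "card (star E v \<union> star E u) \<le> 5"
    proof (cases "u = v")
      case True
      then show ?thesis using deg3[of v] by (simp add: card_star)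
    next
      case False
      then have "{v, u} \<in> star E v \<inter> star E u" using u(2) by (auto simp: star_def cnbs_def nbs_def)
      then have "card (star E v \<inter> star E u) \<ge> 1"
        by (metis One_nat_def Suc_leI card_gt_0_iff empty_iff finite_Int finite_star)
      then show ?thesis
        using card_Un_Int[OF finite_star finite_star, of v u] deg3[of v] deg3[of u] by (simp add: card_star)
    qed
    moreover have "{v, l} \<in> star E v \<union> star E u" using assms by (auto simp: star_def nbs_def)
    ultimately have "card ((star E v \<union> star E u) - {{v, l}}) \<le> 4"
      using finite_star by (simp add: card_Diff_singleton)
    moreover have "card (\<Union>(star E ` nbs E v) - {{v, l}}) \<le> card ((star E v \<union> star E u) - {{v, l}})"
      using u(1) finite_star by (intro card_mono) auto
    ultimately show False using leaf_dense[OF leaf] by simp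
  qed
  moreover have ins: "insert l (cnbs v) \<subseteq> nbs E v" "l \<notin> cnbs v" "finite (cnbs v)"
    using assms finite_nbs by (auto simp: cnbs_def)
  moreover have "card (insert l (cnbs v)) \<le> card (nbs E v)"
    using ins finite_nbs by (intro card_mono)
  ultimately show c: "card (cnbs v) = 2" using deg3[of v] by simp
  then show "nbs E v = insert l (cnbs v)"
    using ins deg3[of v] finite_nbs by (intro card_seteq[symmetric]) auto
  show "v \<in> core"
    using c card_mono[OF finite_nbs, of "cnbs v" v] by (auto simp: core_def cnbs_def)
qed

lemma core_cases:
  assumes "v \<in> core"
  obtains "card (cnbs v) = 2" | "card (cnbs v) = 3" "cnbs v = nbs E v"
proof (cases "nbs E v \<subseteq> core")
  case True
  then have "cnbs v = nbs E v" by (auto simp: cnbs_def)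
  then show ?thesis
    using that assms deg3[of v] by (cases "card (nbs E v) = 2") (simp_all add: core_def)
next
  case False
  then show ?thesis using two_core_nbrs that by auto
qed

section \<open>Recoloring by locally injective maps to the Petersen graph\<close>

definition loc_inj :: "('a \<Rightarrow> pvert) \<Rightarrow> 'a \<Rightarrow> bool" where
  "loc_inj T v \<longleftrightarrow> (\<forall>n \<in> cnbs v. padj (T v) (T n)) \<and> inj_on T (cnbs v)"



text \<open>Minimality colors what is left after removing the edges inside \<open>U\<close> and
  those from \<open>U\<close> to leaves; the edge from x0 to y0 ensures that something is removed.
  At a kept core vertex w, \<open>B w\<close> is a Petersen vertex offering the old colors at w, and
  the arc from \<open>B w\<close> to \<open>X w x\<close> has the old color of wx. A map that
  respects these arcs and is locally injective on \<open>U\<close> would yield a strong coloring of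
  all edges.\<close>

lemma extension:
  assumes U: "U \<subseteq> core" and e0: "{x0, y0} \<in> E" "x0 \<in> U" "y0 \<in> U"
  obtains B X where
    "\<And>w x. w \<in> core \<Longrightarrow> w \<notin> U \<Longrightarrow> x \<in> U \<Longrightarrow> x \<in> nbs E w \<Longrightarrow> padj (B w) (X w x)"
    "\<And>T. (\<And>w x. w \<in> core \<Longrightarrow> w \<notin> U \<Longrightarrow> x \<in> U \<Longrightarrow> x \<in> nbs E w \<Longrightarrow> T w = B w \<and> T x = X w x) \<Longrightarrow>
      (\<And>v. v \<in> U \<Longrightarrow> loc_inj T v) \<Longrightarrow> False"
proof -
  define W where "W = U \<union> {l. l \<notin> core \<and> nbs E l \<inter> U \<noteq> {}}"
  have leafW: "nbs E l \<inter> U \<noteq> {}" "l \<notin> core" if "l \<in> W" "l \<notin> U" for l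
    using that by (auto simp: W_def)
  have coreW: "w \<notin> W" if "w \<in> core" "w \<notin> U" for w
    using that by (auto simp: W_def)
  define E' where "E' = {e \<in> E. \<not> e \<subseteq> W}"
  have "{x0, y0} \<notin> E'" using e0 by (auto simp: E'_def W_def)
  moreover have "E' \<subseteq> E" by (simp add: E'_def)
  ultimately have "E' \<subset> E" using e0 by blast
  then obtain c' :: "'a set \<Rightarrow> color" where c': "strong E' c'"
    using minimal by (auto simp: colorable_def)
  have inj': "inj_on c' (star E w)" if "w \<notin> W" for w
  proof (cases "star E w = {}")
    case False
    then obtain v where v: "{w, v} \<in> E" by (auto simp: star_eq nbs_def)
    then have "inj_on c' (star E' w \<union> star E' v)"
      using c' that by (auto simp: strong_def E'_def)
    moreover have "star E w = star E' w" using that by (auto simp: star_def E'_def)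
    ultimately show ?thesis by (simp add: inj_on_Un)
  qed simp
  have "\<exists>p. \<forall>y \<in> nbs E w. \<exists>q. padj p q \<and> pcol p q = c' {w, y}" for w
  proof -
    have "card (c' ` star E w) \<le> 3"
      using card_image_le[OF finite_star, of c' w] deg3[of w] by (simp add: card_star)
    then obtain p where "\<And>x. x \<in> c' ` star E w \<Longrightarrow> \<exists>q. padj p q \<and> pcol p q = x"
      using pvert_with_colors by blast
    then have "\<forall>y \<in> nbs E w. \<exists>q. padj p q \<and> pcol p q = c' {w, y}" unfolding star_eq by blast
    then show ?thesis by blast
  qed
  then obtain B where "\<And>w. \<forall>y \<in> nbs E w. \<exists>q. padj (B w) q \<and> pcol (B w) q = c' {w, y}" by metis
  then obtain X where X: "\<And>w y. y \<in> nbs E w \<Longrightarrow> padj (B w) (X w y) \<and> pcol (B w) (X w y) = c' {w, y}" by metis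
  have False if bd: "\<And>w x. w \<in> core \<Longrightarrow> w \<notin> U \<Longrightarrow> x \<in> U \<Longrightarrow> x \<in> nbs E w \<Longrightarrow> T w = B w \<and> T x = X w x"
    and loc: "\<And>v. v \<in> U \<Longrightarrow> loc_inj T v" for T
  proof -
    \<comment> \<open>The map is given on the core only. A leaf at v is sent to the third neighbour
      of \<open>T v\<close>, so its edge gets the color left over at v.\<close>
    have "\<exists>s. padj (T v) s \<and> s \<notin> T ` cnbs v" if v: "v \<in> U" "l \<in> nbs E v" "l \<notin> core" for v l
    proof -
      obtain a b where ab: "cnbs v = {a, b}" "a \<noteq> b"
        using two_core_nbrs(1)[OF v(3,2)] by (auto simp: card_2_iff)
      then have "padj (T v) (T a)" "padj (T v) (T b)" "T a \<noteq> T b"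
        using loc[OF v(1)] by (auto simp: loc_inj_def)
      then obtain s where "padj (T v) s" "s \<noteq> T a" "s \<noteq> T b" by (rule third_pnbr)
      then show ?thesis using ab by auto
    qed
    then have "\<forall>v. \<exists>s. v \<in> U \<longrightarrow> nbs E v - core \<noteq> {} \<longrightarrow> padj (T v) s \<and> s \<notin> T ` cnbs v"
      by blast
    from choice[OF this] obtain S where
      "\<forall>v. v \<in> U \<longrightarrow> nbs E v - core \<noteq> {} \<longrightarrow> padj (T v) (S v) \<and> S v \<notin> T ` cnbs v" ..
    then have S: "padj (T v) (S v) \<and> S v \<notin> T ` cnbs v" if "v \<in> U" "nbs E v - core \<noteq> {}" for v
      using that by simp
    define T' where "T' n = (if n \<in> core then T n else S (THE v. nbs E n = {v}))" for n
    have T'core: "T' n = T n" if "n \<in> core" for n using that by (simp add: T'_def)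
    have T'leaf: "T' l = S v" if "l \<in> nbs E v" "l \<notin> core" for l v
      using leaf_nbr[OF that(2,1)] that by (simp add: T'_def)
    have adj: "padj (T' u) (T' n)" if "u \<in> U" "n \<in> nbs E u" for u n
    proof (cases "n \<in> core")
      case True
      then show ?thesis using loc[OF that(1)] that U by (auto simp: loc_inj_def cnbs_def T'core)
    next
      case False
      then have "T' n = S u" "nbs E u - core \<noteq> {}" using T'leaf that by auto
      then show ?thesis using S[OF that(1)] that U by (auto simp: T'core)
    qed
    have injT: "inj_on T' (nbs E u)" if u: "u \<in> U" for u
    proof (cases "nbs E u \<subseteq> core")
      case True
      then have "cnbs u = nbs E u" by (auto simp: cnbs_def)
      then show ?thesis using loc[OF u] True by (auto simp: loc_inj_def inj_on_def T'core subset_iff)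
    next
      case False
      then obtain l where l: "l \<in> nbs E u" "l \<notin> core" by auto
      have eq: "T' x = T x" if "x \<in> cnbs u" for x
        using that by (simp add: cnbs_def T'core)
      have "S u \<notin> T ` cnbs u" using S[OF u] l by blast
      then have "T' l \<notin> T' ` (cnbs u - {l})"
        using T'leaf[OF l] eq by auto
      moreover have "inj_on T' (cnbs u)"
        using loc[OF u] eq by (simp add: loc_inj_def inj_on_def)
      ultimately have "inj_on T' (insert l (cnbs u))"
        unfolding inj_on_insert by blast
      then show ?thesis using two_core_nbrs(2)[OF l(2,1)] by simp
    qed
    \<comment> \<open>An edge inside W gets the label of its image in the Petersen graph. The
      orientation chosen for it is irrelevant by \<open>pcol_sym\<close>.\<close>
    define d where "d e = (if e \<subseteq> W then SOME x. \<exists>u v. e = {u, v} \<and> u \<in> U \<and> v \<in> nbs E u \<and> x = pcol (T' u) (T' v) else c' e)" for e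
    have col: "d {u, v} = pcol (T' u) (T' v)" if u: "u \<in> U" "v \<in> nbs E u" for u v
    proof (cases "v \<in> W")
      case True
      have "\<exists>x. \<exists>u' v'. {u, v} = {u', v'} \<and> u' \<in> U \<and> v' \<in> nbs E u' \<and> x = pcol (T' u') (T' v')"
        using that by blast
      then have "\<exists>u' v'. {u, v} = {u', v'} \<and> u' \<in> U \<and> v' \<in> nbs E u' \<and> d {u, v} = pcol (T' u') (T' v')"
        using True u(1) by (simp add: d_def W_def) (rule someI_ex, blast)
      then show ?thesis using pcol_sym[OF adj[OF that]] by (auto simp: doubleton_eq_iff)
    next
      case False
      have "v \<in> core"
      proof (rule ccontr)
        assume "v \<notin> core"
        moreover have "u \<in> nbs E v \<inter> U" using u nbs_sym[of u v] by simp
        ultimately show False using False by (auto simp: W_def)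
      qed
      moreover have "v \<notin> U" using False by (auto simp: W_def)
      moreover have uv: "u \<in> nbs E v" using u nbs_sym[of u v] by simp
      ultimately have "T v = B v" "T u = X v u" using bd u by auto
      moreover have "d {u, v} = c' {v, u}" using False by (simp add: d_def insert_commute)
      ultimately show ?thesis
        using X[OF uv] pcol_sym[of "B v" "X v u"] \<open>v \<in> core\<close> u U by (auto simp: T'core)
    qed
    \<comment> \<open>The colors around a neighbour v of U are again labels of arcs leaving
      \<open>T' v\<close>: \<open>Q\<close> is \<open>T'\<close> if v is in U or a leaf, and
      \<open>X v\<close> if v keeps its colors. Thus \<open>pcol_across\<close> applies to the edge
      uv in each case.\<close>
    have far: "\<exists>Q. inj_on Q (nbs E v) \<and> Q u = T' u \<and>
        (\<forall>m \<in> nbs E v. padj (T' v) (Q m) \<and> d {v, m} = pcol (T' v) (Q m))"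
      if u: "u \<in> U" "v \<in> nbs E u" for u v
    proof -
      have uv: "u \<in> nbs E v" using u nbs_sym[of u v] by simp
      consider "v \<in> U" | "v \<notin> core" | "v \<in> core" "v \<notin> U" by blast
      then show ?thesis
      proof cases
        case 1
        then show ?thesis using injT adj col by (intro exI[of _ T']) auto
      next
        case 2
        then have "nbs E v = {u}" using leaf_nbr u by blast
        then show ?thesis
          using adj[OF u] col[OF u] pcol_sym[OF adj[OF u]] padj_sym
          by (intro exI[of _ T']) (auto simp: insert_commute)
      next
        case 3
        have Tv: "T v = B v" "T u = X v u" using bd[OF 3 u(1) uv] by auto
        have "inj_on (X v) (nbs E v)"
        proof (rule inj_onI)
          fix m m' assume m: "m \<in> nbs E v" "m' \<in> nbs E v" "X v m = X v m'"
          then have "c' {v, m} = c' {v, m'}" using X by metis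
          then have "{v, m} = {v, m'}"
            using inj'[OF coreW[OF 3]] m by (auto simp: star_eq inj_on_def)
          then show "m = m'" by (auto simp: doubleton_eq_iff)
        qed
        moreover have "d {v, m} = c' {v, m}" for m
          using coreW[OF 3] by (simp add: d_def)
        ultimately show ?thesis
          using X Tv U u 3 by (intro exI[of _ "X v"]) (auto simp: T'core)
      qed
    qed
    have inj: "inj_on d (star E u \<union> star E v)" if u: "u \<in> U" "v \<in> nbs E u" for u v
    proof -
      obtain Q where Q: "inj_on Q (nbs E v)" "Q u = T' u"
        "\<And>m. m \<in> nbs E v \<Longrightarrow> padj (T' v) (Q m) \<and> d {v, m} = pcol (T' v) (Q m)"
        using far[OF u] by blast
      have uv: "u \<in> nbs E v" using u nbs_sym[of u v] by simp
      have same_u: "n = n'" if "n \<in> nbs E u" "n' \<in> nbs E u" "d {u, n} = d {u, n'}" for n n'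
      proof -
        have "T' n = T' n'"
          using that col u adj pcol_inj by metis
        then show ?thesis using injT[OF u(1)] that by (simp add: inj_on_eq_iff)
      qed
      have same_v: "m = m'" if "m \<in> nbs E v" "m' \<in> nbs E v" "d {v, m} = d {v, m'}" for m m'
      proof -
        have "Q m = Q m'"
          using that Q(3) pcol_inj by metis
        then show ?thesis using Q(1) that by (simp add: inj_on_eq_iff)
      qed
      have across: "{u, n} = {v, m}" if nm: "n \<in> nbs E u" "m \<in> nbs E v" "d {u, n} = d {v, m}" for n m
      proof (cases "n = v \<or> m = u")
        case True
        then show ?thesis
        proof
          assume "n = v"
          then have "d {v, u} = d {v, m}" using nm by (simp add: insert_commute)
          then show ?thesis using same_v[OF uv nm(2)] \<open>n = v\<close> by auto
        next
          assume "m = u"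
          then have "d {u, n} = d {u, v}" using nm by (simp add: insert_commute)
          then show ?thesis using same_u[OF nm(1) u(2)] \<open>m = u\<close> by auto
        qed
      next
        case False
        have "T' n \<noteq> T' v" using injT[OF u(1)] nm u False by (auto simp: inj_on_eq_iff)
        moreover have "Q m \<noteq> T' u" using Q(1,2) nm uv False by (metis inj_on_eq_iff)
        ultimately have "pcol (T' u) (T' n) \<noteq> pcol (T' v) (Q m)"
          using adj[OF u] adj[OF u(1) nm(1)] Q(3)[OF nm(2)] by (intro pcol_across) auto
        then show ?thesis using nm col[OF u(1) nm(1)] Q(3)[OF nm(2)] by simp
      qed
      show ?thesis
      proof (rule inj_onI)
        fix e f assume ef: "e \<in> star E u \<union> star E v" "f \<in> star E u \<union> star E v" "d e = d f"
        then consider n n' where "e = {u, n}" "f = {u, n'}" "n \<in> nbs E u" "n' \<in> nbs E u"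
          | m m' where "e = {v, m}" "f = {v, m'}" "m \<in> nbs E v" "m' \<in> nbs E v"
          | n m where "e = {u, n}" "f = {v, m}" "n \<in> nbs E u" "m \<in> nbs E v"
          | n m where "f = {u, n}" "e = {v, m}" "n \<in> nbs E u" "m \<in> nbs E v"
          unfolding star_eq by blast
        then show "e = f"
        proof cases
          case 1
          then show ?thesis using same_u[of n n'] ef(3) by simp
        next
          case (2 m m')
          then show ?thesis using same_v[of m m'] ef(3) by simp
        next
          case (3 n m)
          then show ?thesis using across[of n m] ef(3) by simp
        next
          case (4 n m)
          then show ?thesis using across[of n m] ef(3) by simp
        qed
      qed
    qed
    have "strong E d"
    proof (rule strong_glue)
      show "strong {e \<in> E. \<not> e \<subseteq> W} c'" using c' by (simp add: E'_def)
      show "d e = c' e" if "\<not> e \<subseteq> W" for e using that by (simp add: d_def)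
      fix u v assume uv: "{u, v} \<in> E" "u \<in> W"
      show "inj_on d (star E u \<union> star E v)"
      proof (cases "u \<in> U")
        case True
        then show ?thesis using inj uv by (simp add: nbs_def)
      next
        case False
        then have "u \<notin> core" "nbs E u \<inter> U \<noteq> {}" using leafW uv by auto
        then have "v \<in> U" using leaf_nbr[of u v] uv by (auto simp: nbs_def insert_commute)
        then show ?thesis using inj[of v u] uv by (simp add: nbs_def insert_commute Un_commute)
      qed
    qed
    then show False using uncolorable by (auto simp: colorable_def)
  qed
  then show ?thesis using that[of B X] X by blast
qed

definition two :: "'a set" where
  "two = {v \<in> core. card (cnbs v) = 2}"

definition branch :: "'a set" where
  "branch = {v \<in> core. card (cnbs v) = 3}"

lemma core_eq: "core = two \<union> branch" "two \<inter> branch = {}"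
  by (auto simp: two_def branch_def elim: core_cases)

lemma cadj_sym: "cadj u v \<Longrightarrow> cadj v u"
  by (simp add: cadj_def insert_commute)

lemma cadj_cnbs: "u \<in> core \<Longrightarrow> cadj u v \<longleftrightarrow> v \<in> cnbs u"
  by (auto simp: cadj_def cnbs_def nbs_def)

lemma cadj_neq: "cadj u v \<Longrightarrow> u \<noteq> v"
  using edge_neq by (auto simp: cadj_def)

lemma cnbs_interior:
  assumes "nbwalk cadj l" "Suc (Suc i) < length l" "l ! Suc i \<in> two"
  shows "cnbs (l ! Suc i) = {l ! i, l ! Suc (Suc i)}"
proof -
  have "cadj (l ! i) (l ! Suc i)" "cadj (l ! Suc i) (l ! Suc (Suc i))" "l ! i \<noteq> l ! Suc (Suc i)"
    using assms by (auto simp: nbwalk_def)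
  then have "{l ! i, l ! Suc (Suc i)} \<subseteq> cnbs (l ! Suc i)" "card {l ! i, l ! Suc (Suc i)} = 2"
    by (auto simp: cadj_def cnbs_def nbs_def insert_commute)
  moreover have "finite (cnbs (l ! Suc i))" using finite_nbs by (simp add: cnbs_def)
  moreover have "card (cnbs (l ! Suc i)) = 2" using assms(3) by (simp add: two_def)
  ultimately show ?thesis by (metis card_subset_eq)
qed

lemma loc_inj_interior:
  assumes "nbwalk cadj l" "Suc (Suc i) < length l" "l ! Suc i \<in> two" "nbwalk padj (map T l)"
  shows "loc_inj T (l ! Suc i)"
proof -
  have "padj (T (l ! i)) (T (l ! Suc i))" "padj (T (l ! Suc i)) (T (l ! Suc (Suc i)))" "T (l ! i) \<noteq> T (l ! Suc (Suc i))"
    using assms(2,4) by (auto simp: nbwalk_def)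
  then show ?thesis
    unfolding loc_inj_def cnbs_interior[OF assms(1-3)] by (auto dest: padj_sym)
qed

lemma mem_interior:
  assumes "v \<in> set (butlast (tl l))"
  obtains i where "Suc (Suc i) < length l" "l ! Suc i = v"
proof -
  from assms obtain i where "i < length (butlast (tl l))" "butlast (tl l) ! i = v"
    by (auto simp: in_set_conv_nth)
  then show ?thesis using that[of i] by (auto simp: nth_butlast nth_tl)
qed

lemma interior_rev: "set (butlast (tl (rev l))) = set (butlast (tl l))"
  by (metis butlast_rev butlast_tl rev_rev_ident set_rev)

text \<open>A system \<open>L\<close> of walks whose interiors, together with the branch vertices \<open>Z\<close>, are to be recolored.
  Only the first and last vertices of the walks may lie outside.\<close>

lemma walk_system:
  assumes walk: "\<And>l. l \<in> L \<Longrightarrow> nbwalk cadj l \<and> set (butlast (tl l)) \<subseteq> two"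
    and U: "U = Z \<union> (\<Union>l \<in> L. set (butlast (tl l)))"
    and Z: "Z \<subseteq> branch" "\<And>z n. z \<in> Z \<Longrightarrow> n \<in> cnbs z \<Longrightarrow> \<exists>l \<in> L \<union> rev ` L. \<exists>l'. l = z # n # l'"
    and e0: "{x0, y0} \<in> E" "x0 \<in> U" "y0 \<in> U"
  obtains B X where
    "\<And>w x l l'. l \<in> L \<union> rev ` L \<Longrightarrow> w \<notin> U \<Longrightarrow> x \<in> U \<Longrightarrow> l = w # x # l' \<Longrightarrow> padj (B w) (X w x)"
    "\<And>T. (\<And>l. l \<in> L \<Longrightarrow> nbwalk padj (map T l)) \<Longrightarrow>
      (\<And>l w x l'. l \<in> L \<union> rev ` L \<Longrightarrow> l = w # x # l' \<Longrightarrow> w \<notin> U \<Longrightarrow> x \<in> U \<Longrightarrow> T w = B w \<and> T x = X w x) \<Longrightarrow>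
      (\<And>z. z \<in> Z \<Longrightarrow> inj_on T (cnbs z)) \<Longrightarrow> False"
proof -
  have walk': "nbwalk cadj l" if "l \<in> L \<union> rev ` L" for l
    using that walk nbwalk_rev[of cadj, OF cadj_sym] by blast
  have "U \<subseteq> core" using U Z(1) walk core_eq by blast
  from extension[OF this e0] obtain B X where
    B: "\<And>w x. w \<in> core \<Longrightarrow> w \<notin> U \<Longrightarrow> x \<in> U \<Longrightarrow> x \<in> nbs E w \<Longrightarrow> padj (B w) (X w x)" and
    X: "\<And>T. (\<And>w x. w \<in> core \<Longrightarrow> w \<notin> U \<Longrightarrow> x \<in> U \<Longrightarrow> x \<in> nbs E w \<Longrightarrow> T w = B w \<and> T x = X w x) \<Longrightarrow>
      (\<And>v. v \<in> U \<Longrightarrow> loc_inj T v) \<Longrightarrow> False"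
    by blast
  \<comment> \<open>Prescribed arcs occur at kept core vertices next to U only; each of these opens
    a walk of L or the reversal of one.\<close>
  have two_end: "\<exists>l \<in> L \<union> rev ` L. \<exists>l'. l = w # x # l'"
    if w: "w \<in> core" "w \<notin> U" "x \<in> U" "x \<in> nbs E w" for w x
  proof (cases "x \<in> Z")
    case True
    have "w \<in> cnbs x" using w nbs_sym[of x w] by (simp add: cnbs_def)
    then obtain l l' where l: "l \<in> L \<union> rev ` L" "l = x # w # l'" using Z(2) True by blast
    have "l' = []"
    proof (rule ccontr)
      assume "l' \<noteq> []"
      then have "w \<in> set (butlast (tl l))" using l(2) by simp
      then show False using l(1) w(2) U by (auto simp: interior_rev)
    qed
    then have "rev l = w # x # []" using l by simp
    then show ?thesis using l(1) by (metis (no_types, lifting) Un_iff image_iff rev_rev_ident)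
  next
    case False
    then obtain l i where l: "l \<in> L" "Suc (Suc i) < length l" "l ! Suc i = x"
      using w U by (auto elim!: mem_interior)
    have "x \<in> two"
      using False w U walk by blast
    then have "cnbs x = {l ! i, l ! Suc (Suc i)}"
      using cnbs_interior[of l i] walk[OF l(1)] l by simp
    moreover have "w \<in> cnbs x" using w nbs_sym[of x w] by (simp add: cnbs_def)
    ultimately consider "w = l ! i" | "w = l ! Suc (Suc i)" by blast
    then show ?thesis
    proof cases
      case 1
      have "i = 0"
      proof (rule ccontr)
        assume "i \<noteq> 0"
        then have "butlast (tl l) ! (i - 1) = l ! i" "i - 1 < length (butlast (tl l))"
          using l(2) by (auto simp: nth_butlast nth_tl)
        then have "w \<in> set (butlast (tl l))" using 1 by (metis nth_mem)
        then show False using w U l(1) by blast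
      qed
      then have "l = w # x # drop 2 l"
        using 1 l(2,3) by (cases l; cases "tl l") auto
      then show ?thesis using l(1) by blast
    next
      case 2
      have len: "length l = Suc (Suc (Suc i))"
      proof (rule ccontr)
        assume "length l \<noteq> Suc (Suc (Suc i))"
        then have "butlast (tl l) ! Suc i = l ! Suc (Suc i)" "Suc i < length (butlast (tl l))"
          using l(2) by (auto simp: nth_butlast nth_tl)
        then have "w \<in> set (butlast (tl l))" using 2 by (metis nth_mem)
        then show False using w U l(1) by blast
      qed
      then have "rev l ! 0 = w" "rev l ! 1 = x" using 2 l by (auto simp: rev_nth)
      moreover have "length (rev l) \<ge> 2" using len by simp
      ultimately have "rev l = w # x # drop 2 (rev l)"
        by (cases "rev l"; cases "tl (rev l)") auto
      then show ?thesis using l(1) by blast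
    qed
  qed
  show ?thesis
  proof (rule that[of B X])
    fix w x l l' assume "l \<in> L \<union> rev ` L" "w \<notin> U" "x \<in> U" "l = w # x # l'"
    then have "nbwalk cadj (w # x # l')" using walk'[of l] by simp
    then have "cadj w x" by (rule nbwalk_Cons2)
    then show "padj (B w) (X w x)"
      using B \<open>w \<notin> U\<close> \<open>x \<in> U\<close> by (auto simp: cadj_def nbs_def)
  next
    fix T assume T: "\<And>l. l \<in> L \<Longrightarrow> nbwalk padj (map T l)"
      "\<And>l w x l'. l \<in> L \<union> rev ` L \<Longrightarrow> l = w # x # l' \<Longrightarrow> w \<notin> U \<Longrightarrow> x \<in> U \<Longrightarrow> T w = B w \<and> T x = X w x"
      "\<And>z. z \<in> Z \<Longrightarrow> inj_on T (cnbs z)"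
    have T': "nbwalk padj (map T l)" if "l \<in> L \<union> rev ` L" for l
      using that T(1) nbwalk_rev[of padj, OF padj_sym] by (auto simp: rev_map[symmetric])
    have "loc_inj T v" if v: "v \<in> U" for v
    proof (cases "v \<in> Z")
      case True
      have "padj (T v) (T n)" if "n \<in> cnbs v" for n
      proof -
        obtain l l' where l: "l \<in> L \<union> rev ` L" "l = v # n # l'" using Z(2) True \<open>n \<in> cnbs v\<close> by blast
        from T'[OF l(1)] show ?thesis by (auto simp: l(2) dest: nbwalk_Cons2)
      qed
      then show ?thesis using T(3) True by (simp add: loc_inj_def)
    next
      case False
      then obtain l i where l: "l \<in> L" "Suc (Suc i) < length l" "l ! Suc i = v"
        using v U by (auto elim!: mem_interior)
      have "v \<in> two" using False v U walk by blast
      then show ?thesis using loc_inj_interior[of l i T] walk T(1) l by simp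
    qed
    then show False using X[of T] T(2) two_end by metis
  qed
qed

text \<open>Whatever arcs are prescribed at the two ends, \<open>reach_8\<close> connects them
  through the eight interior vertices. The ends u and w may coincide, as they do on a cycle of
  length nine.\<close>

lemma caterpillar:
  assumes "nbwalk cadj (u # xs @ [w])" "set xs \<subseteq> two" "length xs = 8" "distinct xs" "u \<notin> set xs" "w \<notin> set xs"
  shows False
proof -
  let ?l = "u # xs @ [w]"
  obtain x1 x2 xs' where xs: "xs = x1 # x2 # xs'"
    using assms(3) by (cases xs; cases "tl xs") auto
  obtain y ys where ys: "xs = ys @ [y]"
    using xs by (metis append_butlast_last_id list.distinct(1))
  have e0: "{x1, x2} \<in> E" "x1 \<in> set xs" "x2 \<in> set xs"
    using assms(1) xs by (auto simp: nbwalk_def cadj_def dest!: spec[of _ 1])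
  have walk: "nbwalk cadj l \<and> set (butlast (tl l)) \<subseteq> two" if "l \<in> {?l}" for l
    using assms that by simp
  have U: "set xs = {} \<union> (\<Union>l \<in> {?l}. set (butlast (tl l)))" by simp
  have Z: "\<exists>l \<in> {?l} \<union> rev ` {?l}. \<exists>l'. l = z # n # l'" if "z \<in> {}" for z n
    using that by simp
  from walk_system[OF walk U empty_subsetI Z e0] obtain B X where
    B: "\<And>w x l l'. l \<in> {?l} \<union> rev ` {?l} \<Longrightarrow> w \<notin> set xs \<Longrightarrow> x \<in> set xs \<Longrightarrow> l = w # x # l' \<Longrightarrow> padj (B w) (X w x)"
    and X: "\<And>T. (\<And>l. l \<in> {?l} \<Longrightarrow> nbwalk padj (map T l)) \<Longrightarrow>
      (\<And>l w x l'. l \<in> {?l} \<union> rev ` {?l} \<Longrightarrow> l = w # x # l' \<Longrightarrow> w \<notin> set xs \<Longrightarrow> x \<in> set xs \<Longrightarrow> T w = B w \<and> T x = X w x) \<Longrightarrow>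
      (\<And>z. z \<in> {} \<Longrightarrow> inj_on T (cnbs z)) \<Longrightarrow> False"
    by blast
  have "padj (B u) (X u x1)" using B[of ?l u x1] assms xs by simp
  moreover have "padj (X w y) (B w)" using B[of "rev ?l" w y] assms ys padj_sym by simp
  ultimately have "reach 8 (B u) (X u x1) (X w y) (B w)" by (rule reach_8)
  then obtain vs where vs: "length vs = 8" "nbwalk padj (B u # vs @ [B w])" "hd (vs @ [B w]) = X u x1" "last (B u # vs) = X w y"
    by (rule reach_walk)
  obtain T where T: "map T xs = vs" "\<And>x. x \<notin> set xs \<Longrightarrow> T x = B x"
    using map_override[of xs vs B] assms vs(1) by auto
  show False
  proof (rule X[of T])
    show "nbwalk padj (map T l)" if "l \<in> {?l}" for l
      using that T assms vs by simp
    have ne: "vs \<noteq> []" using vs(1) by auto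
    have "T x1 = X u x1" using vs(3) ne T(1) xs by auto
    moreover have "T y = X w y" using vs(4) ne T(1) ys by auto
    moreover have "rev ?l = w # y # rev ys @ [u]" "?l = u # x1 # x2 # xs' @ [w]"
      by (simp add: ys) (simp add: xs)
    ultimately show "T w' = B w' \<and> T x = X w' x" if "l \<in> {?l} \<union> rev ` {?l}" "l = w' # x # l'" "w' \<notin> set xs" "x \<in> set xs" for l w' x l'
      using that T(2)[of w'] by auto
  qed simp
qed

end

section \<open>Cycles with at most one branch vertex, colored by templates\<close>

lemma color_permutation:
  assumes "distinct [p, q, r :: color]" "card (A :: color set) \<le> 3" "x \<in> A"
  obtains \<pi> where "inj \<pi>" "\<pi> p = x" "\<pi> q \<notin> A" "\<pi> r \<notin> A"
proof -
  have fin: "finite (UNIV :: color set)" and U: "card (UNIV :: color set) = 5"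
    unfolding set_colors[symmetric] by (simp_all add: colors_def)
  have finC: "finite C" for C :: "color set"
    by (rule finite_subset[OF subset_UNIV fin])
  have "card (- A) \<ge> 2"
    using assms(2) U card_Diff_subset[OF finC subset_UNIV, of A] by (simp add: Compl_eq_Diff_UNIV)
  then obtain C where "C \<subseteq> - A" "card C = 2"
    by (meson obtain_subset_with_card_n)
  then obtain a b where ab: "a \<noteq> b" "a \<notin> A" "b \<notin> A"
    by (auto simp: card_2_iff)
  have ne: "x \<noteq> a" "x \<noteq> b" using ab assms(3) by auto
  have "card (- {p, q, r}) = card (- {x, a, b})"
    using assms(1) ab ne U by (simp add: Compl_eq_Diff_UNIV card_Diff_subset finC)
  then obtain h where h: "bij_betw h (- {p, q, r}) (- {x, a, b})"
    using finite_same_card_bij[OF finC finC] by blast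
  define \<pi> where "\<pi> c = (if c = p then x else if c = q then a else if c = r then b else h c)" for c
  have hx: "h c \<noteq> x" "h c \<noteq> a" "h c \<noteq> b" if "c \<noteq> p" "c \<noteq> q" "c \<noteq> r" for c
  proof -
    have "h c \<in> - {x, a, b}" using bij_betwE[OF h] that by blast
    then show "h c \<noteq> x" "h c \<noteq> a" "h c \<noteq> b" by auto
  qed
  have hi: "c = c'" if "h c = h c'" "c \<noteq> p" "c \<noteq> q" "c \<noteq> r" "c' \<noteq> p" "c' \<noteq> q" "c' \<noteq> r" for c c'
    by (rule inj_onD[OF bij_betw_imp_inj_on[OF h] that(1)]) (use that in auto)
  have "inj \<pi>"
  proof (rule injI)
    fix c c' assume "\<pi> c = \<pi> c'"
    then show "c = c'"
      using ab(1) ne hx[of c] hx[of c'] hi[of c c'] by (auto simp: \<pi>_def split: if_splits)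
  qed
  moreover have "\<pi> p = x" "\<pi> q = a" "\<pi> r = b" using assms(1) by (auto simp: \<pi>_def)
  ultimately show ?thesis using that ab by metis
qed

text \<open>A coloring of the \<open>n\<close>-cycle with a pendant edge at each position in \<open>Q\<close>: \<open>es ! i\<close> is the color
  of the cycle edge from position \<open>i\<close> to the next one, \<open>fs ! i\<close> the color of the pendant edge at \<open>i\<close>.\<close>

definition cycle_template :: "nat \<Rightarrow> nat list \<Rightarrow> color list \<Rightarrow> color list \<Rightarrow> bool" where
  "cycle_template n Q es fs \<longleftrightarrow> list_all (\<lambda>i.
      distinct [es ! i, es ! (Suc i mod n), es ! (Suc (Suc i) mod n)]) [0..<n] \<and>
    list_all (\<lambda>i. fs ! i \<notin> set [es ! ((i + n - 2) mod n), es ! ((i + n - 1) mod n), es ! i, es ! (Suc i mod n)] \<and>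
      (Suc i mod n \<in> set Q \<longrightarrow> fs ! i \<noteq> fs ! (Suc i mod n))) Q"

context minimal_uncolorable
begin

text \<open>A map to the Petersen graph colors as if each vertex had a third edge, which is
  impossible on cycles of length 3, 4 and 7. Here pendant edges are colored only where they exist.
  Only position 0 may have a third neighbour in the core, so at most one edge attaches the cycle to
  the rest of the core.\<close>

lemma cycle_template_False:
  assumes n: "n = length xs" "3 \<le> n" "distinct xs"
    and adj: "\<And>i. i < n \<Longrightarrow> cadj (xs ! i) (xs ! (Suc i mod n))"
    and two: "\<And>i. 0 < i \<Longrightarrow> i < n \<Longrightarrow> xs ! i \<in> two"
    and tmpl: "cycle_template n Q es fs"
    and Q: "\<And>i. i < n \<Longrightarrow> nbs E (xs ! i) \<noteq> {xs ! ((i + n - 1) mod n), xs ! (Suc i mod n)} \<Longrightarrow> i \<in> set Q"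
  shows False
proof -
  \<comment> \<open>Indices are read modulo n; i + (n - 1) stands for the predecessor of i, to avoid
    truncated subtraction.\<close>
  define x where "x i = xs ! (i mod n)" for i
  define e where "e i = es ! (i mod n)" for i
  define f where "f i = fs ! (i mod n)" for i
  define P where "P i = nbs E (x i) - {x (i + (n - 1)), x (Suc i)}" for i
  define W where "W = set xs \<union> {l. l \<notin> core \<and> nbs E l \<inter> set xs \<noteq> {}}"
  have n0: "n > 0" using n(2) by simp
  have x_in: "x i \<in> set xs" for i
    unfolding x_def using n(1) n0 by (metis mod_less_divisor nth_mem)
  have x_ex: "\<exists>i. v = x i" if "v \<in> set xs" for v
    using that n(1) by (metis in_set_conv_nth mod_less x_def)
  have x_eq: "x i = x j \<longleftrightarrow> i mod n = j mod n" for i j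
    using n n0 nth_eq_iff_index_eq[OF n(3), of "i mod n" "j mod n"] by (simp add: x_def)
  have per: "x i = x j" "e i = e j" "f i = f j" "P i = P j" if "i mod n = j mod n" for i j
  proof -
    have "(i + (n - 1)) mod n = (j + (n - 1)) mod n" "Suc i mod n = Suc j mod n"
      using that by (metis mod_add_left_eq, metis mod_Suc_eq)
    then show "x i = x j" "e i = e j" "f i = f j" "P i = P j"
      using that by (simp_all add: x_def e_def f_def P_def)
  qed
  have Suc_pred: "Suc (i + (n - 1)) = i + n" for i
    using n0 by simp
  have xadj: "{x i, x (Suc i)} \<in> E" "x i \<in> core" for i
    using adj[of "i mod n"] n0 by (simp_all add: x_def cadj_def mod_Suc_eq)
  have xn: "x (i + n) = x i" "e (i + n) = e i" for i
    by (simp_all add: x_def e_def)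
  have xadj': "{x (i + (n - 1)), x i} \<in> E" for i
    using xadj(1)[of "i + (n - 1)"] unfolding Suc_pred xn .
  have two_shift: "i mod n \<noteq> Suc (Suc i) mod n" for i
  proof
    assume "i mod n = Suc (Suc i) mod n"
    then have "n dvd Suc (Suc i) - i"
      using mod_eq_dvd_iff_nat[of i "Suc (Suc i)" n] by simp
    then have "n dvd 2" by simp
    then show False using n(2) by (auto dest: dvd_imp_le)
  qed
  have xne: "x (i + (n - 1)) \<noteq> x (Suc i)" for i
    using two_shift[of "i + (n - 1)"] unfolding Suc_pred x_eq by (metis add_Suc mod_add_self2)
  have nbs_x: "nbs E (x i) = insert (x (i + (n - 1))) (insert (x (Suc i)) (P i))" for i
    using xadj(1)[of i] xadj'[of i] by (auto simp: P_def nbs_def insert_commute)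
  have P_one: "p = q" if "p \<in> P i" "q \<in> P i" for p q i
  proof (rule ccontr)
    assume "p \<noteq> q"
    then have "card {x (i + (n - 1)), x (Suc i), p, q} = 4"
      using that xne[of i] by (auto simp: P_def)
    moreover have "card {x (i + (n - 1)), x (Suc i), p, q} \<le> card (nbs E (x i))"
      using that by (intro card_mono finite_nbs) (auto simp: nbs_x)
    ultimately show False using deg3[of "x i"] by simp
  qed
  have P_Q: "i mod n \<in> set Q" if "P i \<noteq> {}" for i
  proof (rule Q)
    show "i mod n < n" using n0 by simp
    have "xs ! ((i mod n + n - 1) mod n) = x (i + (n - 1))"
    proof -
      have "i mod n + n - 1 = i mod n + (n - 1)" using n0 by simp
      then show ?thesis by (simp add: x_def mod_add_left_eq)
    qed
    moreover have "xs ! (Suc (i mod n) mod n) = x (Suc i)" by (simp add: x_def mod_Suc_eq)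
    moreover have "xs ! (i mod n) = x i" by (simp add: x_def)
    ultimately show "nbs E (xs ! (i mod n)) \<noteq> {xs ! ((i mod n + n - 1) mod n), xs ! (Suc (i mod n) mod n)}"
      using that by (auto simp: P_def)
  qed
  have cn: "cnbs (x i) = {x (i + (n - 1)), x (Suc i)}" if "i mod n \<noteq> 0" for i
  proof -
    have "x i \<in> two" using two[of "i mod n"] that n0 by (simp add: x_def)
    moreover have "{x (i + (n - 1)), x (Suc i)} \<subseteq> cnbs (x i)" by (auto simp: cnbs_def nbs_x xadj)
    moreover have "finite (cnbs (x i))" using finite_nbs by (simp add: cnbs_def)
    ultimately show ?thesis
      using xne[of i] card_subset_eq[of "cnbs (x i)" "{x (i + (n - 1)), x (Suc i)}"] by (auto simp: two_def)
  qed
  have P_core: "i mod n = 0" if "p \<in> P i" "p \<in> core" for p i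
  proof (rule ccontr)
    assume "i mod n \<noteq> 0"
    moreover have "p \<in> cnbs (x i)" using that by (simp add: cnbs_def P_def)
    ultimately show False using cn[of i] that(1) by (simp add: P_def)
  qed
  have P_out: "p \<notin> set xs" if p: "p \<in> P i" for p i
  proof
    assume "p \<in> set xs"
    then obtain j where j: "p = x j" using x_ex by blast
    then have "i mod n = 0" using P_core[OF p] xadj(2) by simp
    moreover have "x i \<in> cnbs (x j)"
      using p j nbs_sym[of "x i" "x j"] xadj(2)[of i] by (simp add: cnbs_def P_def)
    moreover have "j mod n \<noteq> 0"
    proof
      assume "j mod n = 0"
      then have "x j = x i" using \<open>i mod n = 0\<close> by (simp add: x_eq)
      then have "{x i} \<in> E" using p j by (auto simp: P_def nbs_def)
      then show False using card2 by force
    qed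
    ultimately have "x i = x (j + (n - 1)) \<or> x i = x (Suc j)" using cn by auto
    then have "x (Suc i) = x j \<or> x (i + (n - 1)) = x j"
    proof
      assume "x i = x (j + (n - 1))"
      then have "Suc i mod n = Suc (j + (n - 1)) mod n" unfolding x_eq by (metis mod_Suc_eq)
      then show ?thesis unfolding Suc_pred x_eq by simp
    next
      assume "x i = x (Suc j)"
      then have "(i + (n - 1)) mod n = (Suc j + (n - 1)) mod n" unfolding x_eq by (metis mod_add_left_eq)
      then show ?thesis using n0 unfolding x_eq by simp
    qed
    then show False using p j by (auto simp: P_def)
  qed
  have xs_core: "set xs \<subseteq> core" using x_ex xadj(2) by blast
  have leafW: "nbs E l \<inter> set xs \<noteq> {}" "l \<notin> core" if "l \<in> W" "l \<notin> set xs" for l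
    using that by (auto simp: W_def)
  define E' where "E' = {e \<in> E. \<not> e \<subseteq> W}"
  have "{x 0, x 1} \<in> E" "{x 0, x 1} \<notin> E'"
    using xadj(1)[of 0] x_in by (auto simp: E'_def W_def)
  moreover have "E' \<subseteq> E" by (simp add: E'_def)
  ultimately have "E' \<subset> E" by blast
  then obtain c' :: "'a set \<Rightarrow> color" where c': "strong E' c'"
    using minimal by (auto simp: colorable_def)
  have T1: "e i \<noteq> e (Suc i)" "e i \<noteq> e (Suc (Suc i))" for i
  proof -
    have "i mod n \<in> set [0..<n]" using n0 by simp
    then have "distinct [es ! (i mod n), es ! (Suc (i mod n) mod n), es ! (Suc (Suc (i mod n)) mod n)]"
      using tmpl unfolding cycle_template_def list_all_iff by blast
    moreover have "Suc (Suc (i mod n)) mod n = Suc (Suc i) mod n" by (metis mod_Suc_eq)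
    ultimately show "e i \<noteq> e (Suc i)" "e i \<noteq> e (Suc (Suc i))"
      by (auto simp: e_def mod_Suc_eq)
  qed
  have T23: "f i \<notin> {e (i + (n - 2)), e (i + (n - 1)), e i, e (Suc i)}" "P (Suc i) \<noteq> {} \<Longrightarrow> f i \<noteq> f (Suc i)"
    if "P i \<noteq> {}" for i
  proof -
    let ?i = "i mod n"
    have eq: "?i + n - 2 = ?i + (n - 2)" "?i + n - 1 = ?i + (n - 1)" using n(2) by simp_all
    have "fs ! ?i \<notin> set [es ! ((?i + n - 2) mod n), es ! ((?i + n - 1) mod n), es ! ?i, es ! (Suc ?i mod n)] \<and>
        (Suc ?i mod n \<in> set Q \<longrightarrow> fs ! ?i \<noteq> fs ! (Suc ?i mod n))"
      using tmpl P_Q[OF that] unfolding cycle_template_def list_all_iff by blast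
    then show "f i \<notin> {e (i + (n - 2)), e (i + (n - 1)), e i, e (Suc i)}" "P (Suc i) \<noteq> {} \<Longrightarrow> f i \<noteq> f (Suc i)"
      using P_Q[of "Suc i"] unfolding eq by (simp_all add: e_def f_def mod_Suc_eq mod_add_left_eq)
  qed
  note T2 = T23(1) and T3 = T23(2)
  have e_pred: "e (i + (n - 1)) \<noteq> e i" "e (i + (n - 1)) \<noteq> e (Suc i)" for i
    using T1[of "i + (n - 1)"] unfolding Suc_pred xn(2) using xn(2)[of "Suc i"] by simp_all
  \<comment> \<open>The template is fitted to the rest by permuting colors. The edge from
    \<open>x 0\<close> to its core neighbour z keeps its old color, and the two cycle edges at
    \<open>x 0\<close> take the two colors that remain outside the at most three colors at
    z.\<close>
  obtain \<pi> :: "color \<Rightarrow> color" where \<pi>: "inj \<pi>" and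
    \<pi>z: "\<And>z. z \<in> P 0 \<Longrightarrow> z \<in> core \<Longrightarrow> \<pi> (f 0) = c' {x 0, z} \<and>
      \<pi> (e 0) \<notin> c' ` star E z \<and> \<pi> (e (n - 1)) \<notin> c' ` star E z"
  proof (cases "\<exists>z \<in> P 0. z \<in> core")
    case True
    then obtain z where z: "z \<in> P 0" "z \<in> core" by blast
    have "distinct [f 0, e 0, e (n - 1)]"
      using T2[of 0] z e_pred[of 0] by auto
    moreover have "card (c' ` star E z) \<le> 3"
      using card_image_le[OF finite_star, of c' z] deg3[of z] by (simp add: card_star)
    moreover have "c' {x 0, z} \<in> c' ` star E z"
      using z(1) by (intro imageI) (auto simp: P_def nbs_def star_def)
    ultimately obtain \<pi> where \<pi>: "inj \<pi>" "\<pi> (f 0) = c' {x 0, z}"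
      "\<pi> (e 0) \<notin> c' ` star E z" "\<pi> (e (n - 1)) \<notin> c' ` star E z"
      by (rule color_permutation)
    have "z' = z" if "z' \<in> P 0" for z' using P_one[OF that z(1)] .
    then show ?thesis using that[of \<pi>] \<pi> by blast
  next
    case False
    then show ?thesis using that[of id] by auto
  qed
  \<comment> \<open>Both choices are determined: a cycle edge fixes its position modulo n because n
    is at least 3, and a pendant edge meets the cycle in one vertex.\<close>
  define d where "d S = (if \<not> S \<subseteq> W then c' S
    else if \<exists>i. S = {x i, x (Suc i)} then \<pi> (e (SOME i. S = {x i, x (Suc i)}))
    else \<pi> (f (SOME i. x i \<in> S)))" for S
  have d_cycle: "d {x i, x (Suc i)} = \<pi> (e i)" for i
  proof -
    define j where "j = (SOME j. {x i, x (Suc i)} = {x j, x (Suc j)})"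
    have j: "{x i, x (Suc i)} = {x j, x (Suc j)}"
      unfolding j_def by (rule someI[of _ i]) simp
    have "x i = x j"
    proof (rule ccontr)
      assume "x i \<noteq> x j"
      then have "x i = x (Suc j)" "x (Suc i) = x j" using j by (auto simp: doubleton_eq_iff)
      then have "i mod n = Suc (Suc i) mod n" unfolding x_eq by (metis mod_Suc_eq)
      then show False using two_shift by blast
    qed
    then have "e j = e i" using per(2)[of j i] by (simp add: x_eq)
    moreover have "{x i, x (Suc i)} \<subseteq> W" using x_in by (simp add: W_def)
    moreover have "\<exists>j. {x i, x (Suc i)} = {x j, x (Suc j)}" by blast
    ultimately show ?thesis unfolding d_def j_def by (simp only: if_True if_False not_True_eq_False)
  qed
  have d_pend: "d {x i, p} = \<pi> (f i)" if p: "p \<in> P i" for i p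
  proof (cases "p \<in> core")
    case True
    then have "i mod n = 0 mod n" using P_core p by simp
    note 0 = per[OF this]
    have "p \<notin> W" using True P_out[OF p] by (auto simp: W_def)
    then have "d {x i, p} = c' {x i, p}" by (simp add: d_def)
    also have "\<dots> = \<pi> (f i)" using \<pi>z[of p] True p unfolding 0 by simp
    finally show ?thesis .
  next
    case False
    have "x i \<in> nbs E p" using p nbs_sym[of "x i" p] by (simp add: P_def)
    then have "{x i, p} \<subseteq> W" using False x_in by (auto simp: W_def)
    moreover have "{x i, p} \<noteq> {x j, x (Suc j)}" for j
      using P_out[OF p] x_in by (metis insertI1 insertI2 singletonI insertE empty_iff)
    moreover have "f (SOME j. x j \<in> {x i, p}) = f i"
    proof -
      have "x (SOME j. x j \<in> {x i, p}) \<in> {x i, p}" by (rule someI[of _ i]) simp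
      then have "x (SOME j. x j \<in> {x i, p}) = x i" using P_out[OF p] x_in by (metis insertE singletonD)
      then show ?thesis by (intro per(3)) (simp add: x_eq)
    qed
    ultimately show ?thesis by (simp add: d_def)
  qed
  have star_x: "S = {x (i + (n - 1)), x i} \<and> d S = \<pi> (e (i + (n - 1))) \<or> S = {x i, x (Suc i)} \<and> d S = \<pi> (e i) \<or>
      (\<exists>p \<in> P i. S = {x i, p} \<and> d S = \<pi> (f i))" if "S \<in> star E (x i)" for S i
    using that d_cycle[of i] d_cycle[of "i + (n - 1)"] d_pend[of _ i] unfolding star_eq nbs_x Suc_pred xn
    by (auto simp: insert_commute)
  have \<pi>_eq: "\<pi> a = \<pi> b \<longleftrightarrow> a = b" for a b
    using \<pi> by (auto dest: injD)
  have inj: "inj_on d (star E (x i) \<union> star E (x (Suc i)))" for i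
  proof -
    let ?\<alpha> = "e (i + (n - 1))"
    have Suc_i: "x (Suc i + (n - 1)) = x i" "e (Suc i + (n - 1)) = e i" "e (Suc i + (n - 2)) = ?\<alpha>"
    proof -
      have "Suc i + (n - 1) = i + n" "Suc i + (n - 2) = i + (n - 1)" using n(2) by simp_all
      then show "x (Suc i + (n - 1)) = x i" "e (Suc i + (n - 1)) = e i" "e (Suc i + (n - 2)) = ?\<alpha>"
        by (simp_all only: xn)
    qed
    have kinds: "S = {x (i + (n - 1)), x i} \<and> d S = \<pi> ?\<alpha> \<or> S = {x i, x (Suc i)} \<and> d S = \<pi> (e i) \<or>
        S = {x (Suc i), x (Suc (Suc i))} \<and> d S = \<pi> (e (Suc i)) \<or>
        (\<exists>p \<in> P i. S = {x i, p} \<and> d S = \<pi> (f i)) \<or> (\<exists>p \<in> P (Suc i). S = {x (Suc i), p} \<and> d S = \<pi> (f (Suc i)))"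
      if "S \<in> star E (x i) \<union> star E (x (Suc i))" for S
      using that star_x[of S i] star_x[of S "Suc i"] unfolding Suc_i by blast
    have ne: "?\<alpha> \<noteq> e i" "?\<alpha> \<noteq> e (Suc i)" "e i \<noteq> e (Suc i)" using e_pred T1 by auto
    have nf: "f i \<noteq> ?\<alpha>" "f i \<noteq> e i" "f i \<noteq> e (Suc i)" if "p \<in> P i" for p
      using T2[of i] that by auto
    have nf': "f (Suc i) \<noteq> ?\<alpha>" "f (Suc i) \<noteq> e i" "f (Suc i) \<noteq> e (Suc i)" if "p \<in> P (Suc i)" for p
      using T2[of "Suc i"] that unfolding Suc_i by auto
    have nff: "f i \<noteq> f (Suc i)" if "p \<in> P i" "q \<in> P (Suc i)" for p q
      using T3 that by blast
    show ?thesis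
    proof (rule inj_onI)
      fix S S' assume S: "S \<in> star E (x i) \<union> star E (x (Suc i))" "S' \<in> star E (x i) \<union> star E (x (Suc i))" "d S = d S'"
      show "S = S'"
        using kinds[OF S(1)] kinds[OF S(2)] S(3) ne nf nf' nff P_one
        by (elim disjE bexE conjE) (simp_all add: \<pi>_eq, metis+)
    qed
  qed
  have inj_z: "inj_on d (star E (x i) \<union> star E z)" if z: "z \<in> P i" "z \<in> core" for i z
  proof -
    have "i mod n = 0 mod n" using P_core z by simp
    note 0 = per[OF this]
    have zW: "z \<notin> W" using z P_out[OF z(1)] by (auto simp: W_def)
    have dz: "d S = c' S" if "S \<in> star E z" for S using that zW by (auto simp: d_def star_def)
    have "{x i, z} \<in> E'" using z(1) zW by (auto simp: E'_def P_def nbs_def)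
    then have "inj_on c' (star E' (x i) \<union> star E' z)" using c' by (simp add: strong_def)
    moreover have "star E' z = star E z" using zW by (auto simp: star_def E'_def)
    ultimately have "inj_on c' (star E z)" by (simp add: inj_on_Un)
    then have 1: "inj_on d (star E z)" using dz by (simp add: inj_on_def)
    have 2: "inj_on d (star E (x i))" using inj[of i] by (simp add: inj_on_Un)
    have cross: "S = S'" if S: "S \<in> star E (x i)" "S' \<in> star E z" "d S = d S'" for S S'
    proof -
      have "d S' \<in> c' ` star E z" using dz[OF S(2)] S(2) by simp
      moreover have "\<pi> (e i) \<notin> c' ` star E z" "\<pi> (e (i + (n - 1))) \<notin> c' ` star E z"
      proof -
        have "(i + (n - 1)) mod n = (n - 1) mod n" using \<open>i mod n = 0 mod n\<close> by (metis add_0 mod_add_left_eq)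
        then have "e (i + (n - 1)) = e (n - 1)" by (rule per(2))
        then show "\<pi> (e i) \<notin> c' ` star E z" "\<pi> (e (i + (n - 1))) \<notin> c' ` star E z"
          using \<pi>z[of z] z 0 by auto
      qed
      ultimately have "S = {x i, z}" using star_x[OF S(1)] S(3) P_one[OF _ z(1)] by auto
      moreover have "{x i, z} \<in> star E z" using z(1) by (auto simp: P_def nbs_def star_def)
      ultimately show ?thesis using 1 S by (auto simp: inj_on_eq_iff)
    qed
    show ?thesis
    proof (rule inj_onI)
      fix S S' assume "S \<in> star E (x i) \<union> star E z" "S' \<in> star E (x i) \<union> star E z" "d S = d S'"
      then show "S = S'"
        using 1 2 cross[of S S'] cross[of S' S] by (auto simp: inj_on_eq_iff)
    qed
  qed
  have inj_nbr: "inj_on d (star E (x i) \<union> star E v)" if v: "v \<in> nbs E (x i)" for i v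
  proof -
    consider "v = x (i + (n - 1))" | "v = x (Suc i)" | "v \<in> P i" "v \<in> core" | "v \<in> P i" "v \<notin> core"
      using v nbs_x by blast
    then show ?thesis
    proof cases
      case 1
      then show ?thesis using inj[of "i + (n - 1)"] unfolding Suc_pred xn by (simp add: Un_commute)
    next
      case 4
      then have "star E v \<subseteq> star E (x i)"
        using leaf_nbr[OF 4(2) v] v by (auto simp: star_eq insert_commute)
      moreover have "inj_on d (star E (x i))" using inj[of i] by (simp add: inj_on_Un)
      ultimately show ?thesis by (simp add: Un_absorb2)
    qed (use inj inj_z in auto)
  qed
  have "strong E d"
  proof (rule strong_glue)
    show "strong {e \<in> E. \<not> e \<subseteq> W} c'" using c' by (simp add: E'_def)
    show "d S = c' S" if "\<not> S \<subseteq> W" for S using that by (simp add: d_def)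
    fix u v assume uv: "{u, v} \<in> E" "u \<in> W"
    show "inj_on d (star E u \<union> star E v)"
    proof (cases "u \<in> set xs")
      case True
      then obtain i where "u = x i" using x_ex by blast
      then show ?thesis using inj_nbr[of v i] uv by (simp add: nbs_def)
    next
      case False
      then have "u \<notin> core" "nbs E u \<inter> set xs \<noteq> {}" using leafW uv by auto
      then have "v \<in> set xs" using leaf_nbr[of u v] uv by (auto simp: nbs_def insert_commute)
      then obtain i where "v = x i" using x_ex by blast
      then show ?thesis using inj_nbr[of u i] uv by (simp add: nbs_def insert_commute Un_commute)
    qed
  qed
  then show False using uncolorable by (auto simp: colorable_def)
qed

lemma cycle_pendant:
  assumes n: "n = length xs" "3 \<le> n" "distinct xs"
    and adj: "\<And>i. i < n \<Longrightarrow> cadj (xs ! i) (xs ! (Suc i mod n))"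
    and two: "\<And>i. 0 < i \<Longrightarrow> i < n \<Longrightarrow> xs ! i \<in> two"
    and i: "i < n" "nbs E (xs ! i) \<noteq> {xs ! ((i + n - 1) mod n), xs ! (Suc i mod n)}"
  obtains p where "p \<in> nbs E (xs ! i)" "p \<notin> set xs" "0 < i \<Longrightarrow> p \<notin> core"
proof -
  have Suc_pred: "Suc ((j + n - 1) mod n) mod n = j" if "j < n" for j
    using that by (simp add: mod_Suc_eq)
  have nb: "xs ! ((j + n - 1) mod n) \<in> cnbs (xs ! j)" "xs ! (Suc j mod n) \<in> cnbs (xs ! j)" if "j < n" for j
  proof -
    have "cadj (xs ! ((j + n - 1) mod n)) (xs ! j)"
      using adj[of "(j + n - 1) mod n"] Suc_pred[OF that] that by simp
    then show "xs ! ((j + n - 1) mod n) \<in> cnbs (xs ! j)" "xs ! (Suc j mod n) \<in> cnbs (xs ! j)"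
      using adj[OF that] by (auto simp: cadj_def cnbs_def nbs_def insert_commute)
  qed
  have pred: "(j + n - 1) mod n = j - 1" if "0 < j" "j < n" for j
  proof -
    have eq: "j + n - 1 = (j - 1) + n" using that by simp
    show ?thesis unfolding eq mod_add_self2 using that by simp
  qed
  have cn: "cnbs (xs ! j) = {xs ! (j - 1), xs ! (Suc j mod n)}" if j: "0 < j" "j < n" for j
  proof -
    have "j - 1 \<noteq> Suc j mod n"
      using j n(2) by (cases "Suc j = n") auto
    moreover have "Suc j mod n < n" using j by simp
    ultimately have "card {xs ! (j - 1), xs ! (Suc j mod n)} = 2"
      using j n by (simp add: nth_eq_iff_index_eq)
    moreover have "{xs ! (j - 1), xs ! (Suc j mod n)} \<subseteq> cnbs (xs ! j)"
      using nb[OF j(2)] unfolding pred[OF j] by simp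
    moreover have "finite (cnbs (xs ! j))" using finite_nbs by (simp add: cnbs_def)
    moreover have "card (cnbs (xs ! j)) = 2" using two[OF j] by (simp add: two_def)
    ultimately show ?thesis by (metis card_subset_eq)
  qed
  obtain p where p: "p \<in> nbs E (xs ! i)" "p \<noteq> xs ! ((i + n - 1) mod n)" "p \<noteq> xs ! (Suc i mod n)"
    using nb[OF i(1)] i(2) by (auto simp: cnbs_def)
  have leaf: "p \<notin> core" if "0 < i"
  proof
    assume "p \<in> core"
    then have "p \<in> cnbs (xs ! i)" using p(1) by (simp add: cnbs_def)
    then show False using cn[OF that i(1)] p pred[OF that i(1)] by auto
  qed
  have "p \<notin> set xs"
  proof
    assume "p \<in> set xs"
    then obtain j where j: "j < n" "p = xs ! j" using n by (auto simp: in_set_conv_nth)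
    have core: "xs ! k \<in> core" if "k < n" for k using adj[OF that] by (simp add: cadj_def)
    then have i0: "i = 0" using leaf j by auto
    have "j \<noteq> 0"
    proof
      assume "j = 0"
      then have "{xs ! 0, xs ! 0} \<in> E" using p(1) j i0 by (simp add: nbs_def)
      then show False using edge_neq by blast
    qed
    then have cnj: "cnbs p = {xs ! (j - 1), xs ! (Suc j mod n)}" using cn j by simp
    have "xs ! 0 \<in> cnbs p"
      using p(1) i0 i(1) core[of 0] nbs_sym[of "xs ! 0" p] by (simp add: cnbs_def)
    moreover have "j - 1 < n" "Suc j mod n < n" "0 < n" using j by auto
    ultimately have "j - 1 = 0 \<or> Suc j mod n = 0"
      using cnj n by (auto simp: nth_eq_iff_index_eq)
    then have "j = 1 \<or> j = n - 1"
      using \<open>j \<noteq> 0\<close> j by (cases "Suc j = n") auto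
    then show False using p j i0 n(2) by auto
  qed
  then show ?thesis using that p leaf by blast
qed

text \<open>Third neighbours at different positions differ: at most the one at position 0 is in the
  core, and a leaf has a single neighbour. The offset s lets the pendant edges start anywhere, as
  needed for two adjacent vertices of a 4-cycle.\<close>

lemma cycle_pendant_cycle:
  assumes n: "n = length xs" "3 \<le> n" "distinct xs"
    and adj: "\<And>i. i < n \<Longrightarrow> cadj (xs ! i) (xs ! (Suc i mod n))"
    and two: "\<And>i. 0 < i \<Longrightarrow> i < n \<Longrightarrow> xs ! i \<in> two"
    and k: "k \<le> n" "\<And>j. j < k \<Longrightarrow> (\<lambda>i. nbs E (xs ! i) \<noteq> {xs ! ((i + n - 1) mod n), xs ! (Suc i mod n)}) ((s + j) mod n)"
  shows "pendant_cycle E n k"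
proof -
  let ?r = "\<lambda>j. (s + j) mod n"
  have r: "?r j < n" for j using n(2) by simp
  have r_inj: "j = j'" if "?r j = ?r j'" "j < n" "j' < n" for j j'
  proof (rule ccontr)
    assume "j \<noteq> j'"
    then have "n dvd max j j' - min j j'"
      using that(1) mod_eq_dvd_iff_nat[of "s + j" "s + j'" n] mod_eq_dvd_iff_nat[of "s + j'" "s + j" n]
      by (cases "j < j'") (auto simp: max_def min_def)
    then show False using that(2,3) \<open>j \<noteq> j'\<close> by (auto dest!: dvd_imp_le simp: max_def min_def split: if_splits)
  qed
  have "\<exists>p. j < k \<longrightarrow> p \<in> nbs E (xs ! ?r j) \<and> p \<notin> set xs \<and> (0 < ?r j \<longrightarrow> p \<notin> core)" for j
  proof (cases "j < k")
    case True
    note ne = k(2)[OF True]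
    show ?thesis
    proof (rule cycle_pendant[OF n adj two r ne])
      fix p assume "p \<in> nbs E (xs ! ?r j)" "p \<notin> set xs" "0 < ?r j \<Longrightarrow> p \<notin> core"
      then show ?thesis by (intro exI[of _ p]) simp
    qed
  qed simp
  then obtain p where "\<forall>j. j < k \<longrightarrow> p j \<in> nbs E (xs ! ?r j) \<and> p j \<notin> set xs \<and> (0 < ?r j \<longrightarrow> p j \<notin> core)"
    using choice[of "\<lambda>j p. j < k \<longrightarrow> p \<in> nbs E (xs ! ?r j) \<and> p \<notin> set xs \<and> (0 < ?r j \<longrightarrow> p \<notin> core)"] by blast
  then have p: "p j \<in> nbs E (xs ! ?r j) \<and> p j \<notin> set xs \<and> (0 < ?r j \<longrightarrow> p j \<notin> core)" if "j < k" for j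
    using that by blast
  have p_inj: "j = j'" if jj: "p j = p j'" "j < k" "j' < k" for j j'
  proof (rule ccontr)
    assume "j \<noteq> j'"
    then have ne: "?r j \<noteq> ?r j'" using r_inj jj k(1) by (meson order.strict_trans2)
    then have "p j \<notin> core"
      using p[OF jj(2)] p[OF jj(3)] jj(1) by auto
    then have "nbs E (p j) = {xs ! ?r j}" "nbs E (p j) = {xs ! ?r j'}"
      using p[OF jj(2)] p[OF jj(3)] jj(1) leaf_nbr[of "p j" "xs ! ?r j"] leaf_nbr[of "p j" "xs ! ?r j'"] by simp_all
    then show False using ne n(1,3) r nth_eq_iff_index_eq[of xs "?r j" "?r j'"] by simp
  qed
  define f where "f j = (if j < n then xs ! ?r j else p (j - n))" for j
  have "inj_on f {..<n + k}"
  proof (rule inj_onI)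
    fix j j' assume j: "j \<in> {..<n + k}" "j' \<in> {..<n + k}" "f j = f j'"
    have mem: "xs ! ?r i \<in> set xs" for i using n r by simp
    show "j = j'"
    proof (cases "j < n"; cases "j' < n")
      assume "j < n" "j' < n"
      then have "?r j = ?r j'" using j(3) n(1,3) r nth_eq_iff_index_eq[of xs "?r j" "?r j'"] by (simp add: f_def)
      then show ?thesis using r_inj \<open>j < n\<close> \<open>j' < n\<close> by blast
    next
      assume "\<not> j < n" "\<not> j' < n"
      then have "j - n = j' - n" using j p_inj[of "j - n" "j' - n"] by (simp add: f_def less_diff_conv2)
      then show ?thesis using \<open>\<not> j < n\<close> \<open>\<not> j' < n\<close> by linarith
    next
      assume "j < n" "\<not> j' < n"
      moreover have "j' - n < k" using j(2) \<open>\<not> j' < n\<close> unfolding lessThan_iff by linarith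
      ultimately show ?thesis using j(3) p[of "j' - n"] mem[of j] by (simp add: f_def)
    next
      assume "\<not> j < n" "j' < n"
      moreover have "j - n < k" using j(1) \<open>\<not> j < n\<close> unfolding lessThan_iff by linarith
      ultimately show ?thesis using j(3) p[of "j - n"] mem[of j'] by (simp add: f_def)
    qed
  qed
  moreover have "{f i, f (Suc i mod n)} \<in> E" if "i < n" for i
  proof -
    have "?r (Suc i mod n) = Suc (?r i) mod n" by (simp add: mod_add_right_eq mod_Suc_eq)
    then show ?thesis using that adj[OF r, of i] n(2) by (simp add: f_def cadj_def)
  qed
  moreover have "{f i, f (n + i)} \<in> E" if "i < k" for i
    using p[OF that] that k(1) by (simp add: f_def nbs_def)
  ultimately show ?thesis unfolding pendant_cycle_def by blast
qed

text \<open>From length 9 on, the cycle contains a caterpillar. For lengths 5, 6 and 8 a template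
  with all pendant edges exists because the Petersen graph has cycles of these lengths; for 3, 4 and
  7 the excluded subgraphs leave positions without a pendant edge.\<close>

lemma no_cycle:
  assumes n: "n = length xs" "3 \<le> n" "distinct xs"
    and adj: "\<And>i. i < n \<Longrightarrow> cadj (xs ! i) (xs ! (Suc i mod n))"
    and two: "\<And>i. 0 < i \<Longrightarrow> i < n \<Longrightarrow> xs ! i \<in> two"
  shows False
proof -
  let ?P = "\<lambda>i. nbs E (xs ! i) \<noteq> {xs ! ((i + n - 1) mod n), xs ! (Suc i mod n)}"
  note template = cycle_template_False[OF n adj two]
  note pendant = cycle_pendant_cycle[OF n adj two]
  show False
  proof (cases "n \<ge> 9")
    case True
    define ys where "ys = map ((!) xs) [1..<9]"
    \<comment> \<open>For n = 9 this is position 0 again.\<close>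
    let ?w = "xs ! (9 mod n)"
    have nth: "(xs ! 0 # ys @ [?w]) ! i = xs ! (i mod n)" if "i < 10" for i
      using that True by (cases "i = 9") (auto simp: ys_def nth_Cons nth_append split: nat.split)
    have len: "length ys = 8" by (simp add: ys_def)
    have "nbwalk cadj (xs ! 0 # ys @ [?w])"
      unfolding nbwalk_def
    proof (intro conjI allI impI)
      fix i
      show "cadj ((xs ! 0 # ys @ [?w]) ! i) ((xs ! 0 # ys @ [?w]) ! Suc i)" if "Suc i < length (xs ! 0 # ys @ [?w])"
      proof -
        have i: "i < 10" "Suc i < 10" "i < n" "i mod n = i" using that True by (simp_all add: len)
        show ?thesis unfolding nth[OF i(1)] nth[OF i(2)] i(4) using adj i(3) .
      qed
      show "(xs ! 0 # ys @ [?w]) ! i \<noteq> (xs ! 0 # ys @ [?w]) ! Suc (Suc i)" if "Suc (Suc i) < length (xs ! 0 # ys @ [?w])"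
      proof -
        have i: "i < 10" "Suc (Suc i) < 10" "i < n" "i mod n = i" using that True by (simp_all add: len)
        have "i \<noteq> Suc (Suc i) mod n"
          using i True by (cases "Suc (Suc i) = n") auto
        moreover have "Suc (Suc i) mod n < n" using True by simp
        ultimately show ?thesis
          unfolding nth[OF i(1)] nth[OF i(2)] i(4) using i(3) n by (simp add: nth_eq_iff_index_eq)
      qed
    qed
    moreover have "set ys \<subseteq> two" using two True by (auto simp: ys_def)
    moreover note len
    moreover have "distinct ys" using True n by (auto simp: ys_def distinct_map inj_on_def nth_eq_iff_index_eq)
    moreover have "xs ! 0 \<notin> set ys"
    proof -
      have "0 < length xs" using True n(1) by linarith
      then have ne: "xs ! 0 \<noteq> xs ! i" if "0 < i" "i < 9" for i
        using nth_eq_iff_index_eq[OF n(3), of 0 i] True n(1) that by simp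
      have "xs ! 0 \<notin> (!) xs ` {1..<9}"
      proof
        assume "xs ! 0 \<in> (!) xs ` {1..<9}"
        then obtain i where "i \<in> {1..<9}" "xs ! 0 = xs ! i" by (rule imageE) simp
        then show False using ne[of i] by simp
      qed
      then show ?thesis by (simp add: ys_def)
    qed
    moreover have "?w \<notin> set ys"
    proof (cases "n = 9")
      case False
      then have "9 < length xs" using True n(1) by linarith
      then have ne: "xs ! 9 \<noteq> xs ! i" if "0 < i" "i < 9" for i
        using nth_eq_iff_index_eq[OF n(3), of 9 i] that by simp
      have "xs ! 9 \<notin> (!) xs ` {1..<9}"
      proof
        assume "xs ! 9 \<in> (!) xs ` {1..<9}"
        then obtain i where "i \<in> {1..<9}" "xs ! 9 = xs ! i" by (rule imageE) simp
        then show False using ne[of i] by simp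
      qed
      then show ?thesis using \<open>9 < length xs\<close> n(1) by (simp add: ys_def)
    qed (use \<open>xs ! 0 \<notin> set ys\<close> in simp)
    ultimately show False by (rule caterpillar)
  next
    case False
    then consider "n = 3" | "n = 4" | "n = 5" | "n = 6" | "n = 7" | "n = 8" using n(2) by linarith
    then show False
    proof cases
      case 1
      then obtain m where m: "m < 3" "\<not> ?P m" using pendant[of 3 0] no_S3 by auto
      \<comment> \<open>Without a pendant edge at m, the other two take the two colors that the
        triangle does not use.\<close>
      have "cycle_template 3 (filter (\<lambda>i. i \<noteq> m) [0..<3]) [C0, C1, C2] (map (\<lambda>i. if i = Suc m mod 3 then C3 else C4) [0..<3])"
      proof -
        have "list_all (\<lambda>m. cycle_template 3 (filter (\<lambda>i. i \<noteq> m) [0..<3]) [C0, C1, C2]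
            (map (\<lambda>i. if i = Suc m mod 3 then C3 else C4) [0..<3])) [0..<3]" by code_simp
        then show ?thesis using m(1) by (simp only: list_all_iff set_upt) simp
      qed
      then show False using template[of "filter (\<lambda>i. i \<noteq> m) [0..<3]"] m 1 by auto
    next
      case 2
      have nonadj: "\<not> (?P i \<and> ?P (Suc i mod 4))" if "i < 4" for i
      proof
        assume P: "?P i \<and> ?P (Suc i mod 4)"
        have "?P ((i + j) mod n)" if "j < 2" for j
          using P that \<open>i < 4\<close> 2 by (cases j) (auto simp: less_Suc_eq)
        then have "pendant_cycle E n 2" using pendant[of 2 i] 2 by simp
        then show False using no_S4 2 by simp
      qed
      \<comment> \<open>The cycle edges use up four colors. All pendant edges share the fifth, since
        no two of them are at adjacent positions.\<close>
      have "cycle_template 4 (filter ?P [0..<4]) [C0, C1, C2, C3] (replicate 4 C4)"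
      proof -
        have "Suc i mod 4 \<notin> set (filter ?P [0..<4])" if "i \<in> set (filter ?P [0..<4])" for i
          using nonadj[of i] that by auto
        moreover have "list_all (\<lambda>i. distinct [[C0, C1, C2, C3] ! i, [C0, C1, C2, C3] ! (Suc i mod 4), [C0, C1, C2, C3] ! (Suc (Suc i) mod 4)]) [0..<4]"
          by code_simp
        moreover have "list_all (\<lambda>i. replicate 4 C4 ! i \<notin> set [[C0, C1, C2, C3] ! ((i + 4 - 2) mod 4), [C0, C1, C2, C3] ! ((i + 4 - 1) mod 4), [C0, C1, C2, C3] ! i, [C0, C1, C2, C3] ! (Suc i mod 4)]) [0..<4]"
          by code_simp
        ultimately show ?thesis
          unfolding cycle_template_def list_all_iff by auto
      qed
      then show False using template[of "filter ?P [0..<4]"] 2 by auto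
    next
      case 3
      have "cycle_template 5 [0..<5] [C0, C1, C2, C3, C4] [C2, C3, C4, C0, C1]" by code_simp
      then show False using template[of "[0..<5]"] 3 by auto
    next
      case 4
      have "cycle_template 6 [0..<6] [C0, C1, C2, C0, C1, C2] [C3, C4, C3, C4, C3, C4]" by code_simp
      then show False using template[of "[0..<6]"] 4 by auto
    next
      case 5
      then obtain m where m: "m < 7" "\<not> ?P m" using pendant[of 7 0] no_S7 by auto
      \<comment> \<open>The template has its gap at position 0, where the pendant color C0 is a
        dummy; rotating by 7 - m moves the gap to position m.\<close>
      have "cycle_template 7 (filter (\<lambda>i. i \<noteq> m) [0..<7])
          (rotate (7 - m) [C0, C1, C2, C3, C1, C2, C4]) (rotate (7 - m) [C0, C3, C4, C0, C4, C0, C3])"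
      proof -
        have "list_all (\<lambda>m. cycle_template 7 (filter (\<lambda>i. i \<noteq> m) [0..<7])
          (rotate (7 - m) [C0, C1, C2, C3, C1, C2, C4]) (rotate (7 - m) [C0, C3, C4, C0, C4, C0, C3])) [0..<7]" by code_simp
        then show ?thesis using m(1) by (simp only: list_all_iff set_upt) simp
      qed
      then show False using template[of "filter (\<lambda>i. i \<noteq> m) [0..<7]"] m 5 by auto
    next
      case 6
      have "cycle_template 8 [0..<8] [C0, C1, C2, C0, C3, C2, C1, C3] [C2, C4, C3, C4, C1, C4, C0, C4]" by code_simp
      then show False using template[of "[0..<8]"] 6 by auto
    qed
  qed
qed

end

section \<open>Threads and reducible configurations\<close>

lemma nbwalk_take:
  assumes "nbwalk R l"
  shows "nbwalk R (take n l)"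
  using assms by (simp add: nbwalk_def)

context minimal_uncolorable
begin

lemma two_branch: "v \<in> two \<Longrightarrow> v \<notin> branch"
  using core_eq by blast

text \<open>Consider the first return to an earlier vertex. If that vertex has core degree two and
  is not the start, its two core neighbours are its neighbours on the walk already, which leaves no
  room for a third. A return to the start closes a cycle with at most one branch vertex, contrary to
  \<open>no_cycle\<close>.\<close>

lemma distinct_walk:
  assumes walk: "nbwalk cadj l" and two: "set (tl l) \<subseteq> two"
  shows "distinct l"
proof (rule ccontr)
  assume "\<not> distinct l"
  define j where "j = (LEAST j. \<not> distinct (take (Suc j) l))"
  have "\<not> distinct (take (Suc (length l)) l)" using \<open>\<not> distinct l\<close> by simp
  then have nd: "\<not> distinct (take (Suc j) l)" unfolding j_def by (rule LeastI)
  have d: "distinct (take j l)"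
  proof (cases j)
    case (Suc j')
    then show ?thesis using not_less_Least[of j' "\<lambda>j. \<not> distinct (take (Suc j) l)"] by (simp add: j_def)
  qed simp
  have j: "j < length l"
  proof (rule ccontr)
    assume "\<not> ?thesis"
    then show False using nd d by simp
  qed
  then have "l ! j \<in> set (take j l)" using nd d by (simp add: take_Suc_conv_app_nth)
  then obtain i where i: "i < j" "l ! i = l ! j" by (auto simp: in_set_conv_nth)
  have dist: "l ! a \<noteq> l ! b" if "a < j" "b < j" "a \<noteq> b" for a b
    using d that j by (auto simp: distinct_conv_nth)
  have adj: "cadj (l ! a) (l ! Suc a)" if "Suc a < length l" for a using walk that by (simp add: nbwalk_def)
  have tw: "l ! a \<in> two" if "0 < a" "a < length l" for a
  proof -
    have "tl l ! (a - 1) = l ! a" "a - 1 < length (tl l)" using that by (auto simp: nth_tl)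
    then show ?thesis using two by (metis nth_mem subsetD)
  qed
  have "j \<noteq> Suc i" using adj[of i] cadj_neq i j by auto
  moreover have "j \<noteq> Suc (Suc i)" using walk i j by (auto simp: nbwalk_def)
  ultimately have ij: "Suc (Suc i) < j" using i by simp
  have last: "cadj (l ! (j - 1)) (l ! j)" using adj[of "j - 1"] i j by simp
  show False
  proof (cases i)
    case (Suc i')
    have "l ! Suc i' \<in> two" using tw[of i] Suc i j by simp
    then have "cnbs (l ! i) = {l ! i', l ! Suc (Suc i')}"
      using cnbs_interior[OF walk, of i'] Suc ij j by simp
    moreover have "l ! (j - 1) \<in> cnbs (l ! i)"
      using last i by (auto simp: cadj_def cnbs_def nbs_def insert_commute)
    ultimately show False
      using dist[of "j - 1" i'] dist[of "j - 1" "Suc (Suc i')"] ij Suc by auto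
  next
    case 0
    show False
    proof (rule no_cycle[of j "take j l"])
      show "j = length (take j l)" "3 \<le> j" "distinct (take j l)" using j ij 0 d by simp_all
      show "cadj (take j l ! a) (take j l ! (Suc a mod j))" if "a < j" for a
      proof (cases "Suc a = j")
        case True
        then show ?thesis using last i 0 ij by auto
      next
        case False
        then show ?thesis using that adj[of a] j by simp
      qed
      show "take j l ! a \<in> two" if "0 < a" "a < j" for a using tw that j by simp
    qed
  qed
qed

definition thread :: "'a list \<Rightarrow> bool" where
  "thread l \<longleftrightarrow> nbwalk cadj l \<and> 2 \<le> length l \<and> hd l \<in> branch \<and> last l \<in> branch \<and> set (butlast (tl l)) \<subseteq> two"

lemma thread_rev: "thread l \<Longrightarrow> thread (rev l)"
  using nbwalk_rev[of cadj, OF cadj_sym] by (auto simp: thread_def interior_rev hd_rev last_rev)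

text \<open>By \<open>distinct_walk\<close> only the two ends could coincide, and then the thread
  would be a cycle with one branch vertex.\<close>

lemma thread_distinct:
  assumes "thread l"
  shows "distinct l"
proof -
  have l: "nbwalk cadj l" "2 \<le> length l" "last l \<in> branch" "set (butlast (tl l)) \<subseteq> two"
    using assms by (auto simp: thread_def)
  have "nbwalk cadj (butlast l)" using nbwalk_take[OF l(1)] by (simp add: butlast_conv_take)
  then have d: "distinct (butlast l)"
    using distinct_walk[of "butlast l"] l(4) by (simp add: butlast_tl)
  have split: "l = butlast l @ [last l]" using l(2) by (cases l rule: rev_cases) auto
  have "last l \<notin> set (butlast l)"
  proof
    assume mem: "last l \<in> set (butlast l)"
    moreover have "last l \<notin> set (tl (butlast l))"
      using two_branch l(3,4) by (auto simp: butlast_tl)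
    ultimately have hd: "l ! 0 = last l"
      using l(2) by (cases l) (auto split: if_splits)
    have last: "last l = l ! (length l - 1)" using l(2) by (intro last_conv_nth) auto
    have "length l \<noteq> 2"
    proof
      assume "length l = 2"
      then have "cadj (l ! 0) (l ! 1)" using l(1) by (simp add: nbwalk_def)
      then show False using cadj_neq hd last \<open>length l = 2\<close> by auto
    qed
    moreover have "length l \<noteq> 3"
    proof
      assume "length l = 3"
      then have "l ! 0 \<noteq> l ! 2" using l(1) by (simp add: nbwalk_def numeral_2_eq_2)
      then show False using hd last \<open>length l = 3\<close> by auto
    qed
    ultimately have len: "length l \<ge> 4" using l(2) by simp
    show False
    proof (rule no_cycle[of "length l - 1" "butlast l"])
      show "length l - 1 = length (butlast l)" "3 \<le> length l - 1" "distinct (butlast l)"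
        using len d by simp_all
      show "cadj (butlast l ! a) (butlast l ! (Suc a mod (length l - 1)))" if a: "a < length l - 1" for a
      proof -
        have "cadj (l ! a) (l ! Suc a)" using a l(1) by (simp add: nbwalk_def)
        then show ?thesis
          using a hd last len by (cases "Suc a = length l - 1") (auto simp: nth_butlast)
      qed
      show "butlast l ! a \<in> two" if a: "0 < a" "a < length l - 1" for a
      proof -
        have "butlast (tl l) ! (a - 1) = butlast l ! a" "a - 1 < length (butlast (tl l))"
          using a by (auto simp: nth_butlast nth_tl)
        then show ?thesis using l(4) by (metis nth_mem subsetD)
      qed
    qed
  qed
  then have "distinct (butlast l @ [last l])" using d by simp
  then show ?thesis using split by simp
qed

text \<open>A vertex of core degree two leaves no choice for the next step, and l' cannot stop
  before l because it ends at a branch vertex.\<close>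

lemma walk_prefix:
  assumes "nbwalk cadj l" "nbwalk cadj l'" "set (butlast (tl l)) \<subseteq> two" "set (butlast (tl l')) \<subseteq> two"
    "last l' \<in> branch" "l = x # y # r" "l' = x # y # r'"
  shows "\<exists>t. l' = l @ t"
  using assms
proof (induction r arbitrary: l l' x y r')
  case (Cons c s)
  have y: "y \<in> two" using Cons.prems by simp
  have "r' \<noteq> []" using Cons.prems two_branch[OF y] by auto
  then obtain c' s' where r': "r' = c' # s'" by (cases r') auto
  have "cnbs y = {x, c}" "cnbs y = {x, c'}"
    using cnbs_interior[OF Cons.prems(1), of 0] cnbs_interior[OF Cons.prems(2), of 0] Cons.prems(6,7) r' y by auto
  moreover have "x \<noteq> c" "x \<noteq> c'"
    using Cons.prems(1,2,6,7) r' by (auto simp: nbwalk_def)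
  ultimately have c: "c' = c" by auto
  have "nbwalk cadj (y # c # s)" "nbwalk cadj (y # c # s')"
    using nbwalk_drop[OF Cons.prems(1), of 1] nbwalk_drop[OF Cons.prems(2), of 1] Cons.prems(6,7) r' c by auto
  then have "\<exists>t. y # c # s' = (y # c # s) @ t"
  proof (rule Cons.IH)
    show "set (butlast (tl (y # c # s))) \<subseteq> two" "set (butlast (tl (y # c # s'))) \<subseteq> two"
      "last (y # c # s') \<in> branch"
      using Cons.prems(3-7) unfolding r' c by simp_all
  qed simp_all
  then show ?case using Cons.prems r' c by simp
qed simp

lemma walk_determined:
  assumes "nbwalk cadj l" "nbwalk cadj l'" "set (butlast (tl l)) \<subseteq> two" "set (butlast (tl l')) \<subseteq> two"
    "last l \<in> branch" "last l' \<in> branch" "l = x # y # r" "l' = x # y # r'"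
  shows "l = l'"
proof -
  obtain t t' where "l' = l @ t" "l = l' @ t'"
    using walk_prefix[OF assms(1-4,6-8)] walk_prefix[OF assms(2,1,4,3,5,8,7)] by blast
  then show ?thesis by simp
qed

text \<open>After the common arc the threads agree by \<open>walk_determined\<close>; the same for
  the reversed threads gives agreement before it.\<close>

lemma thread_aligned:
  assumes l: "thread l" "thread l'"
    and i: "Suc (Suc i) < length l" "Suc (Suc j) < length l'"
    and eq: "l ! i = l' ! j" "l ! Suc i = l' ! Suc j"
  shows "l = l'"
proof -
  have drop2: "drop k m = m ! k # m ! Suc k # drop (Suc (Suc k)) m" if "Suc k < length m" for k and m :: "'a list"
    using that by (simp add: Cons_nth_drop_Suc)
  have int: "set (butlast (tl (drop k m))) \<subseteq> two" if "thread m" for k m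
  proof -
    have "butlast (tl (drop k m)) = drop k (butlast (tl m))"
      by (simp only: tl_drop butlast_drop)
    then show ?thesis using that set_drop_subset[of k "butlast (tl m)"] by (auto simp: thread_def)
  qed
  have suffix: "drop k m = drop k' m'"
    if "thread m" "thread m'" "Suc k < length m" "Suc k' < length m'" "m ! k = m' ! k'" "m ! Suc k = m' ! Suc k'" for k k' m m'
  proof (rule walk_determined)
    show "nbwalk cadj (drop k m)" "nbwalk cadj (drop k' m')" using that by (auto simp: thread_def nbwalk_drop)
    show "set (butlast (tl (drop k m))) \<subseteq> two" "set (butlast (tl (drop k' m'))) \<subseteq> two" using int that by auto
    show "last (drop k m) \<in> branch" "last (drop k' m') \<in> branch" using that by (auto simp: thread_def)
    show "drop k m = m ! k # m ! Suc k # drop (Suc (Suc k)) m" using drop2 that by simp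
    show "drop k' m' = m ! k # m ! Suc k # drop (Suc (Suc k')) m'" using drop2 that by simp
  qed
  have 1: "drop i l = drop j l'" using suffix[OF l] i eq by simp
  have "drop (length l - Suc (Suc i)) (rev l) = drop (length l' - Suc (Suc j)) (rev l')"
    by (rule suffix[OF thread_rev[OF l(1)] thread_rev[OF l(2)]]) (use i eq in \<open>auto simp: rev_nth Suc_diff_Suc\<close>)
  then have "rev (take (Suc (Suc i)) l) = rev (take (Suc (Suc j)) l')"
    using i by (simp add: rev_take)
  then have 2: "take (Suc (Suc i)) l = take (Suc (Suc j)) l'" by simp
  then have "i = j" using i by (metis length_take min.absorb2 less_imp_le old.nat.inject)
  then show ?thesis using 1 2 by (metis append_take_drop_id min.absorb1 le_SucI order_refl take_take)
qed

text \<open>At a common interior vertex both threads pass the same two neighbours, in equal or in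
  opposite order, and \<open>thread_aligned\<close> applies to them or after reversing one.\<close>

lemma thread_meet:
  assumes l: "thread l" "thread l'" and v: "v \<in> set (butlast (tl l))" "v \<in> set (butlast (tl l'))"
  shows "l' = l \<or> l' = rev l"
proof -
  obtain i where i: "Suc (Suc i) < length l" "l ! Suc i = v" using v(1) by (rule mem_interior)
  obtain j where j: "Suc (Suc j) < length l'" "l' ! Suc j = v" using v(2) by (rule mem_interior)
  have "v \<in> two" using v l by (auto simp: thread_def)
  then have "{l ! i, l ! Suc (Suc i)} = {l' ! j, l' ! Suc (Suc j)}"
    using cnbs_interior[of l i] cnbs_interior[of l' j] i j l by (simp add: thread_def)
  then consider "l ! i = l' ! j" | "l ! i = l' ! Suc (Suc j)" by (auto simp: doubleton_eq_iff)
  then show ?thesis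
  proof cases
    case 1
    then show ?thesis using thread_aligned[OF l i(1) j(1)] i j by simp
  next
    case 2
    let ?j = "length l' - Suc (Suc (Suc j))"
    have "rev l' ! ?j = l' ! Suc (Suc j)" "rev l' ! Suc ?j = l' ! Suc j"
      using j by (auto simp: rev_nth Suc_diff_Suc)
    then have "l = rev l'"
      using thread_aligned[OF l(1) thread_rev[OF l(2)] i(1), of ?j] 2 i j by simp
    then show ?thesis by simp
  qed
qed

lemma thread_unique:
  assumes "thread l" "thread l'" "hd l = hd l'" "l ! 1 = l' ! 1"
  shows "l = l'"
proof -
  have "m = hd m # m ! 1 # drop 2 m" if "thread m" for m
    using that by (cases m; cases "tl m") (auto simp: thread_def)
  then show ?thesis
    using walk_determined[of l l' "hd l" "l ! 1" "drop 2 l" "drop 2 l'"] assms by (metis thread_def)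
qed

lemma long_walk:
  assumes "nbwalk cadj l" "distinct l" "set (butlast (tl l)) \<subseteq> two"
  shows "length l \<le> 9"
proof (rule ccontr)
  assume "\<not> ?thesis"
  then have len: "length l \<ge> 10" by simp
  let ?xs = "take 8 (tl l)"
  have split: "take 10 l = hd l # ?xs @ [l ! 9]"
    using len by (cases l) (auto simp: take_Suc_conv_app_nth[of 8, simplified] nth_Cons numeral_eq_Suc take_Suc_conv_app_nth)
  have d: "distinct (hd l # ?xs @ [l ! 9])"
    unfolding split[symmetric] using assms(2) by simp
  have "?xs = take 8 (butlast (tl l))"
    using len by (simp add: take_butlast)
  then have two: "set ?xs \<subseteq> two"
    using assms(3) set_take_subset by fastforce
  show False
  proof (rule caterpillar)
    show "nbwalk cadj (hd l # ?xs @ [l ! 9])" unfolding split[symmetric] using assms(1) by (rule nbwalk_take)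
  qed (use d two len in auto)
qed

lemma thread_length: "thread l \<Longrightarrow> length l \<le> 9"
  using long_walk thread_distinct by (auto simp: thread_def)

text \<open>A walk of ten vertices that stays in \<open>two\<close> after its first vertex
  contradicts \<open>long_walk\<close>. In particular no component of the core is a cycle, and every
  vertex of \<open>two\<close> lies on a thread.\<close>

lemma walk_to_branch:
  assumes "u \<in> core" "y \<in> cnbs u"
  shows "\<exists>l. nbwalk cadj l \<and> 2 \<le> length l \<and> last l \<in> branch \<and> set (butlast (tl l)) \<subseteq> two \<and> hd l = u \<and> l ! 1 = y"
proof -
  have "(\<exists>l. nbwalk cadj l \<and> 2 \<le> length l \<and> last l \<in> branch \<and> set (butlast (tl l)) \<subseteq> two \<and> hd l = u \<and> l ! 1 = y) \<or>
      (\<exists>l. nbwalk cadj l \<and> length l = n + 2 \<and> hd l = u \<and> l ! 1 = y \<and> set (tl l) \<subseteq> two)" for n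
  proof (induction n)
    case 0
    have "u \<in> core" "y \<in> core" using assms by (auto simp: cnbs_def)
    then have "nbwalk cadj [u, y]"
      using cadj_cnbs[of u y] assms by (simp add: nbwalk_def)
    show ?case
    proof (cases "y \<in> two")
      case True
      then show ?thesis using \<open>nbwalk cadj [u, y]\<close> by (intro disjI2 exI[of _ "[u, y]"]) simp
    next
      case False
      then have "y \<in> branch" using \<open>y \<in> core\<close> core_eq by blast
      then show ?thesis
        using \<open>nbwalk cadj [u, y]\<close> by (intro disjI1 exI[of _ "[u, y]"]) simp
    qed
  next
    case (Suc n)
    then show ?case
    proof
      assume "\<exists>l. nbwalk cadj l \<and> length l = n + 2 \<and> hd l = u \<and> l ! 1 = y \<and> set (tl l) \<subseteq> two"
      then obtain l where l: "nbwalk cadj l" "length l = n + 2" "hd l = u" "l ! 1 = y" "set (tl l) \<subseteq> two" by blast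
      have lastl: "last l = l ! Suc n" using l(2) by (subst last_conv_nth) auto
      have "tl l \<noteq> []" using l(2) by (cases l) auto
      then have last: "last l \<in> two" using l(5) by (metis last_in_set last_tl subsetD)
      have "cadj (l ! n) (last l)" using l(1,2) lastl by (simp add: nbwalk_def)
      then have "l ! n \<in> cnbs (last l)" by (auto simp: cadj_def cnbs_def nbs_def insert_commute)
      moreover have "card (cnbs (last l)) = 2" using last by (simp add: two_def)
      ultimately obtain c where c: "c \<in> cnbs (last l)" "c \<noteq> l ! n" by (auto simp: card_2_iff)
      have "last l \<in> core" using last by (simp add: two_def)
      then have "cadj (last l) c" using cadj_cnbs c by simp
      then have walk: "nbwalk cadj (l @ [c])" using nbwalk_snoc[OF l(1)] l(2) c by auto
      have ne: "l \<noteq> []" using l(2) by auto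
      show ?thesis
      proof (cases "c \<in> two")
        case True
        then show ?thesis
          using walk l ne by (intro disjI2 exI[of _ "l @ [c]"]) (auto simp: nth_append)
      next
        case False
        then have "c \<in> branch" using c core_eq by (auto simp: cnbs_def)
        then show ?thesis
          using walk l ne assms(1) by (intro disjI1 exI[of _ "l @ [c]"]) (auto simp: nth_append)
      qed
    qed simp
  qed
  moreover have False if "nbwalk cadj l" "length l = 8 + 2" "set (tl l) \<subseteq> two" for l
  proof -
    have "set (butlast (tl l)) \<subseteq> two" using that(3) by (meson in_set_butlastD subset_iff)
    then show False using long_walk[OF that(1) distinct_walk[OF that(1,3)]] that(2) by simp
  qed
  ultimately show ?thesis by blast
qed

lemma thread_exists:
  assumes "u \<in> branch" "y \<in> cnbs u"
  shows "\<exists>l. thread l \<and> hd l = u \<and> l ! 1 = y"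
  using walk_to_branch[of u y] assms by (auto simp: thread_def branch_def)

end

section \<open>Recoloring systems of threads\<close>

context minimal_uncolorable
begin

text \<open>The threads in \<open>L\<close> are recolored together with their ends in \<open>Z\<close>; each of them ends in \<open>Z\<close>,
  and starts either in \<open>Z\<close> or at a branch vertex that keeps its colors, where \<open>B\<close> and \<open>X\<close> give the
  arc of the Petersen graph from which the recoloring has to start.\<close>

lemma configuration:
  assumes Z: "Z \<subseteq> branch"
    and L: "\<And>l. l \<in> L \<Longrightarrow> thread l \<and> last l \<in> Z"
    and disj: "\<And>l l'. l \<in> L \<Longrightarrow> l' \<in> L \<Longrightarrow> l \<noteq> l' \<Longrightarrow> l' \<noteq> rev l"
    and cover: "\<And>z n. z \<in> Z \<Longrightarrow> n \<in> cnbs z \<Longrightarrow>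
      \<exists>l \<in> L. last l = z \<and> l ! (length l - 2) = n \<or> hd l = z \<and> l ! 1 = n"
    and long: "\<exists>l \<in> L. 3 \<le> length l"
  obtains B X where
    "\<And>l. l \<in> L \<Longrightarrow> hd l \<notin> Z \<Longrightarrow> padj (B (hd l)) (X (hd l) (l ! 1))"
    "\<And>p g. (\<And>l. l \<in> L \<Longrightarrow> reach (length l - 2)
        (if hd l \<in> Z then p (hd l) else B (hd l)) (if hd l \<in> Z then g (hd l) (l ! 1) else X (hd l) (l ! 1))
        (g (last l) (l ! (length l - 2))) (p (last l))) \<Longrightarrow>
      (\<And>z. z \<in> Z \<Longrightarrow> inj_on (g z) (cnbs z)) \<Longrightarrow> False"
proof -
  define U where "U = Z \<union> (\<Union>l \<in> L. set (butlast (tl l)))"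
  have thr: "nbwalk cadj l" "2 \<le> length l" "hd l \<in> branch" "last l \<in> branch" "set (butlast (tl l)) \<subseteq> two"
    if "l \<in> L" for l using L[OF that] by (auto simp: thread_def)
  have int_branch: "w \<notin> set (butlast (tl l))" if "w \<in> branch" "l \<in> L" for w l
    using thr(5)[OF that(2)] two_branch that(1) by blast
  have cons2: "m = hd m # m ! 1 # drop 2 m" if "2 \<le> length m" for m :: "'a list"
    using that by (cases m; cases "tl m") auto
  have rev1: "hd (rev m) = last m" "rev m ! 1 = m ! (length m - 2)" if "2 \<le> length m" for m :: "'a list"
    using that by (auto simp: hd_rev rev_nth numeral_2_eq_2)
  have cover': "\<exists>l \<in> L \<union> rev ` L. \<exists>l'. l = z # n # l'" if zn: "z \<in> Z" "n \<in> cnbs z" for z n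
  proof -
    obtain l where l: "l \<in> L" "last l = z \<and> l ! (length l - 2) = n \<or> hd l = z \<and> l ! 1 = n"
      using cover[OF zn] by blast
    from l(2) show ?thesis
    proof
      assume "hd l = z \<and> l ! 1 = n"
      then show ?thesis using cons2[OF thr(2)[OF l(1)]] l(1) by blast
    next
      assume "last l = z \<and> l ! (length l - 2) = n"
      then have "rev l = z # n # drop 2 (rev l)"
        using cons2[of "rev l"] rev1[OF thr(2)[OF l(1)]] thr(2)[OF l(1)] by simp
      then show ?thesis using l(1) by blast
    qed
  qed
  have second: "l ! 1 \<in> U" if l: "l \<in> L" for l
  proof (cases "length l = 2")
    case True
    then have "l ! 1 = last l" by (subst last_conv_nth) auto
    then show ?thesis using L[OF l] by (simp add: U_def)
  next
    case False
    then have "butlast (tl l) ! 0 = l ! 1" "0 < length (butlast (tl l))"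
      using thr(2)[OF l] by (auto simp: nth_butlast nth_tl)
    then have "l ! 1 \<in> set (butlast (tl l))" by (metis nth_mem)
    then show ?thesis using l by (auto simp: U_def)
  qed
  \<comment> \<open>A thread with an interior vertex provides an edge inside U, which
    \<open>extension\<close> has to remove.\<close>
  obtain l0 where l0: "l0 \<in> L" "3 \<le> length l0" using long by blast
  have e0: "{l0 ! (length l0 - 2), last l0} \<in> E" "l0 ! (length l0 - 2) \<in> U" "last l0 \<in> U"
  proof -
    have "Suc (length l0 - 2) = length l0 - 1" "l0 \<noteq> []" using l0(2) by auto
    moreover have "cadj (l0 ! (length l0 - 2)) (l0 ! Suc (length l0 - 2))"
      using thr(1)[OF l0(1)] l0(2) by (simp add: nbwalk_def)
    ultimately show "{l0 ! (length l0 - 2), last l0} \<in> E" by (simp add: cadj_def last_conv_nth)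
    have "butlast (tl l0) ! (length l0 - 3) = l0 ! (length l0 - 2)" "length l0 - 3 < length (butlast (tl l0))"
      using l0(2) by (auto simp: nth_butlast nth_tl Suc_diff_Suc numeral_eq_Suc)
    then have "l0 ! (length l0 - 2) \<in> set (butlast (tl l0))" by (metis nth_mem)
    then show "l0 ! (length l0 - 2) \<in> U" using l0(1) by (auto simp: U_def)
    show "last l0 \<in> U" using L[OF l0(1)] by (simp add: U_def)
  qed
  have walks: "nbwalk cadj l \<and> set (butlast (tl l)) \<subseteq> two" if "l \<in> L" for l
    using thr that by blast
  from walk_system[OF walks U_def Z cover' e0] obtain B X where
    B: "\<And>w x l l'. l \<in> L \<union> rev ` L \<Longrightarrow> w \<notin> U \<Longrightarrow> x \<in> U \<Longrightarrow> l = w # x # l' \<Longrightarrow> padj (B w) (X w x)" and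
    X: "\<And>T. (\<And>l. l \<in> L \<Longrightarrow> nbwalk padj (map T l)) \<Longrightarrow>
      (\<And>l w x l'. l \<in> L \<union> rev ` L \<Longrightarrow> l = w # x # l' \<Longrightarrow> w \<notin> U \<Longrightarrow> x \<in> U \<Longrightarrow> T w = B w \<and> T x = X w x) \<Longrightarrow>
      (\<And>z. z \<in> Z \<Longrightarrow> inj_on T (cnbs z)) \<Longrightarrow> False"
    by blast
  show ?thesis
  proof (rule that[of B X])
    fix l assume l: "l \<in> L" "hd l \<notin> Z"
    have "hd l \<notin> U" using int_branch[OF thr(3)[OF l(1)]] l by (auto simp: U_def)
    then show "padj (B (hd l)) (X (hd l) (l ! 1))"
      using B[OF _ _ second[OF l(1)] cons2[OF thr(2)[OF l(1)]]] l(1) by blast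
  next
    fix p g
    define b c where "b l = (if hd l \<in> Z then g (hd l) (l ! 1) else X (hd l) (l ! 1))"
      and "c l = g (last l) (l ! (length l - 2))" for l
    assume "\<And>l. l \<in> L \<Longrightarrow> reach (length l - 2)
        (if hd l \<in> Z then p (hd l) else B (hd l)) (if hd l \<in> Z then g (hd l) (l ! 1) else X (hd l) (l ! 1))
        (g (last l) (l ! (length l - 2))) (p (last l))"
      and inj: "\<And>z. z \<in> Z \<Longrightarrow> inj_on (g z) (cnbs z)"
    then have reach: "reach (length l - 2) (if hd l \<in> Z then p (hd l) else B (hd l)) (b l) (c l) (p (last l))"
      if "l \<in> L" for l using that by (simp add: b_def c_def)
    have b: "b l = X (hd l) (l ! 1)" if "hd l \<notin> Z" for l using that by (simp add: b_def)
    have g: "g (last l) (l ! (length l - 2)) = c l" "hd l \<in> Z \<Longrightarrow> g (hd l) (l ! 1) = b l" for l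
      by (simp_all add: b_def c_def)
    define val where "val z = (if z \<in> Z then p z else B z)" for z
    have "\<exists>F. l \<in> L \<longrightarrow> length F = length l \<and> nbwalk padj F \<and> F ! 0 = val (hd l) \<and>
        F ! 1 = b l \<and> F ! (length l - 2) = c l \<and> F ! (length l - 1) = p (last l)" for l
    proof (cases "l \<in> L")
      case True
      let ?k = "length l - 2"
      obtain vs where vs: "length vs = ?k" "nbwalk padj (val (hd l) # vs @ [p (last l)])"
        "hd (vs @ [p (last l)]) = b l" "last (val (hd l) # vs) = c l"
        using reach_walk[OF reach[OF True]] by (auto simp: val_def)
      let ?F = "val (hd l) # vs @ [p (last l)]"
      have k: "length l = Suc (Suc ?k)" using thr(2)[OF True] by simp
      have "?F ! 1 = b l" using vs(3) by (cases vs) auto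
      moreover have "?F ! ?k = c l"
        using vs(1,4) last_conv_nth[of "val (hd l) # vs"] unfolding append_Cons[symmetric]
        by (subst nth_append) (simp del: append_Cons)
      moreover have "?F ! Suc ?k = p (last l)" using vs(1) by (simp add: nth_append)
      moreover have "length l - 1 = Suc ?k" using k by simp
      ultimately show ?thesis using vs k by (intro exI[of _ ?F]) simp
    qed simp
    then obtain F where "\<forall>l. l \<in> L \<longrightarrow> length (F l) = length l \<and> nbwalk padj (F l) \<and> F l ! 0 = val (hd l) \<and>
        F l ! 1 = b l \<and> F l ! (length l - 2) = c l \<and> F l ! (length l - 1) = p (last l)"
      using choice[of "\<lambda>l F. l \<in> L \<longrightarrow> length F = length l \<and> nbwalk padj F \<and> F ! 0 = val (hd l) \<and>
        F ! 1 = b l \<and> F ! (length l - 2) = c l \<and> F ! (length l - 1) = p (last l)"] by blast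
    then have F: "length (F l) = length l" "nbwalk padj (F l)" "F l ! 0 = val (hd l)"
        "F l ! 1 = b l" "F l ! (length l - 2) = c l" "F l ! (length l - 1) = p (last l)" if "l \<in> L" for l
      using that by auto
    \<comment> \<open>By \<open>thread_meet\<close> and \<open>disj\<close> an interior vertex lies
      on one thread of L only, and by \<open>thread_distinct\<close> at one position, so both
      choices are determined. All other vertices, the ends included, take
      \<open>val\<close>.\<close>
    define T where "T v = (if \<exists>l \<in> L. v \<in> set (butlast (tl l)) then
      (let l = SOME l. l \<in> L \<and> v \<in> set (butlast (tl l)) in F l ! (SOME i. i < length l \<and> l ! i = v)) else val v)" for v
    have T_nth: "T (l ! i) = F l ! i" if l: "l \<in> L" "i < length l" for l i
    proof -
      have ne: "l \<noteq> []" using thr(2)[OF l(1)] by auto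
      consider "i = 0" | "i = length l - 1" | "0 < i" "Suc i < length l" using l(2) by linarith
      then show ?thesis
      proof cases
        case 1
        have "l ! i = hd l" using 1 ne by (simp add: hd_conv_nth)
        moreover have "T (hd l) = val (hd l)"
          using int_branch[OF thr(3)[OF l(1)]] by (auto simp: T_def)
        ultimately show ?thesis using F(3)[OF l(1)] 1 by simp
      next
        case 2
        have "l ! i = last l" using 2 ne by (simp add: last_conv_nth)
        moreover have "T (last l) = p (last l)"
          using int_branch[OF thr(4)[OF l(1)]] L[OF l(1)] by (auto simp: T_def val_def)
        ultimately show ?thesis using F(6)[OF l(1)] 2 by simp
      next
        case 3
        then have "butlast (tl l) ! (i - 1) = l ! i" "i - 1 < length (butlast (tl l))"
          by (auto simp: nth_butlast nth_tl)
        then have mem: "l ! i \<in> set (butlast (tl l))" by (metis nth_mem)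
        have "(SOME m. m \<in> L \<and> l ! i \<in> set (butlast (tl m))) = l"
        proof (rule some_equality)
          fix m assume m: "m \<in> L \<and> l ! i \<in> set (butlast (tl m))"
          then have "m = l \<or> m = rev l" using thread_meet[of l m "l ! i"] L l(1) mem by blast
          then show "m = l" using disj[OF l(1), of m] m by metis
        qed (use l mem in simp)
        moreover have "(SOME j. j < length l \<and> l ! j = l ! i) = i"
          using thread_distinct[of l] L[OF l(1)] l(2)
          by (intro some_equality) (auto simp: nth_eq_iff_index_eq)
        ultimately show ?thesis using mem l(1) by (auto simp: T_def)
      qed
    qed
    have T_map: "map T l = F l" if "l \<in> L" for l
      using F(1)[OF that] T_nth[OF that] by (intro nth_equalityI) auto
    show False
    proof (rule X[of T])
      show "nbwalk padj (map T l)" if "l \<in> L" for l using T_map[OF that] F(2)[OF that] by simp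
    next
      fix l w x l' assume l: "l \<in> L \<union> rev ` L" "l = w # x # l'" "w \<notin> U" "x \<in> U"
      \<comment> \<open>Every thread of L ends in Z, so no reversed thread starts outside U.\<close>
      have "l \<in> L"
      proof (rule ccontr)
        assume "l \<notin> L"
        then obtain m where "m \<in> L" "l = rev m" using l(1) by blast
        then have "last m = w" using l(2) by (metis hd_rev list.sel(1))
        then show False using L[OF \<open>m \<in> L\<close>] l(3) by (auto simp: U_def)
      qed
      moreover have "hd l = w" "l ! 1 = x" "l ! 0 = w" using l(2) by simp_all
      moreover have "w \<notin> Z" using l(3) by (simp add: U_def)
      ultimately show "T w = B w \<and> T x = X w x"
        using T_nth[of l 0] T_nth[of l 1] F(3,4)[of l] b[of l] l(2) by (simp add: val_def)
    next
      fix z assume z: "z \<in> Z"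
      have "T n = g z n" if n: "n \<in> cnbs z" for n
      proof -
        obtain l where l: "l \<in> L" "last l = z \<and> l ! (length l - 2) = n \<or> hd l = z \<and> l ! 1 = n"
          using cover[OF z n] by blast
        then show ?thesis
          using T_nth[OF l(1), of "length l - 2"] T_nth[OF l(1), of 1] F(4,5)[OF l(1)] g[of l] thr(2)[OF l(1)] z
          by auto
      qed
      then show "inj_on T (cnbs z)" using inj[OF z] by (simp add: inj_on_def)
    qed
  qed
qed

end

section \<open>The four configurations realized by threads\<close>

context minimal_uncolorable
begin

text \<open>A thread is addressed by its first arc. Its reversal is addressed by
  \<open>fin u y\<close> and \<open>pen u y\<close>, which thus form an involution on the arcs
  leaving branch vertices (\<open>fin_fin\<close>). The subtraction of 2 in \<open>klen\<close>
  discards the ends, leaving the interior vertices.\<close>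

definition th :: "'a \<Rightarrow> 'a \<Rightarrow> 'a list" where
  "th u y = (THE l. thread l \<and> hd l = u \<and> l ! 1 = y)"

definition klen :: "'a \<Rightarrow> 'a \<Rightarrow> nat" where
  "klen u y = length (th u y) - 2"

definition fin :: "'a \<Rightarrow> 'a \<Rightarrow> 'a" where
  "fin u y = last (th u y)"

definition pen :: "'a \<Rightarrow> 'a \<Rightarrow> 'a" where
  "pen u y = th u y ! (length (th u y) - 2)"

lemma th:
  assumes "u \<in> branch" "y \<in> cnbs u"
  shows "thread (th u y)" "hd (th u y) = u" "th u y ! 1 = y"
proof -
  obtain l where l: "thread l \<and> hd l = u \<and> l ! 1 = y" using thread_exists[OF assms] by blast
  then have "th u y = l" unfolding th_def using thread_unique by (intro the_equality) auto
  then show "thread (th u y)" "hd (th u y) = u" "th u y ! 1 = y" using l by auto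
qed

lemma th_eq: "thread l \<Longrightarrow> th (hd l) (l ! 1) = l"
  unfolding th_def using thread_unique by (intro the_equality) auto

lemma thread_second: "thread l \<Longrightarrow> l ! 1 \<in> cnbs (hd l)"
proof -
  assume l: "thread l"
  then have "l \<noteq> []" by (auto simp: thread_def)
  then have "cadj (l ! 0) (l ! 1)" "l ! 0 = hd l" using l by (auto simp: thread_def nbwalk_def hd_conv_nth)
  then show ?thesis using cadj_cnbs by (auto simp: cadj_def cnbs_def nbs_def)
qed

lemma thread_rev_ends:
  assumes "2 \<le> length l"
  shows "hd (rev l) = last l" "rev l ! 1 = l ! (length l - 2)" "last (rev l) = hd l" "rev l ! (length l - 2) = l ! 1"
  using assms by (auto simp: hd_rev last_rev rev_nth numeral_2_eq_2 Suc_diff_Suc)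

context
  fixes u y
  assumes u: "u \<in> branch" and y: "y \<in> cnbs u"
begin

lemma th_length: "length (th u y) = klen u y + 2" "klen u y \<le> 7"
  using th(1)[OF u y] thread_length[OF th(1)[OF u y]] by (auto simp: klen_def thread_def)

lemma th_ends: "last (th u y) = fin u y" "th u y ! klen u y = pen u y"
  by (simp_all add: fin_def pen_def klen_def)

lemma th_rev: "hd (rev (th u y)) = fin u y" "rev (th u y) ! 1 = pen u y" "last (rev (th u y)) = u"
    "rev (th u y) ! klen u y = y" "thread (rev (th u y))"
  using thread_rev_ends[of "th u y"] th[OF u y] th_length thread_rev by (auto simp: fin_def pen_def)

lemma fin_branch: "fin u y \<in> branch"
  using th(1)[OF u y] by (simp add: thread_def fin_def)

lemma pen_cnbs: "pen u y \<in> cnbs (fin u y)"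
  using thread_second[OF th_rev(5)] unfolding th_rev(1,2) .

lemma th_fin: "th (fin u y) (pen u y) = rev (th u y)"
  using th_eq[OF th_rev(5)] unfolding th_rev(1,2) .

lemma fin_fin: "fin (fin u y) (pen u y) = u" "pen (fin u y) (pen u y) = y" "klen (fin u y) (pen u y) = klen u y"
  using th_rev(3,4) th_length unfolding fin_def[of "fin u y"] pen_def[of "fin u y"] klen_def[of "fin u y"] th_fin by simp_all

lemma fin_neq: "fin u y \<noteq> u"
proof
  assume "fin u y = u"
  moreover have "distinct (th u y)" using thread_distinct th(1)[OF u y] by blast
  moreover have "hd (th u y) = u" using th(2)[OF u y] .
  ultimately show False
    using th_length(1) by (cases "th u y") (auto simp: fin_def split: if_splits)
qed

end

lemma card_branch: "u \<in> branch \<Longrightarrow> card (cnbs u) = 3"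
  by (simp add: branch_def)

lemma inj_on_three:
  assumes "distinct [y1, y2, y3]" "fan p q1 q2 q3"
  obtains g where "inj_on g {y1, y2, y3}" "g y1 = q1" "g y2 = q2" "g y3 = q3"
proof
  let ?g = "(\<lambda>_. q3)(y1 := q1, y2 := q2)"
  show "inj_on ?g {y1, y2, y3}" "?g y1 = q1" "?g y2 = q2" "?g y3 = q3"
    using assms by (auto simp: fan_def inj_on_def)
qed

text \<open>The three threads are reversed so that they end at u. Their far ends differ from u by
  \<open>fin_neq\<close> and keep their colors; some of these ends may coincide, as
  \<open>tripod\<close> copes with arbitrary arcs. The interior vertex on the first thread supplies
  an edge to be removed.\<close>

lemma no_tripod:
  assumes u: "u \<in> branch" and y: "cnbs u = {y1, y2, y3}" "distinct [y1, y2, y3]"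
    and k: "klen u y1 > 0"
  shows "\<not> tripod (klen u y1) (klen u y2) (klen u y3)"
proof
  assume tri: "tripod (klen u y1) (klen u y2) (klen u y3)"
  let ?L = "(\<lambda>y. rev (th u y)) ` {y1, y2, y3}"
  have yi: "y \<in> cnbs u" if "y \<in> {y1, y2, y3}" for y using that y by simp
  note R = th_rev[OF u yi] th_length[OF u yi] fin_neq[OF u yi]
  have Z: "{u} \<subseteq> branch" using u by simp
  have L: "thread l \<and> last l \<in> {u}" if l: "l \<in> ?L" for l
  proof -
    obtain y where "l = rev (th u y)" "y \<in> {y1, y2, y3}" using l by blast
    then show ?thesis using R(3,5)[of y] by simp
  qed
  have disj: "l' \<noteq> rev l" if l: "l \<in> ?L" "l' \<in> ?L" "l \<noteq> l'" for l l'
  proof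
    assume "l' = rev l"
    then have "hd l' = last l" by (simp only: hd_rev)
    moreover have "last l = u" using L[OF l(1)] by simp
    moreover have "hd l' \<noteq> u"
    proof -
      obtain y where "l' = rev (th u y)" "y \<in> {y1, y2, y3}" using l(2) by blast
      then show ?thesis using R(1,8)[of y] by simp
    qed
    ultimately show False by simp
  qed
  have cover: "\<exists>l \<in> ?L. last l = z \<and> l ! (length l - 2) = n \<or> hd l = z \<and> l ! 1 = n" if "z \<in> {u}" "n \<in> cnbs z" for z n
    using that y R(3,4,6) by (intro bexI[of _ "rev (th u n)"]) auto
  have long: "\<exists>l \<in> ?L. 3 \<le> length l"
    using k R(6)[of y1] by (intro bexI[of _ "rev (th u y1)"]) auto
  from configuration[OF Z L disj cover long] obtain B X where
    B: "\<And>l. l \<in> ?L \<Longrightarrow> hd l \<notin> {u} \<Longrightarrow> padj (B (hd l)) (X (hd l) (l ! 1))" and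
    X: "\<And>p g. (\<And>l. l \<in> ?L \<Longrightarrow> reach (length l - 2)
        (if hd l \<in> {u} then p (hd l) else B (hd l)) (if hd l \<in> {u} then g (hd l) (l ! 1) else X (hd l) (l ! 1))
        (g (last l) (l ! (length l - 2))) (p (last l))) \<Longrightarrow>
      (\<And>z. z \<in> {u} \<Longrightarrow> inj_on (g z) (cnbs z)) \<Longrightarrow> False"
    by blast
  have arc: "padj (B (fin u y)) (X (fin u y) (pen u y))" if "y \<in> {y1, y2, y3}" for y
    using B[of "rev (th u y)"] R[OF that] that by auto
  obtain p q1 q2 q3 where q: "fan p q1 q2 q3"
    "reach (klen u y1) (B (fin u y1)) (X (fin u y1) (pen u y1)) q1 p"
    "reach (klen u y2) (B (fin u y2)) (X (fin u y2) (pen u y2)) q2 p"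
    "reach (klen u y3) (B (fin u y3)) (X (fin u y3) (pen u y3)) q3 p"
    using tri arc[of y1] arc[of y2] arc[of y3] unfolding tripod_def by blast
  obtain g where g: "inj_on g {y1, y2, y3}" "g y1 = q1" "g y2 = q2" "g y3 = q3"
    using inj_on_three[OF y(2) q(1)] by blast
  show False
  proof (rule X[of "\<lambda>_. p" "\<lambda>_. g"])
    fix l assume "l \<in> ?L"
    then obtain y where l: "l = rev (th u y)" "y \<in> {y1, y2, y3}" by blast
    have "reach (klen u y) (B (fin u y)) (X (fin u y) (pen u y)) (g y) p"
      using l(2) q g by auto
    then show "reach (length l - 2) (if hd l \<in> {u} then p else B (hd l)) (if hd l \<in> {u} then g (l ! 1) else X (hd l) (l ! 1))
        (g (l ! (length l - 2))) p"
      using R[OF l(2)] l(1) by simp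
  qed (use g y in simp)
qed

text \<open>The conditions on \<open>fin\<close> keep the far ends of the four outer threads away
  from u and v, so that they keep their colors. Further threads between u and v are the subject of
  \<open>no_twin\<close> and \<open>no_theta\<close>.\<close>

lemma no_dumbbell:
  assumes u: "u \<in> branch" and y: "cnbs u = {y1, y2, y3}" "distinct [y1, y2, y3]"
    and v: "fin u y1 = v" "pen u y1 = z1" "cnbs v = {z1, z2, z3}" "distinct [z1, z2, z3]"
    and sep: "fin u y2 \<noteq> v" "fin u y3 \<noteq> v" "fin v z2 \<noteq> u" "fin v z3 \<noteq> u"
    and k: "klen u y2 > 0"
  shows "\<not> dumbbell (klen u y1) (klen u y2) (klen u y3) (klen v z2) (klen v z3)"
proof
  assume db: "dumbbell (klen u y1) (klen u y2) (klen u y3) (klen v z2) (klen v z3)"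
  let ?L = "{th u y1, rev (th u y2), rev (th u y3), rev (th v z2), rev (th v z3)}"
  have yi: "y1 \<in> cnbs u" "y2 \<in> cnbs u" "y3 \<in> cnbs u" "z2 \<in> cnbs v" "z3 \<in> cnbs v" using y v by auto
  have vb: "v \<in> branch" using fin_branch[OF u yi(1)] v(1) by simp
  note R2 = th_rev[OF u yi(2)] th_length(1)[OF u yi(2)] fin_neq[OF u yi(2)]
  note R3 = th_rev[OF u yi(3)] th_length(1)[OF u yi(3)] fin_neq[OF u yi(3)]
  note S2 = th_rev[OF vb yi(4)] th_length(1)[OF vb yi(4)] fin_neq[OF vb yi(4)]
  note S3 = th_rev[OF vb yi(5)] th_length(1)[OF vb yi(5)] fin_neq[OF vb yi(5)]
  note R1 = th[OF u yi(1)] th_length(1)[OF u yi(1)] th_ends[OF u yi(1), unfolded v] fin_neq[OF u yi(1), unfolded v]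
  have Z: "{u, v} \<subseteq> branch" using u vb by simp
  have L: "thread l \<and> last l \<in> {u, v}" if "l \<in> ?L" for l using that R1 R2 R3 S2 S3 by auto
  have hdZ: "l = th u y1" if "l \<in> ?L" "hd l \<in> {u, v}" for l
    using that R1 R2 R3 S2 S3 sep by auto
  have ends: "hd (rev l) = last l \<and> last (rev l) = hd l" for l :: "'a list"
    by (simp add: hd_rev last_rev)
  have disj: "l' \<noteq> rev l" if "l \<in> ?L" "l' \<in> ?L" "l \<noteq> l'" for l l'
  proof
    assume "l' = rev l"
    then have "hd l \<in> {u, v}" "hd l' \<in> {u, v}" using L[OF that(1)] L[OF that(2)] ends[of l] by auto
    then show False using hdZ that by metis
  qed
  have cover: "\<exists>l \<in> ?L. last l = z \<and> l ! (length l - 2) = n \<or> hd l = z \<and> l ! 1 = n" if "z \<in> {u, v}" "n \<in> cnbs z" for z n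
  proof -
    from that consider "z = u" "n = y1" | "z = u" "n = y2" | "z = u" "n = y3" | "z = v" "n = z1" | "z = v" "n = z2" | "z = v" "n = z3"
      using y v by auto
    then show ?thesis
    proof cases
      case 1
      then show ?thesis using R1 by (intro bexI[of _ "th u y1"]) simp_all
    next
      case 2
      then show ?thesis using R2 by (intro bexI[of _ "rev (th u y2)"]) simp_all
    next
      case 3
      then show ?thesis using R3 by (intro bexI[of _ "rev (th u y3)"]) simp_all
    next
      case 4
      then show ?thesis using R1 by (intro bexI[of _ "th u y1"]) simp_all
    next
      case 5
      then show ?thesis using S2 by (intro bexI[of _ "rev (th v z2)"]) simp_all
    next
      case 6
      then show ?thesis using S3 by (intro bexI[of _ "rev (th v z3)"]) simp_all
    qed
  qed
  have long: "\<exists>l \<in> ?L. 3 \<le> length l"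
    using k R2(6) by (intro bexI[of _ "rev (th u y2)"]) auto
  from configuration[OF Z L disj cover long] obtain B X where
    B: "\<And>l. l \<in> ?L \<Longrightarrow> hd l \<notin> {u, v} \<Longrightarrow> padj (B (hd l)) (X (hd l) (l ! 1))" and
    X: "\<And>p g. (\<And>l. l \<in> ?L \<Longrightarrow> reach (length l - 2)
        (if hd l \<in> {u, v} then p (hd l) else B (hd l)) (if hd l \<in> {u, v} then g (hd l) (l ! 1) else X (hd l) (l ! 1))
        (g (last l) (l ! (length l - 2))) (p (last l))) \<Longrightarrow>
      (\<And>z. z \<in> {u, v} \<Longrightarrow> inj_on (g z) (cnbs z)) \<Longrightarrow> False"
    by blast
  have arcs: "padj (B (fin u y2)) (X (fin u y2) (pen u y2))" "padj (B (fin u y3)) (X (fin u y3) (pen u y3))"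
    "padj (B (fin v z2)) (X (fin v z2) (pen v z2))" "padj (B (fin v z3)) (X (fin v z3) (pen v z3))"
    using B[of "rev (th u y2)"] B[of "rev (th u y3)"] B[of "rev (th v z2)"] B[of "rev (th v z3)"] R2 R3 S2 S3 sep by auto
  from db[unfolded dumbbell_def, rule_format, OF arcs]
  obtain p q1 q2 q3 p' q1' q2' q3' where q: "fan p q1 q2 q3" "fan p' q1' q2' q3'" "reach (klen u y1) p q3 q3' p'"
    "reach (klen u y2) (B (fin u y2)) (X (fin u y2) (pen u y2)) q1 p"
    "reach (klen u y3) (B (fin u y3)) (X (fin u y3) (pen u y3)) q2 p"
    "reach (klen v z2) (B (fin v z2)) (X (fin v z2) (pen v z2)) q1' p'"
    "reach (klen v z3) (B (fin v z3)) (X (fin v z3) (pen v z3)) q2' p'"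
    by blast
  have "distinct [y2, y3, y1]" "distinct [z2, z3, z1]" using y(2) v(4) by auto
  then obtain g h where g: "inj_on g {y2, y3, y1}" "g y2 = q1" "g y3 = q2" "g y1 = q3"
    and h: "inj_on h {z2, z3, z1}" "h z2 = q1'" "h z3 = q2'" "h z1 = q3'"
    using inj_on_three q(1,2) by metis
  have uv: "u \<noteq> v" using R1 by simp
  show False
  proof (rule X[of "\<lambda>z. if z = u then p else p'" "\<lambda>z. if z = u then g else h"])
    fix l assume "l \<in> ?L"
    then show "reach (length l - 2) (if hd l \<in> {u, v} then if hd l = u then p else p' else B (hd l))
        (if hd l \<in> {u, v} then (if hd l = u then g else h) (l ! 1) else X (hd l) (l ! 1))
        ((if last l = u then g else h) (l ! (length l - 2))) (if last l = u then p else p')"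
      using R1 R2 R3 S2 S3 sep uv q g h by (elim insertE) auto
  next
    fix z assume "z \<in> {u, v}"
    then show "inj_on (if z = u then g else h) (cnbs z)"
      using g(1) h(1) y(1) v(3) uv by (auto simp: insert_commute)
  qed
qed

lemma no_twin:
  assumes u: "u \<in> branch" and y: "cnbs u = {y1, y2, y3}" "distinct [y1, y2, y3]"
    and v: "fin u y1 = v" "pen u y1 = z1" "fin u y2 = v" "pen u y2 = z2" "cnbs v = {z1, z2, z3}" "distinct [z1, z2, z3]"
    and sep: "fin u y3 \<noteq> v" "fin v z3 \<noteq> u"
    and k: "klen u y3 > 0"
  shows "\<not> twin (klen u y1) (klen u y2) (klen u y3) (klen v z3)"
proof
  assume tw: "twin (klen u y1) (klen u y2) (klen u y3) (klen v z3)"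
  let ?L = "{rev (th u y1), rev (th u y2), rev (th u y3), rev (th v z3)}"
  have yi: "y1 \<in> cnbs u" "y2 \<in> cnbs u" "y3 \<in> cnbs u" "z3 \<in> cnbs v" using y v by auto
  have vb: "v \<in> branch" using fin_branch[OF u yi(1)] v(1) by simp
  note R1 = th_rev[OF u yi(1), unfolded v] th_length(1)[OF u yi(1)] fin_neq[OF u yi(1), unfolded v]
  note R2 = th_rev[OF u yi(2), unfolded v] th_length(1)[OF u yi(2)]
  note R3 = th_rev[OF u yi(3)] th_length(1)[OF u yi(3)] fin_neq[OF u yi(3)]
  note S3 = th_rev[OF vb yi(4)] th_length(1)[OF vb yi(4)] fin_neq[OF vb yi(4)]
  have Z: "{u, v} \<subseteq> branch" using u vb by simp
  have uv: "u \<noteq> v" using R1 by simp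
  have L: "thread l \<and> last l \<in> {u, v}" if "l \<in> ?L" for l using that R1 R2 R3 S3 by auto
  have hdZ: "hd l = v \<and> last l = u" if "l \<in> ?L" "hd l \<in> {u, v}" for l
    using that R1 R2 R3 S3 sep by auto
  have ends: "hd (rev l) = last l \<and> last (rev l) = hd l" for l :: "'a list"
    by (simp add: hd_rev last_rev)
  have disj: "l' \<noteq> rev l" if "l \<in> ?L" "l' \<in> ?L" "l \<noteq> l'" for l l'
  proof
    assume l': "l' = rev l"
    then have "hd l \<in> {u, v}" "hd l' \<in> {u, v}" using L[OF that(1)] L[OF that(2)] ends[of l] by auto
    then show False using hdZ[OF that(1)] hdZ[OF that(2)] ends[of l] l' uv by auto
  qed
  have cover: "\<exists>l \<in> ?L. last l = z \<and> l ! (length l - 2) = n \<or> hd l = z \<and> l ! 1 = n" if "z \<in> {u, v}" "n \<in> cnbs z" for z n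
  proof -
    from that consider "z = u" "n = y1" | "z = u" "n = y2" | "z = u" "n = y3" | "z = v" "n = z1" | "z = v" "n = z2" | "z = v" "n = z3"
      using y v by auto
    then show ?thesis
    proof cases
      case 1
      then show ?thesis using R1 by (intro bexI[of _ "rev (th u y1)"]) simp_all
    next
      case 2
      then show ?thesis using R2 by (intro bexI[of _ "rev (th u y2)"]) simp_all
    next
      case 3
      then show ?thesis using R3 by (intro bexI[of _ "rev (th u y3)"]) simp_all
    next
      case 4
      then show ?thesis using R1 by (intro bexI[of _ "rev (th u y1)"]) simp_all
    next
      case 5
      then show ?thesis using R2 by (intro bexI[of _ "rev (th u y2)"]) simp_all
    next
      case 6
      then show ?thesis using S3 by (intro bexI[of _ "rev (th v z3)"]) simp_all
    qed
  qed
  have long: "\<exists>l \<in> ?L. 3 \<le> length l"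
    using k R3(6) by (intro bexI[of _ "rev (th u y3)"]) auto
  from configuration[OF Z L disj cover long] obtain B X where
    B: "\<And>l. l \<in> ?L \<Longrightarrow> hd l \<notin> {u, v} \<Longrightarrow> padj (B (hd l)) (X (hd l) (l ! 1))" and
    X: "\<And>p g. (\<And>l. l \<in> ?L \<Longrightarrow> reach (length l - 2)
        (if hd l \<in> {u, v} then p (hd l) else B (hd l)) (if hd l \<in> {u, v} then g (hd l) (l ! 1) else X (hd l) (l ! 1))
        (g (last l) (l ! (length l - 2))) (p (last l))) \<Longrightarrow>
      (\<And>z. z \<in> {u, v} \<Longrightarrow> inj_on (g z) (cnbs z)) \<Longrightarrow> False"
    by blast
  have arcs: "padj (B (fin u y3)) (X (fin u y3) (pen u y3))" "padj (B (fin v z3)) (X (fin v z3) (pen v z3))"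
    using B[of "rev (th u y3)"] B[of "rev (th v z3)"] R3 S3 sep by auto
  from tw[unfolded twin_def, rule_format, OF arcs]
  obtain p q1 q2 q3 p' q1' q2' q3' where q: "fan p q1 q2 q3" "fan p' q1' q2' q3'"
    "reach (klen u y1) p' q1' q1 p" "reach (klen u y2) p' q2' q2 p"
    "reach (klen u y3) (B (fin u y3)) (X (fin u y3) (pen u y3)) q3 p"
    "reach (klen v z3) (B (fin v z3)) (X (fin v z3) (pen v z3)) q3' p'"
    by blast
  obtain g h where g: "inj_on g {y1, y2, y3}" "g y1 = q1" "g y2 = q2" "g y3 = q3"
    and h: "inj_on h {z1, z2, z3}" "h z1 = q1'" "h z2 = q2'" "h z3 = q3'"
    using inj_on_three y(2) v(6) q(1,2) by metis
  show False
  proof (rule X[of "\<lambda>z. if z = u then p else p'" "\<lambda>z. if z = u then g else h"])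
    fix l assume "l \<in> ?L"
    then show "reach (length l - 2) (if hd l \<in> {u, v} then if hd l = u then p else p' else B (hd l))
        (if hd l \<in> {u, v} then (if hd l = u then g else h) (l ! 1) else X (hd l) (l ! 1))
        ((if last l = u then g else h) (l ! (length l - 2))) (if last l = u then p else p')"
      using R1 R2 R3 S3 sep uv q g h by (elim insertE) auto
  next
    fix z assume "z \<in> {u, v}"
    then show "inj_on (if z = u then g else h) (cnbs z)"
      using g(1) h(1) y(1) v(5) uv by auto
  qed
qed

lemma no_theta:
  assumes u: "u \<in> branch" and y: "cnbs u = {y1, y2, y3}" "distinct [y1, y2, y3]"
    and v: "fin u y1 = v" "pen u y1 = z1" "fin u y2 = v" "pen u y2 = z2" "fin u y3 = v" "pen u y3 = z3"
      "cnbs v = {z1, z2, z3}" "distinct [z1, z2, z3]"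
    and k: "klen u y3 > 0"
  shows "\<not> theta (klen u y1) (klen u y2) (klen u y3)"
proof
  assume tw: "theta (klen u y1) (klen u y2) (klen u y3)"
  let ?L = "{rev (th u y1), rev (th u y2), rev (th u y3)}"
  have yi: "y1 \<in> cnbs u" "y2 \<in> cnbs u" "y3 \<in> cnbs u" using y by auto
  have vb: "v \<in> branch" using fin_branch[OF u yi(1)] v(1) by simp
  note R1 = th_rev[OF u yi(1), unfolded v] th_length(1)[OF u yi(1)] fin_neq[OF u yi(1), unfolded v]
  note R2 = th_rev[OF u yi(2), unfolded v] th_length(1)[OF u yi(2)]
  note R3 = th_rev[OF u yi(3), unfolded v] th_length(1)[OF u yi(3)]
  have Z: "{u, v} \<subseteq> branch" using u vb by simp
  have uv: "u \<noteq> v" using R1 by simp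
  have L: "thread l \<and> last l \<in> {u, v}" if "l \<in> ?L" for l using that R1 R2 R3 by auto
  have ends: "hd (rev l) = last l \<and> last (rev l) = hd l" for l :: "'a list"
    by (simp add: hd_rev last_rev)
  have hdL: "hd l = v \<and> last l = u" if "l \<in> ?L" for l
    using that R1 R2 R3 by auto
  have disj: "l' \<noteq> rev l" if "l \<in> ?L" "l' \<in> ?L" "l \<noteq> l'" for l l'
    using hdL[OF that(1)] hdL[OF that(2)] ends[of l] uv by auto
  have cover: "\<exists>l \<in> ?L. last l = z \<and> l ! (length l - 2) = n \<or> hd l = z \<and> l ! 1 = n" if "z \<in> {u, v}" "n \<in> cnbs z" for z n
  proof -
    from that consider "z = u" "n = y1" | "z = u" "n = y2" | "z = u" "n = y3" | "z = v" "n = z1" | "z = v" "n = z2" | "z = v" "n = z3"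
      using y v by auto
    then show ?thesis
    proof cases
      case 1
      then show ?thesis using R1 by (intro bexI[of _ "rev (th u y1)"]) simp_all
    next
      case 2
      then show ?thesis using R2 by (intro bexI[of _ "rev (th u y2)"]) simp_all
    next
      case 3
      then show ?thesis using R3 by (intro bexI[of _ "rev (th u y3)"]) simp_all
    next
      case 4
      then show ?thesis using R1 by (intro bexI[of _ "rev (th u y1)"]) simp_all
    next
      case 5
      then show ?thesis using R2 by (intro bexI[of _ "rev (th u y2)"]) simp_all
    next
      case 6
      then show ?thesis using R3 by (intro bexI[of _ "rev (th u y3)"]) simp_all
    qed
  qed
  have long: "\<exists>l \<in> ?L. 3 \<le> length l"
    using k R3(6) by (intro bexI[of _ "rev (th u y3)"]) auto
  from configuration[OF Z L disj cover long] obtain B X where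
    "\<And>l. l \<in> ?L \<Longrightarrow> hd l \<notin> {u, v} \<Longrightarrow> padj (B (hd l)) (X (hd l) (l ! 1))" and
    X: "\<And>p g. (\<And>l. l \<in> ?L \<Longrightarrow> reach (length l - 2)
        (if hd l \<in> {u, v} then p (hd l) else B (hd l)) (if hd l \<in> {u, v} then g (hd l) (l ! 1) else X (hd l) (l ! 1))
        (g (last l) (l ! (length l - 2))) (p (last l))) \<Longrightarrow>
      (\<And>z. z \<in> {u, v} \<Longrightarrow> inj_on (g z) (cnbs z)) \<Longrightarrow> False"
    by blast
  from tw[unfolded theta_def]
  obtain p q1 q2 q3 p' q1' q2' q3' where q: "fan p q1 q2 q3" "fan p' q1' q2' q3'"
    "reach (klen u y1) p' q1' q1 p" "reach (klen u y2) p' q2' q2 p" "reach (klen u y3) p' q3' q3 p"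
    by blast
  obtain g h where g: "inj_on g {y1, y2, y3}" "g y1 = q1" "g y2 = q2" "g y3 = q3"
    and h: "inj_on h {z1, z2, z3}" "h z1 = q1'" "h z2 = q2'" "h z3 = q3'"
    using inj_on_three y(2) v(8) q(1,2) by metis
  show False
  proof (rule X[of "\<lambda>z. if z = u then p else p'" "\<lambda>z. if z = u then g else h"])
    fix l assume "l \<in> ?L"
    then show "reach (length l - 2) (if hd l \<in> {u, v} then if hd l = u then p else p' else B (hd l))
        (if hd l \<in> {u, v} then (if hd l = u then g else h) (l ! 1) else X (hd l) (l ! 1))
        ((if last l = u then g else h) (l ! (length l - 2))) (if last l = u then p else p')"
      using R1 R2 R3 uv q g h by (elim insertE) auto
  next
    fix z assume "z \<in> {u, v}"
    then show "inj_on (if z = u then g else h) (cnbs z)"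
      using g(1) h(1) y(1) v(7) uv by auto
  qed
qed

end

section \<open>Discharging\<close>

lemma twins:
  assumes "k = 0 \<and> a = 6 \<and> b = 7 \<or> k = 0 \<and> a = 7 \<and> 6 \<le> b \<or> k = 1 \<and> a = 5 \<and> b = 7 \<or> k = 1 \<and> a = 7 \<and> b = 5 \<or>
    k = 1 \<and> a = 6 \<and> b = 6 \<or> k = 2 \<and> a = 4 \<and> b = 7 \<or> k = 2 \<and> a = 7 \<and> b = 4 \<or> k = 3 \<and> a = 3 \<and> b = 7 \<or> k = 3 \<and> a = 7 \<and> b = 3"
  shows "twin k a b d"
  using assms twins_meet[THEN twinI, THEN twin_mono[OF _ _ le0]] by (elim disjE conjE) simp_all

text \<open>These are the triples of sum at least 13 and parts at most 7 that dominate none of the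
  reducible triples 1 6 7, 2 5 6 and 3 4 5. Their sum is 14 for 0 7 7 and 13 otherwise.\<close>

lemma bad_lengths:
  fixes k1 k2 k3 :: nat
  assumes "k1 \<le> k2" "k2 \<le> k3" "k3 \<le> 7" "13 \<le> k1 + k2 + k3" "\<not> tripod k1 k2 k3"
  shows "(k1, k2, k3) \<in> {(0, 6, 7), (0, 7, 7), (1, 5, 7), (1, 6, 6), (2, 4, 7), (3, 3, 7)}"
proof -
  have "\<not> (1 \<le> k1 \<and> 6 \<le> k2 \<and> 7 \<le> k3)" "\<not> (2 \<le> k1 \<and> 5 \<le> k2 \<and> 6 \<le> k3)" "\<not> (3 \<le> k1 \<and> 4 \<le> k2 \<and> 5 \<le> k3)"
    using assms(5) tripods[THEN tripod_mono] by blast+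
  then have "k1 = 0 \<and> k2 = 6 \<and> k3 = 7 \<or> k1 = 0 \<and> k2 = 7 \<and> k3 = 7 \<or> k1 = 1 \<and> k2 = 5 \<and> k3 = 7 \<or>
      k1 = 1 \<and> k2 = 6 \<and> k3 = 6 \<or> k1 = 2 \<and> k2 = 4 \<and> k3 = 7 \<or> k1 = 3 \<and> k2 = 3 \<and> k3 = 7"
    using assms(1-4) by presburger
  then show ?thesis by auto
qed

text \<open>The k are the lengths at a branch vertex, the r the charges arriving through its
  threads; the truncated difference on the right is its own excess, which it passes on. The bound 12
  is attained by lengths 3, 3, 4 with one unit through each of the first two threads, and by 3, 3, 3
  with one unit through each.\<close>

lemma discharge_arith:
  fixes k1 k2 k3 r1 r2 r3 :: nat
  assumes "r1 > 0 \<Longrightarrow> k2 + k3 \<le> 7 \<and> k1 \<le> 3 \<and> r1 \<le> 2 \<and> (k1 > 0 \<longrightarrow> r1 \<le> 1)"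
    and "r2 > 0 \<Longrightarrow> k1 + k3 \<le> 7 \<and> k2 \<le> 3 \<and> r2 \<le> 2 \<and> (k2 > 0 \<longrightarrow> r2 \<le> 1)"
    and "r3 > 0 \<Longrightarrow> k1 + k2 \<le> 7 \<and> k3 \<le> 3 \<and> r3 \<le> 2 \<and> (k3 > 0 \<longrightarrow> r3 \<le> 1)"
  shows "k1 + k2 + k3 + (r1 + r2 + r3) \<le> 12 + (k1 + k2 + k3 - 12)"
proof -
  have r: "r1 = 0 \<or> k2 + k3 \<le> 7 \<and> k1 \<le> 3 \<and> r1 + k1 \<le> 4 \<and> r1 \<le> 2 \<and> (k1 = 0 \<or> r1 = 1)"
    "r2 = 0 \<or> k1 + k3 \<le> 7 \<and> k2 \<le> 3 \<and> r2 + k2 \<le> 4 \<and> r2 \<le> 2 \<and> (k2 = 0 \<or> r2 = 1)"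
    "r3 = 0 \<or> k1 + k2 \<le> 7 \<and> k3 \<le> 3 \<and> r3 + k3 \<le> 4 \<and> r3 \<le> 2 \<and> (k3 = 0 \<or> r3 = 1)"
    using assms by linarith+
  show ?thesis
  proof (cases "r1 + r2 + r3 = 0")
    case False
    then have "k1 + k2 + k3 + (r1 + r2 + r3) \<le> 12" using r by (elim disjE conjE) linarith+
    then show ?thesis by linarith
  qed simp
qed

context minimal_uncolorable
begin

lemma tripod_lengths:
  assumes u: "u \<in> branch" and y: "cnbs u = {y1, y2, y3}" "distinct [y1, y2, y3]"
    and k: "klen u y1 \<le> klen u y2" "klen u y2 \<le> klen u y3" "13 \<le> klen u y1 + klen u y2 + klen u y3"
  shows "(klen u y1, klen u y2, klen u y3) \<in> {(0, 6, 7), (0, 7, 7), (1, 5, 7), (1, 6, 6), (2, 4, 7), (3, 3, 7)}"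
proof (rule bad_lengths[OF k(1,2) _ k(3)])
  show "klen u y3 \<le> 7" using th_length(2)[OF u, of y3] y by simp
  have "cnbs u = {y3, y1, y2}" "distinct [y3, y1, y2]" using y by auto
  from no_tripod[OF u this] k have "\<not> tripod (klen u y3) (klen u y1) (klen u y2)" by simp
  then show "\<not> tripod (klen u y1) (klen u y2) (klen u y3)"
    unfolding tripod_def by (meson fan_permute)
qed

lemma fin_determined:
  assumes "u \<in> branch" "y \<in> cnbs u" "y' \<in> cnbs u" "fin u y = fin u y'" "pen u y = pen u y'"
  shows "y = y'"
  using fin_fin(2)[OF assms(1,2)] fin_fin(2)[OF assms(1,3)] assms(4,5) by metis

lemma three_of:
  assumes "card A = 3" "z1 \<in> A"
  obtains z2 z3 where "A = {z1, z2, z3}" "distinct [z1, z2, z3]"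
proof -
  have "card (A - {z1}) = 2" using assms by simp
  then obtain z2 z3 where "A - {z1} = {z2, z3}" "z2 \<noteq> z3" by (auto simp: card_2_iff)
  then show ?thesis using that[of z2 z3] assms(2) by auto
qed

text \<open>If the third thread from u ends there as well, the three form a theta, otherwise the
  first two form a twin; both are reducible.\<close>

lemma partner_two_back:
  assumes u: "u \<in> branch" and y: "cnbs u = {y1, y2, y3}" "distinct [y1, y2, y3]"
    and tw: "\<And>d. twin (klen u y1) (klen u y2) (klen u y3) d" and th: "theta (klen u y1) (klen u y2) (klen u y3)"
    and k: "klen u y3 > 0"
  shows "fin u y2 \<noteq> fin u y1"
proof
  assume eq: "fin u y2 = fin u y1"
  let ?v = "fin u y1" and ?z1 = "pen u y1" and ?z2 = "pen u y2"
  have yi: "y1 \<in> cnbs u" "y2 \<in> cnbs u" "y3 \<in> cnbs u" using y by auto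
  have v: "?v \<in> branch" using fin_branch[OF u yi(1)] .
  have z: "?z1 \<in> cnbs ?v" "?z2 \<in> cnbs ?v" using pen_cnbs[OF u yi(1)] pen_cnbs[OF u yi(2)] eq by auto
  have ne: "?z1 \<noteq> ?z2" using fin_determined[OF u yi(1,2)] eq y(2) by auto
  obtain a b where ab: "cnbs ?v = {?z1, a, b}" "distinct [?z1, a, b]"
    using three_of[OF card_branch[OF v] z(1)] by blast
  have "\<exists>z3. cnbs ?v = {?z1, ?z2, z3} \<and> distinct [?z1, ?z2, z3]"
  proof (cases "?z2 = a")
    case True
    then show ?thesis using ab by blast
  next
    case False
    then have "?z2 = b" using z(2) ne ab(1) by auto
    then show ?thesis using ab by (intro exI[of _ a]) auto
  qed
  then obtain z3 where z3: "cnbs ?v = {?z1, ?z2, z3}" "distinct [?z1, ?z2, z3]" by blast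
  have z3v: "z3 \<in> cnbs ?v" using z3 by simp
  show False
  proof (cases "fin u y3 = ?v")
    case True
    have "pen u y3 \<in> cnbs ?v" using pen_cnbs[OF u yi(3)] True by simp
    moreover have "pen u y3 \<noteq> ?z1" "pen u y3 \<noteq> ?z2"
      using fin_determined[OF u yi(1,3)] fin_determined[OF u yi(2,3)] True eq y(2) by auto
    ultimately have "pen u y3 = z3" using z3 by auto
    then show False using no_theta[OF u y refl refl eq refl True _ z3 k] th by simp
  next
    case False
    have "fin ?v z3 \<noteq> u"
    proof
      assume fu: "fin ?v z3 = u"
      have "pen ?v z3 \<in> cnbs u" "fin u (pen ?v z3) = ?v" "pen u (pen ?v z3) = z3"
        using pen_cnbs[OF v z3v] fin_fin[OF v z3v] fu by auto
      then show False using y(1) z3(2) False by auto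
    qed
    then show False using no_twin[OF u y refl refl eq refl z3 False _ k] tw by simp
  qed
qed

text \<open>With a sum of 8 or more, u and v could be recolored together as a dumbbell. First, the
  bad lengths at u rule out a second thread between u and v, by \<open>partner_two_back\<close> for
  either of the longer threads.\<close>

lemma partner_bound:
  assumes u: "u \<in> branch" and y: "cnbs u = {y1, y2, y3}" "distinct [y1, y2, y3]"
    and k: "klen u y1 \<le> klen u y2" "klen u y2 \<le> klen u y3" "13 \<le> klen u y1 + klen u y2 + klen u y3"
    and v: "fin u y1 = v" "pen u y1 = z1" "cnbs v = {z1, z2, z3}" "distinct [z1, z2, z3]"
  shows "klen v z2 + klen v z3 \<le> 7"
proof (rule ccontr)
  assume gt: "\<not> ?thesis"
  note bad = tripod_lengths[OF u y k, unfolded insert_iff empty_iff prod.inject]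
  have yi: "y1 \<in> cnbs u" "y2 \<in> cnbs u" "y3 \<in> cnbs u" using y by auto
  have vb: "v \<in> branch" using fin_branch[OF u yi(1)] v(1) by simp
  have sep2: "fin u y2 \<noteq> v"
  proof -
    have tw: "twin (klen u y1) (klen u y2) (klen u y3) d" for d
      using bad by (intro twins) (elim disjE conjE; simp)
    have th: "theta (klen u y1) (klen u y2) (klen u y3)"
      using bad thetas by (elim disjE conjE) simp_all
    have "klen u y3 > 0" using bad by (elim disjE conjE) simp_all
    then show ?thesis using partner_two_back[OF u y tw th] v(1) by simp
  qed
  have y': "cnbs u = {y1, y3, y2}" "distinct [y1, y3, y2]" using y by auto
  have theta': "theta a c b" if "theta a b c" for a b c
    using that fan_permute(2) unfolding theta_def by blast
  have sep3: "fin u y3 \<noteq> v"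
  proof -
    have tw: "twin (klen u y1) (klen u y3) (klen u y2) d" for d
      using bad by (intro twins) (elim disjE conjE; simp)
    have th: "theta (klen u y1) (klen u y3) (klen u y2)"
      using bad thetas[THEN theta'] by (elim disjE conjE) simp_all
    have "klen u y2 > 0" using bad by (elim disjE conjE) simp_all
    then show ?thesis using partner_two_back[OF u y' tw th] v(1) by simp
  qed
  have zi: "z2 \<in> cnbs v" "z3 \<in> cnbs v" using v(3) by auto
  have away: "fin v z \<noteq> u" if "z \<in> cnbs v" "z \<noteq> z1" for z
  proof
    assume fu: "fin v z = u"
    then have "pen v z \<in> cnbs u" "fin u (pen v z) = v" "pen u (pen v z) = z"
      using pen_cnbs[OF vb that(1)] fin_fin[OF vb that(1)] by auto
    then show False using y(1) sep2 sep3 v(2) that(2) by auto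
  qed
  have kz: "klen v z2 \<le> 7" "klen v z3 \<le> 7" using th_length(2)[OF vb] zi by auto
  have ub: "klen u y1 = 0 \<and> 6 \<le> klen u y2 \<and> 7 \<le> klen u y3 \<or> klen u y1 = 1 \<and> 5 \<le> klen u y2 \<and> 7 \<le> klen u y3 \<or>
      klen u y1 = 1 \<and> 6 \<le> klen u y2 \<and> 6 \<le> klen u y3 \<or> klen u y1 = 2 \<and> 4 \<le> klen u y2 \<and> 7 \<le> klen u y3 \<or>
      klen u y1 = 3 \<and> 3 \<le> klen u y2 \<and> 7 \<le> klen u y3"
    using bad by (elim disjE conjE) simp_all
  have k2: "klen u y2 > 0" using ub by auto
  have key: False if z: "cnbs v = {z1, w2, w3}" "distinct [z1, w2, w3]" "klen v w2 \<le> klen v w3" "8 \<le> klen v w2 + klen v w3" "klen v w3 \<le> 7" for w2 w3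
  proof -
    have "1 \<le> klen v w2 \<and> 6 \<le> klen v w3 \<or> 2 \<le> klen v w2 \<and> 5 \<le> klen v w3 \<or> 3 \<le> klen v w2 \<and> 4 \<le> klen v w3"
      using z(3-5) by presburger
    then have "dumbbell (klen u y1) (klen u y2) (klen u y3) (klen v w2) (klen v w3)" by (rule dumbbells[OF ub])
    moreover have "fin v w2 \<noteq> u" "fin v w3 \<noteq> u" using away z(1,2) by auto
    ultimately show False using no_dumbbell[OF u y v(1,2) z(1,2) sep2 sep3 _ _ k2] by blast
  qed
  have sum: "8 \<le> klen v z2 + klen v z3" using gt by simp
  show False
  proof (cases "klen v z2 \<le> klen v z3")
    case True
    show False by (rule key[OF v(3,4) True sum kz(2)])
  next
    case False
    have "cnbs v = {z1, z3, z2}" "distinct [z1, z3, z2]" using v(3,4) by auto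
    then show False by (rule key) (use False sum kz in simp_all)
  qed
qed

definition load :: "'a \<Rightarrow> nat" where
  "load u = (\<Sum>y \<in> cnbs u. klen u y)"

definition shortest :: "'a \<Rightarrow> 'a" where
  "shortest u = (ARG_MIN (klen u) y. y \<in> cnbs u)"

text \<open>The discharging rule seen from the receiver: a branch vertex sends its load above 12
  along its shortest thread. Truncated subtraction lets the others send nothing, and the choice made
  by \<open>shortest\<close> prevents a tie from sending the excess twice.\<close>

definition received :: "'a \<Rightarrow> 'a \<Rightarrow> nat" where
  "received v z = (if shortest (fin v z) = pen v z then load (fin v z) - 12 else 0)"

lemma finite_cnbs: "finite (cnbs v)"
  using finite_nbs by (simp add: cnbs_def)

lemma shortest:
  assumes "u \<in> branch"
  shows "shortest u \<in> cnbs u" "y \<in> cnbs u \<Longrightarrow> klen u (shortest u) \<le> klen u y"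
proof -
  have "cnbs u \<noteq> {}" using card_branch[OF assms] by auto
  then obtain y0 where "y0 \<in> cnbs u" by blast
  then show "shortest u \<in> cnbs u" "y \<in> cnbs u \<Longrightarrow> klen u (shortest u) \<le> klen u y"
    unfolding shortest_def by (auto intro: arg_min_natI arg_min_nat_le)
qed

lemma received_bound:
  assumes v: "v \<in> branch" and z: "cnbs v = {z1, z2, z3}" "distinct [z1, z2, z3]" and r: "received v z1 > 0"
  shows "klen v z2 + klen v z3 \<le> 7" "klen v z1 \<le> 3" "received v z1 \<le> 2" "klen v z1 > 0 \<Longrightarrow> received v z1 \<le> 1"
proof -
  let ?u = "fin v z1" and ?y1 = "pen v z1"
  have z1: "z1 \<in> cnbs v" using z by simp
  note u = fin_branch[OF v z1] and ff = fin_fin[OF v z1]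
  have r': "shortest ?u = ?y1" "load ?u \<ge> 13" "received v z1 = load ?u - 12"
    using r by (auto simp: received_def split: if_splits)
  have "\<exists>y2 y3. cnbs ?u = {?y1, y2, y3} \<and> distinct [?y1, y2, y3] \<and> klen ?u y2 \<le> klen ?u y3"
  proof -
    obtain a b where ab: "cnbs ?u = {?y1, a, b}" "distinct [?y1, a, b]"
      using three_of[OF card_branch[OF u] pen_cnbs[OF v z1]] by blast
    show ?thesis
    proof (cases "klen ?u a \<le> klen ?u b")
      case False
      then show ?thesis using ab by (intro exI[of _ b] exI[of _ a]) auto
    qed (use ab in blast)
  qed
  then obtain y2 y3 where y: "cnbs ?u = {?y1, y2, y3}" "distinct [?y1, y2, y3]" "klen ?u y2 \<le> klen ?u y3" by blast
  have le: "klen ?u ?y1 \<le> klen ?u y2" using shortest(2)[OF u, of y2] r'(1) y(1) by simp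
  have load: "load ?u = klen ?u ?y1 + klen ?u y2 + klen ?u y3" using y(1,2) by (simp add: load_def)
  have sum: "13 \<le> klen ?u ?y1 + klen ?u y2 + klen ?u y3" using r'(2) load by simp
  show "klen v z2 + klen v z3 \<le> 7"
    by (rule partner_bound[OF u y(1,2) le y(3) sum ff(1,2) z])
  have "(klen ?u ?y1, klen ?u y2, klen ?u y3) \<in> {(0, 6, 7), (0, 7, 7), (1, 5, 7), (1, 6, 6), (2, 4, 7), (3, 3, 7)}"
    by (rule tripod_lengths[OF u y(1,2) le y(3) sum])
  then show "klen v z1 \<le> 3" "received v z1 \<le> 2" "klen v z1 > 0 \<Longrightarrow> received v z1 \<le> 1"
    using r'(3) load ff(3) by auto
qed

lemma discharge:
  assumes v: "v \<in> branch"
  shows "load v + (\<Sum>z \<in> cnbs v. received v z) \<le> 12 + (load v - 12)"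
proof -
  obtain z1 where "z1 \<in> cnbs v" using card_branch[OF v] by fastforce
  then obtain z2 z3 where z: "cnbs v = {z1, z2, z3}" "distinct [z1, z2, z3]"
    using three_of[OF card_branch[OF v]] by blast
  have z': "cnbs v = {z2, z1, z3}" "distinct [z2, z1, z3]" "cnbs v = {z3, z1, z2}" "distinct [z3, z1, z2]"
    using z by auto
  have s: "load v = klen v z1 + klen v z2 + klen v z3"
    "(\<Sum>z \<in> cnbs v. received v z) = received v z1 + received v z2 + received v z3"
    using z by (simp_all add: load_def)
  note 1 = received_bound[OF v z] and 2 = received_bound[OF v z'(1,2)] and 3 = received_bound[OF v z'(3,4)]
  show ?thesis
    unfolding s by (rule discharge_arith) (use 1 2 3 in \<open>auto simp: add.commute\<close>)
qed

text \<open>Each branch vertex sends along one arc, and \<open>fin\<close> recovers the sender from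
  the arc at the receiver. So the excesses add up to at most the charges received, and they cancel
  when \<open>discharge\<close> is summed over all branch vertices.\<close>

lemma sum_load: "(\<Sum>v \<in> branch. load v) \<le> 12 * card branch"
proof -
  have fin: "finite branch"
  proof (rule finite_subset)
    show "branch \<subseteq> \<Union>E"
    proof
      fix v assume "v \<in> branch"
      then have "cnbs v \<noteq> {}" using card_branch by fastforce
      then show "v \<in> \<Union>E" by (auto simp: cnbs_def nbs_def)
    qed
    show "finite (\<Union>E)" using finE card2 by (intro finite_Union) (auto intro: card_ge_0_finite)
  qed
  let ?D = "Sigma branch cnbs"
  let ?\<delta> = "\<lambda>u. (fin u (shortest u), pen u (shortest u))"
  have inj: "inj_on ?\<delta> branch"
  proof (rule inj_on_inverseI)
    fix u assume "u \<in> branch"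
    then show "(\<lambda>(v, z). fin v z) (?\<delta> u) = u" using fin_fin(1) shortest(1) by simp
  qed
  have "(\<Sum>u \<in> branch. load u - 12) = (\<Sum>u \<in> branch. case ?\<delta> u of (v, z) \<Rightarrow> received v z)"
  proof (rule sum.cong)
    fix u assume "u \<in> branch"
    then show "load u - 12 = (case ?\<delta> u of (v, z) \<Rightarrow> received v z)"
      using fin_fin[OF _ shortest(1)] by (simp add: received_def)
  qed simp
  also have "\<dots> = (\<Sum>(v, z) \<in> ?\<delta> ` branch. received v z)"
    using inj by (simp add: sum.reindex case_prod_beta comp_def)
  also have "\<dots> \<le> (\<Sum>(v, z) \<in> ?D. received v z)"
    using fin finite_cnbs fin_branch pen_cnbs shortest(1) by (intro sum_mono2) auto
  also have "\<dots> = (\<Sum>v \<in> branch. \<Sum>z \<in> cnbs v. received v z)"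
    using fin finite_cnbs by (subst sum.Sigma) auto
  finally have 1: "(\<Sum>u \<in> branch. load u - 12) \<le> (\<Sum>v \<in> branch. \<Sum>z \<in> cnbs v. received v z)" .
  have "(\<Sum>v \<in> branch. load v + (\<Sum>z \<in> cnbs v. received v z)) \<le> (\<Sum>v \<in> branch. 12 + (load v - 12))"
    by (rule sum_mono) (rule discharge)
  then show ?thesis using 1 by (simp add: sum.distrib)
qed

end

section \<open>Density of the core\<close>

context minimal_uncolorable
begin

lemma finite_core: "finite core"
proof (rule finite_subset)
  show "core \<subseteq> \<Union>E"
  proof
    fix v assume "v \<in> core"
    then have "nbs E v \<noteq> {}" by (auto simp: core_def)
    then show "v \<in> \<Union>E" by (auto simp: nbs_def)
  qed
  show "finite (\<Union>E)" using finE card2 by (intro finite_Union) (auto intro: card_ge_0_finite)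
qed

text \<open>Walk from v through p on to a branch vertex u. The thread from u that starts backwards
  along this walk meets p and then v, and goes on because v is no branch vertex.\<close>

lemma two_on_thread:
  assumes v: "v \<in> two" and p: "p \<in> cnbs v"
  obtains u y i where "u \<in> branch" "y \<in> cnbs u" "i < klen u y" "th u y ! Suc i = v" "th u y ! i = p"
proof -
  have "v \<in> core" using v by (simp add: two_def)
  then obtain l where l: "nbwalk cadj l" "2 \<le> length l" "last l \<in> branch" "set (butlast (tl l)) \<subseteq> two" "hd l = v" "l ! 1 = p"
    using walk_to_branch[OF _ p] by blast
  let ?r = "rev l" and ?u = "last l" and ?y = "l ! (length l - 2)"
  note ends = thread_rev_ends[OF l(2)]
  have walk: "nbwalk cadj ?r" using nbwalk_rev[of cadj, OF cadj_sym] l(1) by blast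
  have cons2: "m = hd m # m ! 1 # drop 2 m" if "2 \<le> length m" for m :: "'a list"
    using that by (cases m; cases "tl m") auto
  have r: "?r = ?u # ?y # drop 2 ?r" using cons2[of ?r] ends l(2) by simp
  then have "cadj ?u ?y" using walk by (metis nbwalk_Cons2)
  then have y: "?y \<in> cnbs ?u" using cadj_cnbs by (auto simp: cadj_def)
  note t = th[OF l(3) y]
  have tt: "th ?u ?y = ?u # ?y # drop 2 (th ?u ?y)"
    using cons2[of "th ?u ?y"] t by (simp add: thread_def)
  have t1: "nbwalk cadj (th ?u ?y)" "set (butlast (tl (th ?u ?y))) \<subseteq> two" "last (th ?u ?y) \<in> branch"
    using t(1) by (simp_all add: thread_def)
  have "set (butlast (tl ?r)) \<subseteq> two" using l(4) by (simp only: interior_rev)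
  from walk_prefix[OF walk t1(1) this t1(2,3) r tt] obtain t' where t': "th ?u ?y = ?r @ t'" ..
  have "t' \<noteq> []"
  proof
    assume "t' = []"
    then have "last (th ?u ?y) = v" using t' l(5) ends by simp
    then show False using t(1) two_branch[OF v] by (simp add: thread_def)
  qed
  then have len: "length l < length (th ?u ?y)" using t' by simp
  let ?i = "length l - 2"
  have "?i < klen ?u ?y" using len l(2) by (simp add: klen_def)
  moreover have "?r ! Suc ?i = v" "?r ! ?i = p"
  proof -
    have "Suc ?i = length l - 1" using l(2) by simp
    moreover have "l \<noteq> []" using l(2) by auto
    ultimately show "?r ! Suc ?i = v" using l(5) by (simp add: rev_nth hd_conv_nth)
    show "?r ! ?i = p" using ends(4) l(6) by simp
  qed
  then have "th ?u ?y ! Suc ?i = v" "th ?u ?y ! ?i = p" using l(2) by (auto simp: t' nth_append)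
  ultimately show ?thesis using that[OF l(3) y] by blast
qed

text \<open>Each vertex of \<open>two\<close> is entered from either of its two neighbours by a
  thread leaving a branch vertex, and the loads count such entries.\<close>

lemma two_count: "2 * card two \<le> (\<Sum>u \<in> branch. load u)"
proof -
  have fin: "finite two" "finite branch" using finite_core core_eq(1) by auto
  let ?S = "Sigma branch (\<lambda>u. Sigma (cnbs u) (\<lambda>y. {..<klen u y}))"
  have finS: "finite ?S" using fin finite_cnbs by auto
  have "2 * card two = (\<Sum>v \<in> two. card (cnbs v))" by (simp add: two_def)
  also have "\<dots> = card (Sigma two cnbs)" using fin finite_cnbs by simp
  also have "\<dots> \<le> card ((\<lambda>(u, y, i). (th u y ! Suc i, th u y ! i)) ` ?S)"
  proof (rule card_mono)
    show "finite ((\<lambda>(u, y, i). (th u y ! Suc i, th u y ! i)) ` ?S)" using finS by simp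
    show "Sigma two cnbs \<subseteq> (\<lambda>(u, y, i). (th u y ! Suc i, th u y ! i)) ` ?S"
    proof
      fix x assume "x \<in> Sigma two cnbs"
      then obtain v p where x: "x = (v, p)" "v \<in> two" "p \<in> cnbs v" by auto
      obtain u y i where "u \<in> branch" "y \<in> cnbs u" "i < klen u y" "th u y ! Suc i = v" "th u y ! i = p"
        using two_on_thread[OF x(2,3)] .
      then show "x \<in> (\<lambda>(u, y, i). (th u y ! Suc i, th u y ! i)) ` ?S"
        using x(1) by (intro image_eqI[of _ _ "(u, y, i)"]) auto
    qed
  qed
  also have "\<dots> \<le> card ?S" by (rule card_image_le[OF finS])
  also have "\<dots> = (\<Sum>u \<in> branch. load u)" using fin finite_cnbs by (simp add: load_def)
  finally show ?thesis .
qed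

lemma core_edges:
  defines "F \<equiv> {e \<in> E. e \<subseteq> core}"
  shows "2 * card F = 2 * card two + 3 * card branch" "\<Union>F = core"
proof -
  have inc: "{e \<in> F. v \<in> e} = (\<lambda>w. {v, w}) ` cnbs v" if "v \<in> core" for v
  proof
    show "(\<lambda>w. {v, w}) ` cnbs v \<subseteq> {e \<in> F. v \<in> e}" using that by (auto simp: F_def cnbs_def nbs_def)
    show "{e \<in> F. v \<in> e} \<subseteq> (\<lambda>w. {v, w}) ` cnbs v"
    proof
      fix e assume e: "e \<in> {e \<in> F. v \<in> e}"
      then have "e \<in> star E v" by (auto simp: F_def star_def)
      then obtain w where "e = {v, w}" "w \<in> nbs E v" by (auto simp: star_eq)
      then show "e \<in> (\<lambda>w. {v, w}) ` cnbs v" using e by (auto simp: F_def cnbs_def)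
    qed
  qed
  have card_inc: "card {e \<in> F. v \<in> e} = card (cnbs v)" if "v \<in> core" for v
    unfolding inc[OF that] by (intro card_image inj_onI) (auto simp: doubleton_eq_iff)
  have finF: "finite F" using finE by (simp add: F_def)
  have "(\<Sum>v \<in> core. card {e \<in> F. v \<in> e}) = (\<Sum>e \<in> F. 2)"
  proof (rule sum_multicount_gen[OF finite_core finF])
    show "\<forall>e \<in> F. card {v \<in> core. v \<in> e} = 2"
    proof
      fix e assume "e \<in> F"
      then have "{v \<in> core. v \<in> e} = e" "card e = 2" using card2 by (auto simp: F_def)
      then show "card {v \<in> core. v \<in> e} = 2" by simp
    qed
  qed
  then have "2 * card F = (\<Sum>v \<in> core. card (cnbs v))" using card_inc by simp
  also have "\<dots> = (\<Sum>v \<in> two. card (cnbs v)) + (\<Sum>v \<in> branch. card (cnbs v))"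
    using finite_core core_eq by (simp add: sum.union_disjoint)
  also have "\<dots> = 2 * card two + 3 * card branch" by (simp add: two_def branch_def)
  finally show "2 * card F = 2 * card two + 3 * card branch" .
  show "\<Union>F = core"
  proof
    show "core \<subseteq> \<Union>F"
    proof
      fix v assume v: "v \<in> core"
      then have "cnbs v \<noteq> {}" by (rule core_cases) auto
      then obtain w where "w \<in> cnbs v" by blast
      then have "{v, w} \<in> {e \<in> F. v \<in> e}" unfolding inc[OF v] by (rule imageI)
      then show "v \<in> \<Union>F" by (intro UnionI[of "{v, w}"]) simp_all
    qed
    show "\<Union>F \<subseteq> core" unfolding F_def by (rule Union_least) simp
  qed
qed

lemma dense_core: "\<exists>F \<subseteq> E. F \<noteq> {} \<and> 15 * card (\<Union>F) \<le> 14 * card F"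
proof (intro exI[of _ "{e \<in> E. e \<subseteq> core}"] conjI)
  have "card core = card two + card branch"
    using finite_core core_eq by (simp add: card_Un_disjoint)
  \<comment> \<open>With |F| edges inside the core, 14 |F| - 15 |core| = 6 |branch| - |two|, which
    is nonnegative by this bound.\<close>
  moreover have "2 * card two \<le> 12 * card branch" using two_count sum_load by linarith
  ultimately show "15 * card (\<Union>{e \<in> E. e \<subseteq> core}) \<le> 14 * card {e \<in> E. e \<subseteq> core}"
    using core_edges by simp
  have "E \<noteq> {}"
  proof
    assume "E = {}"
    then have "strong E (\<lambda>_. C0)" by (simp add: strong_def)
    then show False using uncolorable by (auto simp: colorable_def)
  qed
  then obtain e where "e \<in> E" by blast
  then obtain a b where ab: "{a, b} \<in> E" using card2 by (metis card_2_iff)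
  have "core \<noteq> {}"
  proof (cases "a \<in> core")
    case False
    then show ?thesis using two_core_nbrs(3)[of a b] ab by (auto simp: nbs_def insert_commute)
  qed auto
  then show "{e \<in> E. e \<subseteq> core} \<noteq> {}" using core_edges(2) by auto
qed auto

end

lemma pendant_cycle_mono: "pendant_cycle F n k \<Longrightarrow> F \<subseteq> E \<Longrightarrow> pendant_cycle E n k"
  unfolding pendant_cycle_def by blast

theorem sparse_colorable:
  assumes fin: "finite E" and card2: "\<And>e. e \<in> E \<Longrightarrow> card e = 2" and deg3: "\<And>v. card (nbs E v) \<le> 3"
    and cyc: "\<not> pendant_cycle E 3 3" "\<not> pendant_cycle E 4 2" "\<not> pendant_cycle E 7 7"
    and sparse: "\<And>F. F \<subseteq> E \<Longrightarrow> F \<noteq> {} \<Longrightarrow> 14 * card F < 15 * card (\<Union>F)"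
  shows "colorable E"
proof (rule ccontr)
  let ?S = "{F \<in> Pow E. \<not> colorable F}"
  assume "\<not> colorable E"
  then have "finite ?S" "E \<in> ?S" using fin by simp_all
  from finite_has_minimal2[OF this] obtain F where
    "F \<in> ?S" "F \<subseteq> E" and min: "\<forall>G \<in> ?S. G \<subseteq> F \<longrightarrow> F = G"
    by (elim bexE conjE)
  then have F: "F \<subseteq> E" "\<not> colorable F" by simp_all
  have min: "colorable G" if "G \<subset> F" for G
    using min that F(1) by blast
  interpret minimal_uncolorable F
  proof
    show "finite F" using F(1) fin by (rule finite_subset)
    show "card e = 2" if "e \<in> F" for e using that F(1) card2 by blast
    have finN: "finite (nbs E v)" for v
    proof (rule finite_subset)
      show "nbs E v \<subseteq> \<Union>E" by (auto simp: nbs_def)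
      show "finite (\<Union>E)" using fin card2 by (intro finite_Union) (auto intro: card_ge_0_finite)
    qed
    show "card (nbs F v) \<le> 3" for v
    proof -
      have "nbs F v \<subseteq> nbs E v" using F(1) by (auto simp: nbs_def)
      then show ?thesis using card_mono[OF finN] deg3[of v] le_trans by blast
    qed
    show "\<not> pendant_cycle F 3 3" "\<not> pendant_cycle F 4 2" "\<not> pendant_cycle F 7 7"
      using cyc pendant_cycle_mono[OF _ F(1)] by blast+
  qed (use F min in auto)
  obtain H where "H \<subseteq> F" "H \<noteq> {}" "15 * card (\<Union>H) \<le> 14 * card H" using dense_core by blast
  then show False using sparse[of H] F(1) by auto
qed

section \<open>From edge sets to graphs; the case of small maximum average degree\<close>

lemma strong_chromatic_index_le_5:
  assumes "simple_graph G" "colorable (edges G)"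
  shows "strong_chromatic_index G \<le> 5"
proof -
  obtain c :: "'a set \<Rightarrow> color" where c: "strong (edges G) c"
    using assms(2) by (auto simp: colorable_def)
  define num where "num x = (case x of C0 \<Rightarrow> 0 | C1 \<Rightarrow> 1 | C2 \<Rightarrow> 2 | C3 \<Rightarrow> 3 | C4 \<Rightarrow> (4 :: nat))" for x
  have num: "num x = num y \<longleftrightarrow> x = y" "num x < 5" for x y
    by (cases x; cases y; simp add: num_def)+
  have "strong_edge_coloring G (num \<circ> c)"
    unfolding strong_edge_coloring_def
  proof (intro ballI impI)
    fix e f assume ef: "e \<in> edges G" "f \<in> edges G" "edges_close G e f"
    have pair: "\<exists>w. e = {v, w}" if "e \<in> edges G" "v \<in> e" for e v
    proof -
      have "card e = 2" using assms(1) that(1) by (auto simp: simple_graph_def)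
      then obtain a b where "e = {a, b}" by (auto simp: card_2_iff)
      then show ?thesis using that(2) by auto
    qed
    have "\<exists>u v. {u, v} \<in> edges G \<and> u \<in> e \<and> v \<in> f"
    proof (cases "e \<inter> f = {}")
      case False
      then obtain v where v: "v \<in> e" "v \<in> f" by blast
      obtain w where "f = {v, w}" using pair[OF ef(2) v(2)] by blast
      then show ?thesis using v ef(2) by blast
    next
      case True
      then show ?thesis using ef(3) by (auto simp: edges_close_def)
    qed
    then obtain u v where uv: "{u, v} \<in> edges G" "u \<in> e" "v \<in> f" by blast
    then have "inj_on c (star (edges G) u \<union> star (edges G) v)" using c by (simp add: strong_def)
    moreover have "e \<in> star (edges G) u" "f \<in> star (edges G) v" using uv ef by (auto simp: star_def)
    ultimately show "(num \<circ> c) e \<noteq> (num \<circ> c) f"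
      using ef(3) num(1) by (auto simp: edges_close_def inj_on_eq_iff)
  qed
  then show ?thesis
    unfolding strong_chromatic_index_def using num(2) by (intro Least_le exI[of _ "num \<circ> c"]) auto
qed

lemma simple_graph_finite:
  assumes "simple_graph G"
  shows "finite (edges G)" "finite (verts G)" "e \<in> edges G \<Longrightarrow> card e = 2" "e \<in> edges G \<Longrightarrow> e \<subseteq> verts G"
proof -
  show v: "finite (verts G)" using assms by (simp add: simple_graph_def)
  have "edges G \<subseteq> Pow (verts G)" using assms by (auto simp: simple_graph_def)
  then show "finite (edges G)" using v by (meson finite_Pow_iff finite_subset)
qed (use assms in \<open>auto simp: simple_graph_def\<close>)

lemma subcubic_nbs:
  assumes "simple_graph G" "subcubic G"
  shows "card (nbs (edges G) v) \<le> 3"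
proof (cases "v \<in> verts G")
  case True
  have "card (nbs (edges G) v) = card ((\<lambda>w. {v, w}) ` nbs (edges G) v)"
    by (intro card_image[symmetric] inj_onI) (auto simp: doubleton_eq_iff)
  also have "\<dots> \<le> card {e \<in> edges G. v \<in> e}"
    using simple_graph_finite(1)[OF assms(1)] by (intro card_mono) (auto simp: nbs_def)
  also have "\<dots> = degree G v" by (simp add: degree_def)
  also have "\<dots> \<le> max_degree G"
    unfolding max_degree_def using True simple_graph_finite(2)[OF assms(1)]
    by (intro cSUP_upper bdd_above_finite) auto
  also have "\<dots> \<le> 3" using assms(2) by (simp add: subcubic_def)
  finally show ?thesis .
next
  case False
  then have "nbs (edges G) v = {}"
    using simple_graph_finite(4)[OF assms(1)] by (auto simp: nbs_def)
  then show ?thesis by simp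
qed

lemma contains_cycle_with_pendants:
  assumes G: "simple_graph G" and n: "0 < n" "k \<le> n" and pc: "pendant_cycle (edges G) n k"
  shows "contains_subgraph G (cycle_with_pendants n k)"
proof -
  obtain f where f: "inj_on f {..<n + k}" "\<And>i. i < n \<Longrightarrow> {f i, f (Suc i mod n)} \<in> edges G"
    "\<And>i. i < k \<Longrightarrow> {f i, f (n + i)} \<in> edges G"
    using pc by (auto simp: pendant_cycle_def)
  let ?S = "cycle_with_pendants n k"
  let ?H = "\<lparr>verts = f ` verts ?S, edges = (\<lambda>e. f ` e) ` edges ?S\<rparr>"
  have E: "edges ?H \<subseteq> edges G"
    using f(2,3) by (auto simp: cycle_with_pendants_def cycle_graph_def)
  have V: "verts ?H \<subseteq> verts G"
  proof
    fix v assume "v \<in> verts ?H"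
    then obtain i where i: "i < n + k" "v = f i" by (auto simp: cycle_with_pendants_def)
    show "v \<in> verts G"
    proof (cases "i < n")
      case True
      then show ?thesis using f(2) simple_graph_finite(4)[OF G] i by blast
    next
      case False
      then have "{f (i - n), f i} \<in> edges G" using f(3)[of "i - n"] i by simp
      then show ?thesis using simple_graph_finite(4)[OF G] i by blast
    qed
  qed
  have "e \<subseteq> verts ?H" if "e \<in> edges ?H" for e
  proof -
    have "e' \<subseteq> verts ?S" if "e' \<in> edges ?S" for e'
      using that n by (auto simp: cycle_with_pendants_def cycle_graph_def trans_less_add1)
    then show ?thesis using that by auto
  qed
  moreover have "card e = 2" if "e \<in> edges ?H" for e using simple_graph_finite(3)[OF G] E that by blast
  ultimately have "simple_graph ?H"
    by (simp add: simple_graph_def cycle_with_pendants_def)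
  then have "subgraph ?H G" using E V by (simp add: subgraph_def)
  moreover have "isomorphic ?S ?H"
    unfolding isomorphic_def using f(1)
    by (intro exI[of _ f]) (auto simp: bij_betw_def cycle_with_pendants_def)
  ultimately show ?thesis unfolding contains_subgraph_def by blast
qed

lemma average_degree_le_mad:
  assumes G: "simple_graph G" and H: "subgraph H G" "verts H \<noteq> {}"
  shows "average_degree H \<le> mad G"
  unfolding mad_def
proof (rule Max_ge)
  have "{average_degree H | H. subgraph H G \<and> verts H \<noteq> {}} \<subseteq>
      (\<lambda>(V, E). 2 * real (card E) / real (card V)) ` (Pow (verts G) \<times> Pow (edges G))"
    by (auto simp: subgraph_def average_degree_def)
  then show "finite {average_degree H | H. subgraph H G \<and> verts H \<noteq> {}}"
    by (rule finite_subset) (simp add: simple_graph_finite[OF G])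
qed (use H in auto)

lemma sparse_mad:
  assumes G: "simple_graph G" and mad: "mad G < 2 + 1 / 7" and F: "F \<subseteq> edges G" "F \<noteq> {}"
  shows "14 * card F < 15 * card (\<Union>F)"
proof -
  let ?H = "\<lparr>verts = \<Union>F, edges = F\<rparr>"
  have V: "\<Union>F \<subseteq> verts G" using F(1) simple_graph_finite(4)[OF G] by blast
  have fin: "finite (\<Union>F)" using V simple_graph_finite(2)[OF G] by (rule finite_subset)
  have "simple_graph ?H" using fin F simple_graph_finite(3)[OF G] by (auto simp: simple_graph_def)
  then have sub: "subgraph ?H G" using V F by (simp add: subgraph_def)
  obtain e where "e \<in> F" using F(2) by blast
  moreover have "e \<noteq> {}" using simple_graph_finite(3)[OF G, of e] F(1) \<open>e \<in> F\<close> by auto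
  ultimately have ne: "\<Union>F \<noteq> {}" by blast
  then have pos: "card (\<Union>F) > 0" using fin by (simp add: card_gt_0_iff)
  have "average_degree ?H < 15 / 7"
    using average_degree_le_mad[OF G sub] ne mad by simp
  then have "14 * real (card F) < 15 * real (card (\<Union>F))"
    using pos by (simp add: average_degree_def field_simps)
  then show ?thesis by linarith
qed

lemma mad_part:
  assumes G: "simple_graph G" "subcubic G"
    and S: "\<not> contains_subgraph G S3" "\<not> contains_subgraph G S4" "\<not> contains_subgraph G S7"
    and mad: "mad G < 2 + 1 / 7"
  shows "strong_chromatic_index G \<le> 5"
proof (rule strong_chromatic_index_le_5[OF G(1) sparse_colorable])
  show "\<not> pendant_cycle (edges G) 3 3" "\<not> pendant_cycle (edges G) 4 2" "\<not> pendant_cycle (edges G) 7 7"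
    using S contains_cycle_with_pendants[OF G(1), of 3 3] contains_cycle_with_pendants[OF G(1), of 4 2]
      contains_cycle_with_pendants[OF G(1), of 7 7] by (auto simp: S3_def S4_def S7_def)
qed (use simple_graph_finite[OF G(1)] subcubic_nbs[OF G] sparse_mad[OF G(1) mad] in auto)

section \<open>Edge density of plane graphs\<close>

fun path_edges :: "'a list \<Rightarrow> 'a set set" where
  "path_edges [] = {}"
| "path_edges [x] = {}"
| "path_edges (x # y # l) = insert {x, y} (path_edges (y # l))"

definition cycle_edges :: "'a list \<Rightarrow> 'a set set" where
  "cycle_edges xs = path_edges (xs @ [hd xs])"

lemma path_edges_append: "path_edges (l1 @ v # l2) = path_edges (l1 @ [v]) \<union> path_edges (v # l2)"
  by (induction l1 rule: path_edges.induct) auto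

lemma path_edges_rev: "path_edges (rev l) = path_edges l"
proof (induction l rule: path_edges.induct)
  case (3 x y l)
  have "path_edges (rev (x # y # l)) = path_edges (rev l @ y # [x])" by simp
  also have "\<dots> = path_edges (rev (y # l)) \<union> {{y, x}}" by (subst path_edges_append) simp
  finally show ?case using 3 by (auto simp: insert_commute)
qed simp_all

lemma path_edges_subset: "e \<in> path_edges l \<Longrightarrow> e \<subseteq> set l"
  by (induction l rule: path_edges.induct) auto

lemma path_edges_nonempty: "e \<in> path_edges l \<Longrightarrow> e \<noteq> {}"
  by (induction l rule: path_edges.induct) auto

lemma Union_path_edges: "2 \<le> length l \<Longrightarrow> \<Union>(path_edges l) = set l"
proof (induction l rule: path_edges.induct)
  case (3 x y l)
  then show ?case by (cases l) auto
qed simp_all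

lemma finite_path_edges: "finite (path_edges l)"
  by (induction l rule: path_edges.induct) auto

lemma card_path_edges: "distinct l \<Longrightarrow> card (path_edges l) = length l - 1"
proof (induction l rule: path_edges.induct)
  case (3 x y l)
  have "{x, y} \<notin> path_edges (y # l)" using 3(2) path_edges_subset[of "{x, y}" "y # l"] by auto
  then show ?case using 3 by (simp add: finite_path_edges)
qed simp_all

lemma cycle_edges_split: "cycle_edges (a # A @ b # B) = path_edges (a # A @ [b]) \<union> path_edges (b # B @ [a])"
  using path_edges_append[of "a # A" b "B @ [a]"] by (simp add: cycle_edges_def)

lemma cycle_edges_rotate:
  assumes "xs = l1 @ a # l2"
  shows "cycle_edges xs = cycle_edges (a # l2 @ l1)"
proof (cases l1)
  case (Cons c l)
  then show ?thesis
    using path_edges_append[of l1 a "l2 @ [c]"] path_edges_append[of "a # l2" c "l @ [a]"] assms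
    by (auto simp: cycle_edges_def)
qed (simp add: assms)

lemma cycle_edges_subset: "e \<in> cycle_edges xs \<Longrightarrow> xs \<noteq> [] \<Longrightarrow> e \<subseteq> set xs"
  using path_edges_subset[of e "xs @ [hd xs]"] by (auto simp: cycle_edges_def)

lemma path_edges_ends:
  assumes "distinct (a # A @ [b])" "{a, b} \<in> path_edges (a # A @ [b])"
  shows "A = []"
proof (rule ccontr)
  assume "A \<noteq> []"
  then obtain c A' where A: "A = c # A'" by (cases A) auto
  then have "{a, b} = {a, c} \<or> {a, b} \<in> path_edges (c # A' @ [b])" using assms(2) by auto
  then show False
    using assms(1) A path_edges_subset[of "{a, b}" "c # A' @ [b]"] by (auto simp: doubleton_eq_iff)
qed

text \<open>A common edge could only be ab, and a path from a to b that contains this edge consists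
  of it alone; the cycle would then have two vertices.\<close>

lemma cycle_edges_disjoint:
  assumes "distinct (a # A @ b # B)" "3 \<le> length (a # A @ b # B)"
  shows "path_edges (a # A @ [b]) \<inter> path_edges (b # B @ [a]) = {}"
proof (rule ccontr)
  assume "\<not> ?thesis"
  then obtain e where e: "e \<in> path_edges (a # A @ [b])" "e \<in> path_edges (b # B @ [a])" by blast
  have "e \<subseteq> {a, b}" using path_edges_subset[OF e(1)] path_edges_subset[OF e(2)] assms(1) by auto
  moreover have "card e' = 2" if "e' \<in> path_edges l" "distinct l" for e' :: "'a set" and l
    using that by (induction l rule: path_edges.induct) auto
  then have "card e = 2" using e(1) assms(1) by auto
  moreover have "card {a, b} = 2" using assms(1) by simp
  ultimately have "e = {a, b}" by (intro card_subset_eq) simp_all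
  then show False
    using path_edges_ends[of a A b] path_edges_ends[of b B a] e assms by (auto simp: insert_commute)
qed

lemma rtrancl_distinct_path:
  assumes "(x, y) \<in> r\<^sup>*"
  shows "\<exists>l. l \<noteq> [] \<and> hd l = x \<and> last l = y \<and> distinct l \<and>
    path_edges l \<subseteq> {{u, v} | u v. (u, v) \<in> r} \<and> set l \<subseteq> insert x (Range r)"
  using assms
proof (induction rule: rtrancl_induct)
  case base
  then show ?case by (intro exI[of _ "[x]"]) simp
next
  case (step y z)
  then obtain l where l: "l \<noteq> []" "hd l = x" "last l = y" "distinct l"
    "path_edges l \<subseteq> {{u, v} | u v. (u, v) \<in> r}" "set l \<subseteq> insert x (Range r)" by blast
  show ?case
  proof (cases "z \<in> set l")
    case True
    then obtain l1 l2 where s: "l = l1 @ z # l2" by (auto simp: in_set_conv_decomp)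
    have "path_edges (l1 @ [z]) \<subseteq> path_edges l" using path_edges_append[of l1 z l2] s by auto
    moreover have "hd (l1 @ [z]) = x" using l(2) s by (cases l1) auto
    ultimately show ?thesis using l s by (intro exI[of _ "l1 @ [z]"]) auto
  next
    case False
    obtain l' where s: "l = l' @ [y]" using l(1,3) by (metis append_butlast_last_id)
    have "path_edges (l @ [z]) = path_edges l \<union> {{y, z}}" using path_edges_append[of l' y "[z]"] s by simp
    then show ?thesis
      using l False step(2) by (intro exI[of _ "l @ [z]"]) (auto simp: Range_iff)
  qed
qed

section \<open>Plane topology: arcs and inversions\<close>

lemma interior_arc_empty:
  fixes g :: "real \<Rightarrow> complex"
  assumes "arc g"
  shows "interior (path_image g) = {}"
proof (rule ccontr)
  assume ne: "interior (path_image g) \<noteq> {}"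
  obtain h where h: "homeomorphism {0..1} (path_image g) g h" using homeomorphism_arc[OF assms] .
  have "DIM(complex) \<le> DIM(real)"
  proof (rule invariance_of_dimension[OF _ open_interior _ ne])
    show "continuous_on (interior (path_image g)) h"
      using h by (intro continuous_on_subset[OF _ interior_subset]) (simp add: homeomorphism_def)
    show "inj_on h (interior (path_image g))"
      using h by (intro inj_on_subset[OF _ interior_subset] inj_on_inverseI[of _ g]) (simp add: homeomorphism_def)
  qed
  then show False by simp
qed

lemma connected_arc_minus_ends:
  fixes g :: "real \<Rightarrow> complex"
  assumes "arc g" "T \<subseteq> {pathstart g, pathfinish g}"
  shows "connected (path_image g - T)"
proof -
  have inj: "inj_on g {0..1}" and cont: "continuous_on {0..1} g"
    using assms(1) by (auto simp: arc_def path_def)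
  define I where "I = {0..1} - {t \<in> {0, 1}. g t \<in> T}"
  have "path_image g - T = g ` I"
  proof
    show "g ` I \<subseteq> path_image g - T"
    proof
      fix z assume "z \<in> g ` I"
      then obtain t where tI: "t \<in> I" and z: "z = g t" by blast
      then have t: "t \<in> {0..1}" "z = g t" "t \<in> {0, 1} \<Longrightarrow> g t \<notin> T" by (auto simp: I_def)
      have "z \<notin> T"
      proof
        assume zT: "z \<in> T"
        then have "g t = g 0 \<or> g t = g 1" using assms(2) t(2) by (auto simp: pathstart_def pathfinish_def)
        then have "t = 0 \<or> t = 1" using inj t(1) by (auto simp: inj_on_def)
        then show False using t zT by auto
      qed
      then show "z \<in> path_image g - T" using t by (auto simp: path_image_def)
    qed
  qed (auto simp: path_image_def I_def)
  moreover have "connected (g ` I)"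
  proof (rule connected_continuous_image)
    show "continuous_on I g" using cont by (rule continuous_on_subset) (auto simp: I_def)
    have mem: "t \<in> I \<longleftrightarrow> 0 \<le> t \<and> t \<le> 1 \<and> \<not> (t = 0 \<and> g 0 \<in> T) \<and> \<not> (t = 1 \<and> g 1 \<in> T)" for t
      by (auto simp: I_def)
    have "I = (if g 0 \<in> T then if g 1 \<in> T then {0<..<1} else {0<..1} else if g 1 \<in> T then {0..<1} else {0..1})"
      by (intro set_eqI) (simp add: mem less_le, blast)
    then show "connected I" by simp
  qed
  ultimately show ?thesis by simp
qed

lemma connected_meets_inside:
  assumes "connected T" "T \<inter> S = {}" "T \<inter> inside S \<noteq> {}"
  shows "T \<subseteq> inside S"
proof
  fix y assume "y \<in> T"
  obtain x where x: "x \<in> T" "x \<in> inside S" using assms(3) by blast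
  have "connected_component (- S) x y"
    using assms(1,2) x(1) \<open>y \<in> T\<close> by (intro connected_componentI[of T]) auto
  then show "y \<in> inside S" using inside_same_component x(2) by blast
qed

text \<open>The connected image of the inside without z0 is unbounded, hence outside the image
  curve. The image of the outside becomes connected with 0, the image of infinity, and then contains
  the whole inside of the image curve; as this is nonempty by the Jordan curve theorem, it is met
  and cannot be left.\<close>

lemma inversion_inside_outside:
  fixes c :: "real \<Rightarrow> complex"
  assumes c: "simple_path c" "pathfinish c = pathstart c" and z0: "z0 \<in> inside (path_image c)"
  defines "\<phi> \<equiv> \<lambda>z. inverse (z - z0)"
  shows "\<phi> ` outside (path_image c) \<subseteq> inside (\<phi> ` path_image c)"
    and "\<phi> ` (inside (path_image c) - {z0}) \<subseteq> outside (\<phi> ` path_image c)"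
proof -
  let ?S = "path_image c"
  let ?T = "\<phi> ` ?S"
  have inj: "inj \<phi>" by (auto simp: \<phi>_def inj_def)
  have z0S: "z0 \<notin> ?S" "z0 \<notin> outside ?S" using z0 inside_no_overlap[of ?S] inside_Int_outside[of ?S] by blast+
  have cont: "continuous_on X \<phi>" if "z0 \<notin> X" for X
    unfolding \<phi>_def using that by (intro continuous_intros) auto
  note J = Jordan_inside_outside[OF c]
  have "simple_path (\<phi> \<circ> c)"
    using c(1) inj cont[OF z0S(1)] path_continuous_image[of c \<phi>]
    by (auto simp: simple_path_def loop_free_def inj_eq)
  then have J': "inside ?T \<noteq> {}"
    using Jordan_inside_outside[of "\<phi> \<circ> c"] c(2) by (simp add: path_image_compose pathstart_compose pathfinish_compose)
  let ?Q = "\<phi> ` (inside ?S - {z0})"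
  have disj: "\<phi> ` X \<inter> ?T = {}" if "X \<inter> ?S = {}" for X
    using that inj by (auto dest: injD)
  show out: "?Q \<subseteq> outside ?T"
  proof
    fix x assume x: "x \<in> ?Q"
    have "connected (inside ?S - {z0})"
      using connected_open_delete[of "inside ?S" z0] J by simp
    then have conn: "connected ?Q" by (intro connected_continuous_image cont) auto
    have "(inside ?S - {z0}) \<inter> ?S = {}" using inside_no_overlap[of ?S] by blast
    then have QT: "?Q \<subseteq> - ?T" using disj by blast
    have unb: "\<not> bounded ?Q"
    proof
      assume "bounded ?Q"
      then obtain M where M: "M > 0" "\<And>w. w \<in> ?Q \<Longrightarrow> norm w \<le> M" by (auto simp: bounded_pos)
      obtain e where e: "e > 0" "ball z0 e \<subseteq> inside ?S" using J z0 by (meson openE)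
      \<comment> \<open>A point at this distance from z0 stays inside the curve and is sent to norm
        1 / d, beyond the supposed bound M.\<close>
      define d where "d = min (e / 2) (1 / (2 * M))"
      have d: "0 < d" "d < e" "d * M < 1" using e(1) M(1) by (auto simp: d_def min_def field_simps)
      have "z0 + of_real d \<in> inside ?S - {z0}" using d e(2) by (auto simp: dist_norm)
      then have "\<phi> (z0 + of_real d) \<in> ?Q" by (rule imageI)
      then have "norm (\<phi> (z0 + of_real d)) \<le> M" by (rule M(2))
      then have "1 / d \<le> M" using d(1) by (simp add: \<phi>_def norm_inverse divide_inverse)
      then show False using d by (simp add: field_simps)
    qed
    have "?Q \<subseteq> connected_component_set (- ?T) x"
      using connected_component_maximal[OF x conn QT] .
    then have "\<not> bounded (connected_component_set (- ?T) x)" using unb bounded_subset by blast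
    then show "x \<in> outside ?T" using x QT by (auto simp: outside_def)
  qed
  \<comment> \<open>0 takes the part of infinity: it is the one point of the plane that is not an
    image under the inversion.\<close>
  let ?R = "insert 0 (\<phi> ` outside ?S)"
  have conn_out: "connected (\<phi> ` outside ?S)" using J by (intro connected_continuous_image cont z0S) simp
  have zero_closure: "0 \<in> closure (\<phi> ` outside ?S)"
    unfolding closure_approachable
  proof (intro allI impI)
    fix e :: real assume e: "e > 0"
    have "\<not> bounded (outside ?S)" using J by simp
    then obtain z where z: "z \<in> outside ?S" "norm z > norm z0 + 1 / e" unfolding bounded_iff by (meson not_le)
    have "norm (z - z0) > 1 / e" using z(2) norm_triangle_ineq2[of z z0] by linarith
    moreover have "1 / e > 0" using e by simp
    ultimately have "norm (z - z0) > 0" by linarith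
    then have "inverse (norm (z - z0)) < e"
      using e \<open>norm (z - z0) > 1 / e\<close> by (simp add: field_simps)
    then have "dist (\<phi> z) 0 < e" by (simp only: \<phi>_def dist_norm diff_zero norm_inverse)
    then show "\<exists>y \<in> \<phi> ` outside ?S. dist y 0 < e" using z(1) by blast
  qed
  have conn: "connected ?R"
  proof (rule connected_intermediate_closure[OF conn_out])
    show "\<phi> ` outside ?S \<subseteq> ?R" by (rule subset_insertI)
    show "?R \<subseteq> closure (\<phi> ` outside ?S)"
      by (rule insert_subsetI[OF zero_closure closure_subset])
  qed
  have T0: "0 \<notin> ?T" using z0S(1) by (auto simp: \<phi>_def)
  have RT: "?R \<inter> ?T = {}" using disj[of "outside ?S"] T0 outside_no_overlap[of ?S] by auto
  have "inside ?T \<subseteq> ?R"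
  proof
    fix w assume w: "w \<in> inside ?T"
    show "w \<in> ?R"
    proof (cases "w = 0")
      case False
      define z where "z = z0 + inverse w"
      have zw: "\<phi> z = w" "z \<noteq> z0" using False by (simp_all add: \<phi>_def z_def)
      have "z \<notin> ?S" using w zw inside_no_overlap[of ?T] by blast
      moreover have "z \<notin> inside ?S" using out w zw inside_Int_outside[of ?T] by blast
      ultimately have "z \<in> outside ?S" using inside_Un_outside[of ?S] by blast
      then show ?thesis using zw by blast
    qed simp
  qed
  then have "?R \<inter> inside ?T \<noteq> {}" using J' by blast
  then show "\<phi> ` outside ?S \<subseteq> inside ?T" using connected_meets_inside[OF conn RT] by blast
qed

definition is_cycle :: "'a set set \<Rightarrow> 'a list \<Rightarrow> bool" where
  "is_cycle F xs \<longleftrightarrow> distinct xs \<and> 3 \<le> length xs \<and> cycle_edges xs \<subseteq> F"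

lemma is_cycle_two_points:
  assumes "is_cycle F xs" "a \<in> set xs" "b \<in> set xs" "a \<noteq> b"
  obtains A B where "is_cycle F (a # A @ b # B)" "cycle_edges (a # A @ b # B) = cycle_edges xs"
    "set (a # A @ b # B) = set xs" "length (a # A @ b # B) = length xs"
proof -
  obtain l1 l2 where s: "xs = l1 @ a # l2" using assms(2) by (auto simp: in_set_conv_decomp)
  have "b \<in> set (l2 @ l1)" using assms(3,4) s by auto
  from split_list[OF this] obtain A B where AB: "l2 @ l1 = A @ b # B" by blast
  have eq: "a # l2 @ l1 = a # A @ b # B" using AB by simp
  have "cycle_edges (a # A @ b # B) = cycle_edges xs"
    using cycle_edges_rotate[OF s] eq by simp
  moreover have "set (a # A @ b # B) = set xs" "length (a # A @ b # B) = length xs" "distinct (a # A @ b # B)"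
    unfolding eq[symmetric] using assms(1) s by (auto simp: is_cycle_def)
  ultimately show ?thesis using that[of A B] assms(1) by (simp add: is_cycle_def)
qed

section \<open>Plane drawings of edge sets and the insides of their cycles\<close>

locale plane_edges =
  fixes F :: "'a set set" and p :: "'a \<Rightarrow> complex" and \<gamma> :: "'a set \<Rightarrow> real \<Rightarrow> complex"
  assumes finF: "finite F" and card2F: "\<And>e. e \<in> F \<Longrightarrow> card e = 2"
    and injp: "inj_on p (\<Union>F)"
    and arcF: "\<And>e. e \<in> F \<Longrightarrow> arc (\<gamma> e)"
    and endsF: "\<And>e. e \<in> F \<Longrightarrow> {pathstart (\<gamma> e), pathfinish (\<gamma> e)} = p ` e"
    and vertexF: "\<And>e. e \<in> F \<Longrightarrow> path_image (\<gamma> e) \<inter> p ` \<Union>F = p ` e"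
    and crossF: "\<And>e f. e \<in> F \<Longrightarrow> f \<in> F \<Longrightarrow> e \<noteq> f \<Longrightarrow> path_image (\<gamma> e) \<inter> path_image (\<gamma> f) = p ` (e \<inter> f)"
begin

definition im :: "'a set set \<Rightarrow> complex set" where
  "im S = (\<Union>e \<in> S. path_image (\<gamma> e))"

lemma ends_in_image: "e \<in> F \<Longrightarrow> v \<in> e \<Longrightarrow> p v \<in> path_image (\<gamma> e)"
  using vertexF[of e] by blast

lemma im_Un: "im (S \<union> T) = im S \<union> im T"
  by (auto simp: im_def)

lemma im_Int:
  assumes "S \<subseteq> F" "T \<subseteq> F" "S \<inter> T = {}"
  shows "im S \<inter> im T = p ` (\<Union>S \<inter> \<Union>T)"
proof
  show "im S \<inter> im T \<subseteq> p ` (\<Union>S \<inter> \<Union>T)"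
  proof
    fix z assume "z \<in> im S \<inter> im T"
    then obtain e f where ef: "e \<in> S" "f \<in> T" "z \<in> path_image (\<gamma> e) \<inter> path_image (\<gamma> f)" by (auto simp: im_def)
    then have "e \<in> F" "f \<in> F" "e \<noteq> f" using assms by auto
    then have "z \<in> p ` (e \<inter> f)" using crossF ef(3) by simp
    then show "z \<in> p ` (\<Union>S \<inter> \<Union>T)" using ef by blast
  qed
  show "p ` (\<Union>S \<inter> \<Union>T) \<subseteq> im S \<inter> im T"
  proof
    fix z assume "z \<in> p ` (\<Union>S \<inter> \<Union>T)"
    then obtain v e f where "z = p v" "v \<in> e" "e \<in> S" "v \<in> f" "f \<in> T" by blast
    then show "z \<in> im S \<inter> im T"
      using ends_in_image[of e v] ends_in_image[of f v] assms by (auto simp: im_def)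
  qed
qed

lemma path_arc:
  assumes "distinct l" "2 \<le> length l" "path_edges l \<subseteq> F"
  shows "\<exists>g. arc g \<and> pathstart g = p (hd l) \<and> pathfinish g = p (last l) \<and> path_image g = im (path_edges l)"
  using assms
proof (induction l rule: path_edges.induct)
  case (3 x y l)
  have e: "{x, y} \<in> F" using 3(4) by simp
  have "pathstart (\<gamma> {x, y}) = p x \<and> pathfinish (\<gamma> {x, y}) = p y \<or>
      pathstart (\<gamma> {x, y}) = p y \<and> pathfinish (\<gamma> {x, y}) = p x"
    using endsF[OF e] by (simp add: doubleton_eq_iff)
  then have "\<exists>g. arc g \<and> pathstart g = p x \<and> pathfinish g = p y \<and> path_image g = path_image (\<gamma> {x, y})"
  proof
    assume "pathstart (\<gamma> {x, y}) = p x \<and> pathfinish (\<gamma> {x, y}) = p y"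
    then show ?thesis using arcF[OF e] by blast
  next
    assume "pathstart (\<gamma> {x, y}) = p y \<and> pathfinish (\<gamma> {x, y}) = p x"
    then show ?thesis
      using arc_reversepath[OF arcF[OF e]] by (intro exI[of _ "reversepath (\<gamma> {x, y})"]) simp
  qed
  then obtain g1 where g1: "arc g1" "pathstart g1 = p x" "pathfinish g1 = p y" "path_image g1 = path_image (\<gamma> {x, y})" by blast
  show ?case
  proof (cases "l = []")
    case True
    then show ?thesis using g1 by (intro exI[of _ g1]) (auto simp: im_def)
  next
    case False
    then obtain g2 where g2: "arc g2" "pathstart g2 = p y" "pathfinish g2 = p (last l)" "path_image g2 = im (path_edges (y # l))"
      using 3 by (cases l) auto
    have ne: "{x, y} \<notin> path_edges (y # l)" using path_edges_subset[of "{x, y}" "y # l"] 3(2) by auto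
    have "path_image g1 \<inter> path_image g2 = im {{x, y}} \<inter> im (path_edges (y # l))"
      using g1(4) g2(4) by (simp add: im_def)
    also have "\<dots> = p ` ({x, y} \<inter> set (y # l))"
    proof -
      have "\<Union>(path_edges (y # l)) = set (y # l)"
        by (rule Union_path_edges) (use False in \<open>cases l, simp_all\<close>)
      then show ?thesis using im_Int[of "{{x, y}}" "path_edges (y # l)"] ne e 3(4) by simp
    qed
    also have "\<dots> \<subseteq> {pathstart g2}" using 3(2) g2(2) by auto
    finally have "arc (g1 +++ g2)" using g1(1,3) g2(1,2) by (intro arc_join) auto
    moreover have "path_image (g1 +++ g2) = im (path_edges (x # y # l))"
      using path_image_join[of g1 g2] g1(3,4) g2(2,4) by (simp add: im_def)
    ultimately show ?thesis
      using g1(2) g2(3) False by (intro exI[of _ "g1 +++ g2"]) simp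
  qed
qed simp_all

lemma cycle_closed_curve:
  assumes "is_cycle F xs"
  obtains c where "simple_path c" "pathfinish c = pathstart c" "path_image c = im (cycle_edges xs)"
proof -
  obtain a b B where xs: "xs = a # [] @ b # B" using assms by (cases xs; cases "tl xs") (auto simp: is_cycle_def)
  have d: "distinct (a # [] @ b # B)" "3 \<le> length (a # [] @ b # B)" and sub: "cycle_edges xs \<subseteq> F"
    using assms xs by (auto simp: is_cycle_def)
  have ce: "cycle_edges xs = path_edges [a, b] \<union> path_edges (b # B @ [a])"
    using cycle_edges_split[of a "[]" b B] xs by simp
  have sub': "path_edges [a, b] \<subseteq> F" "path_edges (b # B @ [a]) \<subseteq> F" using ce sub by auto
  obtain g1 where g1: "arc g1" "pathstart g1 = p a" "pathfinish g1 = p b" "path_image g1 = im (path_edges [a, b])"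
    using path_arc[of "[a, b]"] d sub' by auto
  obtain g2 where g2: "arc g2" "pathstart g2 = p b" "pathfinish g2 = p a" "path_image g2 = im (path_edges (b # B @ [a]))"
    using path_arc[of "b # B @ [a]"] d sub' by auto
  have "path_edges [a, b] \<inter> path_edges (b # B @ [a]) = {}"
    using cycle_edges_disjoint[OF d] by simp
  then have "path_image g1 \<inter> path_image g2 = p ` (\<Union>(path_edges [a, b]) \<inter> \<Union>(path_edges (b # B @ [a])))"
    using im_Int[OF sub'] g1(4) g2(4) by simp
  also have "\<dots> \<subseteq> {pathstart g1, pathstart g2}"
    using g1(2) g2(2) by auto
  finally have "simple_path (g1 +++ g2)"
    using g1 g2 by (intro simple_path_join_loop) auto
  moreover have "path_image (g1 +++ g2) = im (cycle_edges xs)"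
    using g1 g2 unfolding ce im_Un by (simp add: path_image_join)
  ultimately show ?thesis using that[of "g1 +++ g2"] g1 g2 by simp
qed

text \<open>One point besides the ends suffices as a criterion: an edge off the cycle meets it at
  most in ends of that edge, so without these it stays on one side. Edges of the cycle itself are
  never inner.\<close>

definition inner_edges :: "'a list \<Rightarrow> 'a set set" where
  "inner_edges xs = {f \<in> F. (path_image (\<gamma> f) - p ` f) \<inter> inside (im (cycle_edges xs)) \<noteq> {}}"

definition inner_verts :: "'a list \<Rightarrow> 'a set" where
  "inner_verts xs = {v \<in> \<Union>F. p v \<in> inside (im (cycle_edges xs))}"

lemma interior_nonempty:
  assumes "e \<in> F"
  shows "path_image (\<gamma> e) - p ` e \<noteq> {}"
proof
  assume "path_image (\<gamma> e) - p ` e = {}"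
  moreover have "finite (p ` e)" using card2F[OF assms] by (intro finite_imageI card_ge_0_finite) simp
  ultimately have "finite (path_image (\<gamma> e))" by (metis Diff_eq_empty_iff finite_subset)
  moreover have "connected (path_image (\<gamma> e))" using arcF[OF assms] by (simp add: arc_imp_path connected_path_image)
  moreover have "pathstart (\<gamma> e) \<noteq> pathfinish (\<gamma> e)" using arcF[OF assms] arc_distinct_ends by metis
  ultimately show False
    using connected_finite_iff_sing[of "path_image (\<gamma> e)"] pathstart_in_path_image[of "\<gamma> e"] pathfinish_in_path_image[of "\<gamma> e"] by auto
qed

lemma connected_minus_ends: "e \<in> F \<Longrightarrow> X \<subseteq> e \<Longrightarrow> connected (path_image (\<gamma> e) - p ` X)"
  using connected_arc_minus_ends[OF arcF] endsF by (metis image_mono)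

lemma image_minus_disjoint:
  assumes "e \<in> F" "S \<subseteq> F" "e \<notin> S" "e \<inter> \<Union>S \<subseteq> X"
  shows "(path_image (\<gamma> e) - p ` X) \<inter> im S = {}"
proof -
  have "im {e} \<inter> im S = p ` (e \<inter> \<Union>S)" using im_Int[of "{e}" S] assms by simp
  then show ?thesis using assms(4) by (auto simp: im_def)
qed

lemma Union_cycle_edges: "is_cycle F xs \<Longrightarrow> \<Union>(cycle_edges xs) = set xs"
  unfolding cycle_edges_def using Union_path_edges[of "xs @ [hd xs]"] by (cases xs) (auto simp: is_cycle_def)

lemma card_cycle_edges: 
  assumes "is_cycle F xs"
  shows "card (cycle_edges xs) = length xs"
proof -
  obtain a b B where xs: "xs = a # [] @ b # B" using assms by (cases xs; cases "tl xs") (auto simp: is_cycle_def)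
  have d: "distinct (a # [] @ b # B)" "3 \<le> length (a # [] @ b # B)"
    using assms xs by (auto simp: is_cycle_def)
  have "card (cycle_edges xs) = card (path_edges [a, b]) + card (path_edges (b # B @ [a]))"
  proof -
    have "cycle_edges xs = path_edges [a, b] \<union> path_edges (b # B @ [a])"
      using cycle_edges_split[of a "[]" b B] unfolding xs append_Nil .
    then show ?thesis
      using card_Un_disjoint[OF finite_path_edges finite_path_edges cycle_edges_disjoint[OF d]]
      unfolding append_Nil by simp
  qed
  then show ?thesis using card_path_edges[of "[a, b]"] card_path_edges[of "b # B @ [a]"] d xs by auto
qed

text \<open>The two arcs of the cycle and the ear join the same two points and are disjoint
  otherwise. Since the ear runs inside, the theta curve version of the Jordan curve theorem splits
  the disc along it.\<close>

lemma theta_split: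
  assumes cyc: "is_cycle F (a # A @ b # B)"
    and P: "distinct (a # qs @ [b])" "set qs \<inter> set (a # A @ b # B) = {}" "path_edges (a # qs @ [b]) \<subseteq> F"
      "path_edges (a # qs @ [b]) \<inter> cycle_edges (a # A @ b # B) = {}"
    and ne: "im (path_edges (a # qs @ [b])) \<inter> inside (im (cycle_edges (a # A @ b # B))) \<noteq> {}"
  defines "xs1 \<equiv> a # A @ b # rev qs" and "xs2 \<equiv> a # qs @ b # B"
  shows "is_cycle F xs1" "is_cycle F xs2"
    "cycle_edges xs1 = path_edges (a # A @ [b]) \<union> path_edges (a # qs @ [b])"
    "cycle_edges xs2 = path_edges (b # B @ [a]) \<union> path_edges (a # qs @ [b])"
    "inside (im (cycle_edges xs1)) \<inter> inside (im (cycle_edges xs2)) = {}"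
    "inside (im (cycle_edges xs1)) \<union> inside (im (cycle_edges xs2)) \<union> (im (path_edges (a # qs @ [b])) - {p a, p b}) =
      inside (im (cycle_edges (a # A @ b # B)))"
proof -
  let ?PA = "path_edges (a # A @ [b])" and ?PB = "path_edges (b # B @ [a])" and ?P = "path_edges (a # qs @ [b])"
  have d: "distinct (a # A @ b # B)" "3 \<le> length (a # A @ b # B)" and sub: "cycle_edges (a # A @ b # B) \<subseteq> F"
    using cyc by (auto simp: is_cycle_def)
  note ce = cycle_edges_split[of a A b B]
  have PF: "?PA \<subseteq> F" "?PB \<subseteq> F" using ce sub by auto
  have revP: "path_edges (b # rev qs @ [a]) = ?P" using path_edges_rev[of "a # qs @ [b]"] by simp
  show c1: "cycle_edges xs1 = ?PA \<union> ?P" unfolding xs1_def cycle_edges_split revP ..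
  show c2: "cycle_edges xs2 = ?PB \<union> ?P" unfolding xs2_def cycle_edges_split by (rule Un_commute)
  \<comment> \<open>If the ear and an arc of the cycle were both single edges, they would be the
    same edge. So both new cycles have length at least three.\<close>
  have ab: "A \<noteq> [] \<or> qs \<noteq> []" "B \<noteq> [] \<or> qs \<noteq> []"
    using P(4) ce by (auto simp: insert_commute)
  show "is_cycle F xs1"
    using d P ab PF c1 by (auto simp: is_cycle_def xs1_def Suc_le_eq neq_Nil_conv)
  show "is_cycle F xs2"
    using d P ab PF c2 by (auto simp: is_cycle_def xs2_def Suc_le_eq neq_Nil_conv)
  have revB: "path_edges (a # rev B @ [b]) = ?PB" using path_edges_rev[of "b # B @ [a]"] by simp
  obtain g1 where g1: "arc g1" "pathstart g1 = p a" "pathfinish g1 = p b" "path_image g1 = im ?PA"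
    using path_arc[of "a # A @ [b]"] d PF by auto
  obtain g2 where g2: "arc g2" "pathstart g2 = p a" "pathfinish g2 = p b" "path_image g2 = im ?PB"
    using path_arc[of "a # rev B @ [b]"] d PF revB by auto
  obtain g where g: "arc g" "pathstart g = p a" "pathfinish g = p b" "path_image g = im ?P"
    using path_arc[of "a # qs @ [b]"] P by auto
  have U: "\<Union>?PA = set (a # A @ [b])" "\<Union>?PB = set (b # B @ [a])" "\<Union>?P = set (a # qs @ [b])"
    by (intro Union_path_edges; simp)+
  have I12: "im ?PA \<inter> im ?PB = {p a, p b}"
  proof -
    have "set (a # A @ [b]) \<inter> set (b # B @ [a]) = {a, b}" using d by auto
    then show ?thesis using im_Int[OF PF cycle_edges_disjoint[OF d]] unfolding U by simp
  qed
  have I1: "im ?PA \<inter> im ?P = {p a, p b}"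
  proof -
    have "set (a # A @ [b]) \<inter> set (a # qs @ [b]) = {a, b}" "?PA \<inter> ?P = {}" using P(2,4) ce by auto
    then show ?thesis using im_Int[OF PF(1) P(3)] unfolding U by simp
  qed
  have I2: "im ?PB \<inter> im ?P = {p a, p b}"
  proof -
    have "set (b # B @ [a]) \<inter> set (a # qs @ [b]) = {a, b}" "?PB \<inter> ?P = {}" using P(2,4) ce by auto
    then show ?thesis using im_Int[OF PF(2) P(3)] unfolding U by simp
  qed
  have pab: "p a \<noteq> p b" using g(1-3) arc_distinct_ends by metis
  have imC: "im (cycle_edges (a # A @ b # B)) = path_image g1 \<union> path_image g2"
    using ce g1(4) g2(4) by (simp add: im_Un)
  have im12: "im (cycle_edges xs1) = path_image g1 \<union> path_image g" "im (cycle_edges xs2) = path_image g2 \<union> path_image g"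
    using c1 c2 g1(4) g2(4) g(4) by (simp_all add: im_Un)
  have "inside (path_image g1 \<union> path_image g) \<inter> inside (path_image g2 \<union> path_image g) = {} \<and>
      inside (path_image g1 \<union> path_image g) \<union> inside (path_image g2 \<union> path_image g) \<union>
        (path_image g - {p a, p b}) = inside (path_image g1 \<union> path_image g2)"
    using split_inside_simple_closed_curve[OF arc_imp_simple_path[OF g1(1)] g1(2,3) arc_imp_simple_path[OF g2(1)] g2(2,3)
        arc_imp_simple_path[OF g(1)] g(2,3) pab] I12 I1 I2 ne imC g1(4) g2(4) g(4) by metis
  then show "inside (im (cycle_edges xs1)) \<inter> inside (im (cycle_edges xs2)) = {}"
    "inside (im (cycle_edges xs1)) \<union> inside (im (cycle_edges xs2)) \<union> (im ?P - {p a, p b}) =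
      inside (im (cycle_edges (a # A @ b # B)))"
    unfolding im12 imC g(4)[symmetric] by auto
qed

end

context plane_edges
begin

text \<open>The assumption \<open>nonsep\<close> is 2-connectedness, phrased for edge sets. An inner
  edge with both ends on the cycle is an ear itself. Otherwise let K be the component, off the
  cycle, of an end of this edge: the edges at K attach to at least two cycle vertices, and an ear
  runs through K. It enters the inside, because connectedness carries that side to all of K.\<close>

lemma ear:
  assumes nonsep: "\<And>F'. F' \<subseteq> F \<Longrightarrow> F' \<noteq> {} \<Longrightarrow> F' \<noteq> F \<Longrightarrow> 2 \<le> card (\<Union>F' \<inter> \<Union>(F - F'))"
    and cyc: "is_cycle F xs" and e: "e \<in> inner_edges xs"
  obtains a b qs where "a \<in> set xs" "b \<in> set xs" "distinct (a # qs @ [b])" "set qs \<inter> set xs = {}"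
    "path_edges (a # qs @ [b]) \<subseteq> F" "path_edges (a # qs @ [b]) \<inter> cycle_edges xs = {}"
    "im (path_edges (a # qs @ [b])) \<inter> inside (im (cycle_edges xs)) \<noteq> {}"
proof -
  let ?S = "im (cycle_edges xs)"
  have ne: "xs \<noteq> []" and sub: "cycle_edges xs \<subseteq> F" using cyc by (auto simp: is_cycle_def)
  note Uce = Union_cycle_edges[OF cyc]
  have eF: "e \<in> F" and e_in: "(path_image (\<gamma> e) - p ` e) \<inter> inside ?S \<noteq> {}" using e by (auto simp: inner_edges_def)
  have e_out: "e \<notin> cycle_edges xs"
  proof
    assume "e \<in> cycle_edges xs"
    then have "path_image (\<gamma> e) \<subseteq> ?S" by (auto simp: im_def)
    then show False using e_in inside_no_overlap[of ?S] by blast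
  qed
  show ?thesis
  proof (cases "e \<subseteq> set xs")
    case True
    obtain a b where ab: "e = {a, b}" "a \<noteq> b" using card2F[OF eF] by (auto simp: card_2_iff)
    show ?thesis
    proof (rule that[of a b "[]"])
      show "im (path_edges (a # [] @ [b])) \<inter> inside ?S \<noteq> {}"
        using e_in ab by (auto simp: im_def)
    qed (use ab True eF e_out in auto)
  next
    case False
    then obtain x where x: "x \<in> e" "x \<notin> set xs" by blast
    define r where "r = {(u, v). {u, v} \<in> F \<and> u \<notin> set xs \<and> v \<notin> set xs}"
    define K where "K = {y. (x, y) \<in> r\<^sup>*}"
    have sym: "sym (r\<^sup>*)" by (intro sym_rtrancl symI) (auto simp: r_def insert_commute)
    have K_out: "y \<notin> set xs" if "y \<in> K" for y
      using that x(2) by (auto simp: K_def r_def elim: rtranclE)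
    have K_step: "z \<in> K" if "y \<in> K" "{y, z} \<in> F" "z \<notin> set xs" for y z
      using that K_out[OF that(1)] by (auto simp: K_def r_def intro: rtrancl_into_rtrancl)
    have K_in: "p y \<in> inside ?S" if "y \<in> K" for y
    proof -
      have "(x, y) \<in> r\<^sup>*" using that by (simp add: K_def)
      then show ?thesis
      proof (induction rule: rtrancl_induct)
        case base
        let ?T = "path_image (\<gamma> e) - p ` (e \<inter> set xs)"
        have "?T \<inter> ?S = {}" using image_minus_disjoint[OF eF sub e_out] Uce by blast
        moreover have "?T \<inter> inside ?S \<noteq> {}" using e_in by blast
        moreover have "connected ?T" using connected_minus_ends[OF eF] by blast
        ultimately have T: "?T \<subseteq> inside ?S" by (intro connected_meets_inside)
        have "p x \<notin> p ` (e \<inter> set xs)"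
        proof
          assume "p x \<in> p ` (e \<inter> set xs)"
          then obtain v where "p x = p v" "v \<in> e" "v \<in> set xs" by blast
          then show False using injp x eF by (metis UnionI inj_onD)
        qed
        then show ?case using T ends_in_image[OF eF x(1)] by blast
      next
        case (step y z)
        have yz: "{y, z} \<in> F" "y \<notin> set xs" "z \<notin> set xs" using step(2) by (auto simp: r_def)
        have out: "{y, z} \<notin> cycle_edges xs" using cycle_edges_subset[OF _ ne] yz(2) by blast
        have "(path_image (\<gamma> {y, z}) - p ` {}) \<inter> ?S = {}"
          by (rule image_minus_disjoint[OF yz(1) sub out]) (use Uce yz in auto)
        moreover have "connected (path_image (\<gamma> {y, z}) - p ` {})" using connected_minus_ends[OF yz(1)] by blast
        moreover have "p y \<in> path_image (\<gamma> {y, z})" "p z \<in> path_image (\<gamma> {y, z})" using ends_in_image[OF yz(1)] by auto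
        ultimately show ?case
          using connected_meets_inside[of "path_image (\<gamma> {y, z})" ?S] step.IH by auto
      qed
    qed
    define F1 where "F1 = {f \<in> F. f \<inter> K \<noteq> {}}"
    have "e \<in> F1" using x(1) eF by (auto simp: F1_def K_def)
    moreover have "F1 \<noteq> F"
    proof -
      have "cycle_edges xs \<noteq> {}" using Uce ne by auto
      then obtain f where f: "f \<in> cycle_edges xs" by blast
      then have "f \<subseteq> set xs" using cycle_edges_subset ne by blast
      then have "f \<notin> F1" using K_out by (auto simp: F1_def)
      then show ?thesis using f sub by blast
    qed
    ultimately have "2 \<le> card (\<Union>F1 \<inter> \<Union>(F - F1))"
      by (intro nonsep) (auto simp: F1_def)
    then obtain D where "D \<subseteq> \<Union>F1 \<inter> \<Union>(F - F1)" "card D = 2"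
      by (meson obtain_subset_with_card_n)
    then obtain a b where ab: "a \<noteq> b" "a \<in> \<Union>F1 \<inter> \<Union>(F - F1)" "b \<in> \<Union>F1 \<inter> \<Union>(F - F1)"
      by (auto simp: card_2_iff)
    \<comment> \<open>A vertex shared with an edge that avoids K is not in K itself, so it is on the
      cycle, K being closed under steps off the cycle.\<close>
    have attach: "c \<in> set xs \<and> (\<exists>k \<in> K. {c, k} \<in> F)" if c: "c \<in> \<Union>F1 \<inter> \<Union>(F - F1)" for c
    proof -
      have "c \<notin> K" using c by (auto simp: F1_def)
      obtain f where f: "f \<in> F" "c \<in> f" "f \<inter> K \<noteq> {}" using c by (auto simp: F1_def)
      then obtain k where k: "k \<in> f" "k \<in> K" by blast
      then have "f = {c, k}" using card2F[OF f(1)] f(2) \<open>c \<notin> K\<close> by (auto simp: card_2_iff)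
      then show ?thesis using K_step[of k c] f(1) k(2) \<open>c \<notin> K\<close> by (auto simp: insert_commute)
    qed
    obtain k1 k2 where k: "a \<in> set xs" "k1 \<in> K" "{a, k1} \<in> F" "b \<in> set xs" "k2 \<in> K" "{b, k2} \<in> F"
      using attach[OF ab(2)] attach[OF ab(3)] by blast
    have "(k1, k2) \<in> r\<^sup>*" using k(2,5) symD[OF sym] by (auto simp: K_def intro: rtrancl_trans)
    from rtrancl_distinct_path[OF this] obtain l where
      l: "l \<noteq> []" "hd l = k1" "last l = k2" "distinct l" "path_edges l \<subseteq> {{u, v} | u v. (u, v) \<in> r}" "set l \<subseteq> insert k1 (Range r)"
      by blast
    have lF: "path_edges l \<subseteq> F" using l(5) by (auto simp: r_def)
    have l_out: "set l \<inter> set xs = {}" using l(6) K_out[OF k(2)] by (auto simp: r_def)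
    obtain m where m: "l = m @ [k2]" using l(1,3) by (metis append_butlast_last_id)
    obtain m' where m': "l = k1 # m'" using l(1,2) by (cases l) auto
    have "path_edges (a # l @ [b]) = insert {a, k1} (path_edges (l @ [b]))" using m' by simp
    also have "path_edges (l @ [b]) = path_edges l \<union> {{k2, b}}" using path_edges_append[of m k2 "[b]"] m by simp
    finally have pe: "path_edges (a # l @ [b]) = insert {a, k1} (path_edges l \<union> {{k2, b}})" .
    show ?thesis
    proof (rule that[of a b l])
      show "distinct (a # l @ [b])" using l(4) l_out k(1,4) ab(1) by auto
      show "path_edges (a # l @ [b]) \<subseteq> F" using pe lF k(3,6) by (simp add: insert_commute)
      have "f \<inter> set l \<noteq> {}" if "f \<in> path_edges (a # l @ [b])" for f
      proof -
        have "k1 \<in> set l" "k2 \<in> set l" using l(1-3) hd_in_set last_in_set by blast+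
        moreover have "f = {a, k1} \<or> f \<in> path_edges l \<or> f = {k2, b}" using that unfolding pe by blast
        ultimately show ?thesis using path_edges_subset[of f l] path_edges_nonempty[of f l] by blast
      qed
      then show "path_edges (a # l @ [b]) \<inter> cycle_edges xs = {}"
        using cycle_edges_subset[OF _ ne] l_out by blast
      have "p k1 \<in> im (path_edges (a # l @ [b]))"
        using ends_in_image[OF k(3)] by (auto simp: pe im_def)
      then show "im (path_edges (a # l @ [b])) \<inter> inside ?S \<noteq> {}" using K_in[OF k(2)] by blast
    qed (use k l_out in auto)
  qed
qed

lemma finite_inner: "finite (inner_edges xs)" "finite (inner_verts xs)"
proof -
  show "finite (inner_edges xs)" using finF by (simp add: inner_edges_def)
  have "finite (\<Union>F)" using finF card2F by (intro finite_Union) (auto intro: card_ge_0_finite)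
  then show "finite (inner_verts xs)" by (rule rev_finite_subset) (auto simp: inner_verts_def)
qed

text \<open>Euler's formula for the disc bounded by the cycle, combined with the face count: an ear splits
  the disc into two discs, for which the inequality adds up.\<close>

lemma disc_inequality:
  assumes nonsep: "\<And>F'. F' \<subseteq> F \<Longrightarrow> F' \<noteq> {} \<Longrightarrow> F' \<noteq> F \<Longrightarrow> 2 \<le> card (\<Union>F' \<inter> \<Union>(F - F'))"
    and girth: "\<And>xs. is_cycle F xs \<Longrightarrow> g \<le> length xs" and g: "3 \<le> g"
    and cyc: "is_cycle F xs"
  shows "(g - 2) * card (inner_edges xs) + g \<le> g * card (inner_verts xs) + length xs"
  using cyc
proof (induction "card (inner_edges xs)" arbitrary: xs rule: less_induct)
  case less
  show ?case
  proof (cases "inner_edges xs = {}")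
    case True
    \<comment> \<open>Without inner edges the claim is just the girth assumption for this
      cycle.\<close>
    then show ?thesis using girth[OF less.prems] by simp
  next
    case False
    then obtain e where "e \<in> inner_edges xs" by blast
    from ear[OF nonsep less.prems this] obtain a b qs where
      ab: "a \<in> set xs" "b \<in> set xs" and dP: "distinct (a # qs @ [b])" and outP: "set qs \<inter> set xs = {}"
      and PF: "path_edges (a # qs @ [b]) \<subseteq> F" and PC: "path_edges (a # qs @ [b]) \<inter> cycle_edges xs = {}"
      and neP: "im (path_edges (a # qs @ [b])) \<inter> inside (im (cycle_edges xs)) \<noteq> {}"
      by blast
    have "a \<noteq> b" using dP by auto
    from is_cycle_two_points[OF less.prems ab this] obtain A B where
      AB: "is_cycle F (a # A @ b # B)" "cycle_edges (a # A @ b # B) = cycle_edges xs"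
      "set (a # A @ b # B) = set xs" "length (a # A @ b # B) = length xs" by blast
    let ?P = "path_edges (a # qs @ [b])" and ?X = "inside (im (cycle_edges xs))"
    let ?xs1 = "a # A @ b # rev qs" and ?xs2 = "a # qs @ b # B"
    let ?X1 = "inside (im (cycle_edges ?xs1))" and ?X2 = "inside (im (cycle_edges ?xs2))"
    note split = theta_split[OF AB(1) dP _ PF, unfolded AB(2,3), OF outP PC neP]
    have X: "?X1 \<inter> ?X2 = {}" "?X1 \<union> ?X2 \<union> (im ?P - {p a, p b}) = ?X" using split(5,6) .
    have imP: "im ?P \<inter> ?X1 = {}" "im ?P \<inter> ?X2 = {}"
      using inside_no_overlap[of "im (cycle_edges ?xs1)"] inside_no_overlap[of "im (cycle_edges ?xs2)"]
      unfolding split(3,4) im_Un by blast+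
    have UP: "\<Union>?P = set (a # qs @ [b])" by (rule Union_path_edges) simp
    have P_open: "(path_image (\<gamma> f) - p ` f) \<inter> ?X \<noteq> {}" "(path_image (\<gamma> f) - p ` f) \<inter> {p a, p b} = {}"
      if f: "f \<in> ?P" for f
    proof -
      have fF: "f \<in> F" using f PF by blast
      have "a \<in> \<Union>F" "b \<in> \<Union>F" using UP PF by auto
      then show dis: "(path_image (\<gamma> f) - p ` f) \<inter> {p a, p b} = {}" using vertexF[OF fF] by blast
      have "path_image (\<gamma> f) \<subseteq> im ?P" using f by (auto simp: im_def)
      then have "path_image (\<gamma> f) - p ` f \<subseteq> ?X" using dis X(2) by blast
      then show "(path_image (\<gamma> f) - p ` f) \<inter> ?X \<noteq> {}" using interior_nonempty[OF fF] by blast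
    qed
    have edges: "inner_edges xs = inner_edges ?xs1 \<union> inner_edges ?xs2 \<union> ?P"
    proof
      show "inner_edges ?xs1 \<union> inner_edges ?xs2 \<union> ?P \<subseteq> inner_edges xs"
        using P_open(1) PF X(2) unfolding inner_edges_def by blast
      show "inner_edges xs \<subseteq> inner_edges ?xs1 \<union> inner_edges ?xs2 \<union> ?P"
      proof
        fix f assume f: "f \<in> inner_edges xs"
        show "f \<in> inner_edges ?xs1 \<union> inner_edges ?xs2 \<union> ?P"
        proof (cases "f \<in> ?P")
          case False
          have fF: "f \<in> F" using f by (simp add: inner_edges_def)
          obtain z where z: "z \<in> path_image (\<gamma> f) - p ` f" "z \<in> ?X" using f by (auto simp: inner_edges_def)
          have "(path_image (\<gamma> f) - p ` f) \<inter> im ?P = {}" by (rule image_minus_disjoint[OF fF PF False]) simp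
          then have "z \<in> ?X1 \<or> z \<in> ?X2" using z X(2) by blast
          then show ?thesis using z(1) fF unfolding inner_edges_def by blast
        qed simp
      qed
    qed
    have notP: "f \<notin> ?P" if "f \<in> inner_edges ?xs1 \<or> f \<in> inner_edges ?xs2" for f
    proof
      assume "f \<in> ?P"
      then have "path_image (\<gamma> f) \<subseteq> im ?P" by (auto simp: im_def)
      then show False using that imP unfolding inner_edges_def by blast
    qed
    have Pne: "?P \<noteq> {}" using UP by auto
    have "card (inner_edges ?xs1) < card (inner_edges xs)" "card (inner_edges ?xs2) < card (inner_edges xs)"
      using notP Pne edges by (intro psubset_card_mono finite_inner; blast)+
    note IH = less.hyps[OF this(1) split(1)] less.hyps[OF this(2) split(2)]
    let ?m = "length qs + 1"
    have "card ?P = ?m" using card_path_edges[OF dP] by simp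
    then have E: "card (inner_edges xs) \<le> card (inner_edges ?xs1) + card (inner_edges ?xs2) + ?m"
      using card_Un_le[of "inner_edges ?xs1 \<union> inner_edges ?xs2" ?P] card_Un_le[of "inner_edges ?xs1" "inner_edges ?xs2"]
      unfolding edges by linarith
    have V: "card (inner_verts ?xs1) + card (inner_verts ?xs2) + length qs \<le> card (inner_verts xs)"
    proof -
      have sub: "inner_verts ?xs1 \<union> inner_verts ?xs2 \<union> set qs \<subseteq> inner_verts xs"
      proof -
        have "v \<in> inner_verts xs" if v: "v \<in> set qs" for v
        proof -
          have vF: "v \<in> \<Union>F" "a \<in> \<Union>F" "b \<in> \<Union>F" using v UP PF by auto
          then have "p v \<noteq> p a" "p v \<noteq> p b" using injp v dP by (auto simp: inj_on_eq_iff)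
          moreover have "v \<in> \<Union>?P" using v UP by simp
          then obtain f where "f \<in> ?P" "v \<in> f" by (rule UnionE)
          then have "p v \<in> im ?P" using ends_in_image[of f v] PF by (auto simp: im_def)
          ultimately have "p v \<in> ?X" using X(2) by blast
          then show ?thesis using vF(1) by (simp add: inner_verts_def)
        qed
        then show ?thesis using X(2) unfolding inner_verts_def by blast
      qed
      have "p v \<in> im ?P" if "v \<in> set qs" for v
      proof -
        have "v \<in> \<Union>?P" using that UP by simp
        then obtain f where "f \<in> ?P" "v \<in> f" by (rule UnionE)
        then show ?thesis using ends_in_image[of f v] PF by (auto simp: im_def)
      qed
      then have "(inner_verts ?xs1 \<union> inner_verts ?xs2) \<inter> set qs = {}" "inner_verts ?xs1 \<inter> inner_verts ?xs2 = {}"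
        using imP X(1) unfolding inner_verts_def by blast+
      then have "card (inner_verts ?xs1 \<union> inner_verts ?xs2 \<union> set qs) =
          card (inner_verts ?xs1) + card (inner_verts ?xs2) + card (set qs)"
        by (simp add: card_Un_disjoint finite_inner)
      then show ?thesis
        using card_mono[OF finite_inner(2) sub] distinct_card[of qs] dP by simp
    qed
    \<comment> \<open>An ear of m edges contributes m - 1 vertices and adds 2 m to the total length
      of the two cycles. Since (g - 2) m + 2 m = g (m - 1) + g, the two inequalities add up to the
      claim, one of their two summands g on the left being used up.\<close>
    obtain h where h: "g = h + 2" using g by (metis add.commute le_iff_add numeral_le_iff order_trans semiring_norm(68) semiring_norm(72))
    have len: "length ?xs1 + length ?xs2 = length xs + 2 * ?m" using AB(4) by simp
    have "h * card (inner_edges xs) \<le> h * (card (inner_edges ?xs1) + card (inner_edges ?xs2) + ?m)"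
      using E by (rule mult_le_mono2)
    moreover have "(h + 2) * (card (inner_verts ?xs1) + card (inner_verts ?xs2) + length qs) \<le> (h + 2) * card (inner_verts xs)"
      using V by (rule mult_le_mono2)
    ultimately show ?thesis
      using IH len unfolding h by (simp add: algebra_simps)
  qed
qed

end

text \<open>The disc inequality is used twice: for the drawing, and for its image under an inversion
  centred inside the cycle and off the drawing. Such a centre exists as finitely many arcs have
  empty interior. The cycle and the two discs together account for all edges, and no vertex is
  counted twice.\<close>

lemma (in plane_edges) whole_inequality:
  assumes nonsep: "\<And>F'. F' \<subseteq> F \<Longrightarrow> F' \<noteq> {} \<Longrightarrow> F' \<noteq> F \<Longrightarrow> 2 \<le> card (\<Union>F' \<inter> \<Union>(F - F'))"
    and girth: "\<And>xs. is_cycle F xs \<Longrightarrow> g \<le> length xs" and g: "3 \<le> g"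
    and cyc: "is_cycle F xs"
  shows "(g - 2) * card F + g \<le> g * card (\<Union>F)"
proof -
  let ?S = "im (cycle_edges xs)"
  obtain c where c: "simple_path c" "pathfinish c = pathstart c" "path_image c = ?S"
    using cycle_closed_curve[OF cyc] .
  note J = Jordan_inside_outside[OF c(1,2), unfolded c(3)]
  have "interior (im F) = {}"
  proof -
    have "interior (\<Union>e \<in> F'. path_image (\<gamma> e)) = {} \<and> closed (\<Union>e \<in> F'. path_image (\<gamma> e))" if "F' \<subseteq> F" for F'
      using finite_subset[OF that finF] that
    proof (induction F' rule: finite_induct)
      case (insert e F')
      have "closed (path_image (\<gamma> e))" "interior (path_image (\<gamma> e)) = {}"
        using insert.prems arcF interior_arc_empty by (auto intro: closed_path_image arc_imp_path)
      then show ?case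
        using insert by (simp add: interior_closed_Un_empty_interior closed_Un)
    qed simp
    then show ?thesis by (simp add: im_def)
  qed
  then have "\<not> inside ?S \<subseteq> im F" using J interior_maximal[of "inside ?S" "im F"] by auto
  then obtain z0 where z0: "z0 \<in> inside ?S" "z0 \<notin> im F" by blast
  define \<phi> where "\<phi> z = inverse (z - z0)" for z :: complex
  have inj: "inj \<phi>" by (auto simp: \<phi>_def inj_def)
  have z0e: "z0 \<notin> path_image (\<gamma> e)" if "e \<in> F" for e using z0(2) that by (auto simp: im_def)
  have img: "\<phi> ` X \<inter> \<phi> ` Y = \<phi> ` (X \<inter> Y)" for X Y using image_Int[OF inj] by blast
  interpret inv: plane_edges F "\<phi> \<circ> p" "\<lambda>e. \<phi> \<circ> \<gamma> e"
  proof
    show "inj_on (\<phi> \<circ> p) (\<Union>F)" using injp inj by (intro comp_inj_on) (auto intro: inj_on_subset)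
    fix e assume e: "e \<in> F"
    have "continuous_on (path_image (\<gamma> e)) \<phi>"
      unfolding \<phi>_def using z0e[OF e] by (intro continuous_intros) auto
    then show "arc (\<phi> \<circ> \<gamma> e)"
      using arcF[OF e] inj path_continuous_image[of "\<gamma> e" \<phi>] by (auto simp: arc_def intro: comp_inj_on inj_on_subset)
    show "{pathstart (\<phi> \<circ> \<gamma> e), pathfinish (\<phi> \<circ> \<gamma> e)} = (\<phi> \<circ> p) ` e"
      using arg_cong[OF endsF[OF e], of "image \<phi>"] by (simp add: pathstart_compose pathfinish_compose image_comp)
    show "path_image (\<phi> \<circ> \<gamma> e) \<inter> (\<phi> \<circ> p) ` \<Union>F = (\<phi> \<circ> p) ` e"
      using arg_cong[OF vertexF[OF e], of "image \<phi>"] unfolding path_image_compose image_comp[symmetric] img .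
    fix f assume f: "f \<in> F" "e \<noteq> f"
    show "path_image (\<phi> \<circ> \<gamma> e) \<inter> path_image (\<phi> \<circ> \<gamma> f) = (\<phi> \<circ> p) ` (e \<inter> f)"
      using arg_cong[OF crossF[OF e f], of "image \<phi>"] unfolding path_image_compose image_comp[symmetric] img .
  qed (use finF card2F in auto)
  have imS: "inv.im (cycle_edges xs) = \<phi> ` ?S"
    by (auto simp: inv.im_def im_def path_image_compose)
  have in_out: "\<phi> ` outside ?S \<subseteq> inside (\<phi> ` ?S)" "\<phi> ` (inside ?S - {z0}) \<subseteq> outside (\<phi> ` ?S)"
    using inversion_inside_outside[OF c(1,2), of z0] z0(1) unfolding c(3) \<phi>_def by auto
  have sub: "cycle_edges xs \<subseteq> F" using cyc by (simp add: is_cycle_def)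
  have E: "F \<subseteq> cycle_edges xs \<union> inner_edges xs \<union> inv.inner_edges xs"
  proof
    fix f assume f: "f \<in> F"
    show "f \<in> cycle_edges xs \<union> inner_edges xs \<union> inv.inner_edges xs"
    proof (cases "f \<in> cycle_edges xs")
      case False
      obtain z where z: "z \<in> path_image (\<gamma> f) - p ` f" using interior_nonempty[OF f] by blast
      have "z \<notin> ?S" using image_minus_disjoint[OF f sub False, of f] z by blast
      then consider "z \<in> inside ?S" | "z \<in> outside ?S" using inside_Un_outside[of ?S] by blast
      then show ?thesis
      proof cases
        case 2
        have "\<phi> z \<in> path_image (\<phi> \<circ> \<gamma> f) - (\<phi> \<circ> p) ` f"
          unfolding path_image_compose image_comp[symmetric] image_set_diff[OF inj, symmetric] using z by (rule imageI)
        moreover have "\<phi> z \<in> inside (inv.im (cycle_edges xs))"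
          unfolding imS by (rule subsetD[OF in_out(1) imageI[OF 2]])
        ultimately show ?thesis using f unfolding inv.inner_edges_def by blast
      qed (use z f in \<open>auto simp: inner_edges_def\<close>)
    qed simp
  qed
  have finV: "finite (\<Union>F)" using finF card2F by (intro finite_Union) (auto intro: card_ge_0_finite)
  have xsV: "set xs \<subseteq> \<Union>F" using Union_cycle_edges[OF cyc] sub by blast
  have vS: "p v \<in> ?S" if v: "v \<in> set xs" for v
  proof -
    obtain f where f: "f \<in> cycle_edges xs" "v \<in> f" using v Union_cycle_edges[OF cyc] by blast
    then have "p v \<in> path_image (\<gamma> f)" using ends_in_image sub by blast
    then show ?thesis using f by (auto simp: im_def)
  qed
  have V: "set xs \<inter> inner_verts xs = {}" "set xs \<inter> inv.inner_verts xs = {}" "inner_verts xs \<inter> inv.inner_verts xs = {}"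
  proof -
    show "set xs \<inter> inner_verts xs = {}"
    proof (intro equals0I)
      fix v assume "v \<in> set xs \<inter> inner_verts xs"
      then have "v \<in> set xs" "p v \<in> inside ?S" by (simp_all add: inner_verts_def)
      then have "p v \<in> inside ?S \<inter> ?S" using vS by blast
      then show False unfolding inside_no_overlap by blast
    qed
    show "set xs \<inter> inv.inner_verts xs = {}"
    proof (intro equals0I)
      fix v assume "v \<in> set xs \<inter> inv.inner_verts xs"
      then have "v \<in> set xs" "\<phi> (p v) \<in> inside (\<phi> ` ?S)" by (simp_all add: inv.inner_verts_def imS)
      then have "\<phi> (p v) \<in> inside (\<phi> ` ?S) \<inter> \<phi> ` ?S" using vS by blast
      then show False unfolding inside_no_overlap by blast
    qed
    have out: "\<phi> (p v) \<in> outside (\<phi> ` ?S)" if "v \<in> inner_verts xs" for v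
    proof -
      have pv: "p v \<in> inside ?S" and "v \<in> \<Union>F" using that by (auto simp: inner_verts_def)
      from this(2) obtain e where "e \<in> F" "v \<in> e" by blast
      then have "p v \<noteq> z0" using ends_in_image[of e v] z0e[of e] by auto
      then have "p v \<in> inside ?S - {z0}" using pv by simp
      then show ?thesis by (rule subsetD[OF in_out(2) imageI])
    qed
    show "inner_verts xs \<inter> inv.inner_verts xs = {}"
    proof (intro equals0I)
      fix v assume v: "v \<in> inner_verts xs \<inter> inv.inner_verts xs"
      then have "v \<in> inner_verts xs" "\<phi> (p v) \<in> inside (\<phi> ` ?S)" by (simp_all add: inv.inner_verts_def imS)
      then have "\<phi> (p v) \<in> inside (\<phi> ` ?S) \<inter> outside (\<phi> ` ?S)" using out by blast
      then show False unfolding inside_Int_outside by blast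
    qed
  qed
  have "card (set xs \<union> inner_verts xs \<union> inv.inner_verts xs) = length xs + card (inner_verts xs) + card (inv.inner_verts xs)"
    using V finite_inner inv.finite_inner distinct_card[of xs] cyc
    by (simp add: card_Un_disjoint Int_Un_distrib2 is_cycle_def)
  moreover have "card (set xs \<union> inner_verts xs \<union> inv.inner_verts xs) \<le> card (\<Union>F)"
    using xsV by (intro card_mono finV) (auto simp: inner_verts_def inv.inner_verts_def)
  ultimately have cV: "length xs + card (inner_verts xs) + card (inv.inner_verts xs) \<le> card (\<Union>F)" by simp
  have "card F \<le> card (cycle_edges xs \<union> inner_edges xs \<union> inv.inner_edges xs)"
    using E finite_inner inv.finite_inner finite_subset[OF sub finF] by (intro card_mono) auto
  also have "\<dots> \<le> length xs + card (inner_edges xs) + card (inv.inner_edges xs)"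
    using card_Un_le[of "cycle_edges xs \<union> inner_edges xs" "inv.inner_edges xs"] card_Un_le[of "cycle_edges xs" "inner_edges xs"]
      card_cycle_edges[OF cyc] by linarith
  finally have cE: "card F \<le> length xs + card (inner_edges xs) + card (inv.inner_edges xs)" .
  note D = disc_inequality[OF nonsep girth g cyc] inv.disc_inequality[OF nonsep girth g cyc]
  obtain h where h: "g = h + 2" using g by (metis add.commute le_iff_add numeral_le_iff order_trans semiring_norm(68) semiring_norm(72))
  have "h * card F \<le> h * (length xs + card (inner_edges xs) + card (inv.inner_edges xs))"
    using cE by (rule mult_le_mono2)
  moreover have "(h + 2) * (length xs + card (inner_verts xs) + card (inv.inner_verts xs)) \<le> (h + 2) * card (\<Union>F)"
    using cV by (rule mult_le_mono2)
  ultimately show ?thesis using D unfolding h by (simp add: algebra_simps)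
qed

section \<open>The girth bound for arbitrary plane edge sets\<close>

lemma plane_edges_subset:
  assumes "plane_edges F p \<gamma>" "F' \<subseteq> F"
  shows "plane_edges F' p \<gamma>"
proof -
  interpret plane_edges F p \<gamma> by fact
  show ?thesis
  proof
    show "finite F'" using assms(2) finF by (rule finite_subset)
    show "inj_on p (\<Union>F')" using injp assms(2) by (auto intro: inj_on_subset)
    fix e assume e: "e \<in> F'"
    have "p ` e \<subseteq> path_image (\<gamma> e) \<inter> p ` \<Union>F'" using vertexF[of e] e assms(2) by blast
    moreover have "path_image (\<gamma> e) \<inter> p ` \<Union>F' \<subseteq> p ` e" using vertexF[of e] e assms(2) by blast
    ultimately show "path_image (\<gamma> e) \<inter> p ` \<Union>F' = p ` e" by blast
    have eF: "e \<in> F" using e assms(2) by blast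
    show "card e = 2" using eF by (rule card2F)
    show "arc (\<gamma> e)" using eF by (rule arcF)
    show "{pathstart (\<gamma> e), pathfinish (\<gamma> e)} = p ` e" using eF by (rule endsF)
    show "path_image (\<gamma> e) \<inter> path_image (\<gamma> f) = p ` (e \<inter> f)" if "f \<in> F'" "e \<noteq> f" for f
      using that assms(2) by (intro crossF eF) auto
  qed
qed

lemma path_edges_nth: "Suc i < length l \<Longrightarrow> {l ! i, l ! Suc i} \<in> path_edges l"
proof (induction l arbitrary: i rule: path_edges.induct)
  case (3 x y l)
  then show ?case by (cases i) auto
qed simp_all

text \<open>An end vertex of a longest path has a second edge, and this edge must return to the
  path.\<close>

lemma cycle_exists:
  assumes fin: "finite F" "F \<noteq> {}" and card2: "\<And>e. e \<in> F \<Longrightarrow> card e = 2"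
    and deg: "\<And>e v. e \<in> F \<Longrightarrow> v \<in> e \<Longrightarrow> \<exists>f \<in> F. f \<noteq> e \<and> v \<in> f"
  shows "\<exists>xs. is_cycle F xs"
proof -
  have finV: "finite (\<Union>F)" using fin card2 by (intro finite_Union) (auto intro: card_ge_0_finite)
  let ?Q = "\<lambda>l. 2 \<le> length l \<and> distinct l \<and> set l \<subseteq> \<Union>F \<and> path_edges l \<subseteq> F"
  have pair: "\<exists>w. e = {v, w} \<and> w \<noteq> v" if e: "e \<in> F" "v \<in> e" for e v
    using card2[OF e(1)] e(2) by (auto simp: card_2_iff)
  obtain e where e: "e \<in> F" using fin(2) by blast
  then obtain v where "v \<in> e" using card2 by fastforce
  then obtain w where "e = {v, w}" "w \<noteq> v" using pair[OF e] by blast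
  then have "?Q [v, w]" using e by auto
  moreover have "\<forall>l. ?Q l \<longrightarrow> length l < Suc (card (\<Union>F))"
    using card_mono[OF finV] distinct_card by (metis le_imp_less_Suc)
  ultimately have "\<exists>l. ?Q l \<and> (\<forall>l'. ?Q l' \<longrightarrow> length l' \<le> length l)"
    by (rule ex_has_greatest_nat)
  then obtain l where l: "?Q l" and max: "\<And>l'. ?Q l' \<Longrightarrow> length l' \<le> length l"
    by (elim exE conjE) blast
  obtain x y r where r: "l = x # y # r" using l by (cases l; cases "tl l") auto
  have xy: "{x, y} \<in> F" using l r by simp
  obtain f where f: "f \<in> F" "f \<noteq> {x, y}" "x \<in> f" using deg[OF xy, of x] by auto
  then obtain z where z: "f = {x, z}" "z \<noteq> x" using pair by blast
  have "z \<in> set r"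
  proof (rule ccontr)
    assume "z \<notin> set r"
    then have "?Q (z # l)" using l r f z by (auto simp: insert_commute)
    then show False using max[of "z # l"] by simp
  qed
  then obtain A B where AB: "r = A @ z # B" by (auto simp: in_set_conv_decomp)
  let ?xs = "x # y # A @ [z]"
  have "path_edges l = path_edges ?xs \<union> path_edges (z # B)"
    using path_edges_append[of "x # y # A" z B] r AB by simp
  moreover have "cycle_edges ?xs = path_edges ?xs \<union> {{z, x}}"
    using path_edges_append[of "x # y # A" z "[x]"] by (simp add: cycle_edges_def)
  ultimately have "is_cycle F ?xs"
    using l r AB f(1) z by (auto simp: is_cycle_def insert_commute)
  then show ?thesis by blast
qed

text \<open>Splitting into two parts with at most one common vertex counts that vertex twice, at the
  cost of g; the additional summand g on the left is there to absorb this. What cannot be split is a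
  single edge or an edge set in which each edge has further edges at both ends; the latter contains
  a cycle, so that \<open>whole_inequality\<close> applies.\<close>

theorem plane_girth_bound:
  assumes "plane_edges F p \<gamma>" "F \<noteq> {}" "\<And>xs. is_cycle F xs \<Longrightarrow> g \<le> length xs" "3 \<le> g"
  shows "(g - 2) * card F + g \<le> g * card (\<Union>F)"
  using assms(1-3)
proof (induction "card F" arbitrary: F rule: less_induct)
  case less
  interpret plane_edges F p \<gamma> by fact
  have finU: "finite (\<Union>F')" if "F' \<subseteq> F" for F'
  proof (rule finite_Union)
    show "finite F'" using that finF by (rule finite_subset)
    show "finite e" if "e \<in> F'" for e
      using card2F[of e] that \<open>F' \<subseteq> F\<close> by (intro card_ge_0_finite) auto
  qed
  show ?case
  proof (cases "\<exists>F' \<subseteq> F. F' \<noteq> {} \<and> F' \<noteq> F \<and> card (\<Union>F' \<inter> \<Union>(F - F')) \<le> 1")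
    case True
    then obtain F' where F': "F' \<subseteq> F" "F' \<noteq> {}" "F' \<noteq> F" "card (\<Union>F' \<inter> \<Union>(F - F')) \<le> 1" by blast
    have part: "(g - 2) * card H + g \<le> g * card (\<Union>H)" if "H \<subset> F" "H \<noteq> {}" for H
    proof (rule less.hyps)
      show "card H < card F" using that(1) finF by (rule psubset_card_mono[rotated])
      show "plane_edges H p \<gamma>" using less.prems(1) that(1) plane_edges_subset by blast
      show "g \<le> length xs" if "is_cycle H xs" for xs
        using that \<open>H \<subset> F\<close> less.prems(3)[of xs] by (auto simp: is_cycle_def)
    qed fact
    have "F' \<subset> F" "F - F' \<subset> F" "F - F' \<noteq> {}" using F' by blast+
    then have 1: "(g - 2) * card F' + g \<le> g * card (\<Union>F')" "(g - 2) * card (F - F') + g \<le> g * card (\<Union>(F - F'))"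
      using part F'(2) by blast+
    have E: "card F' + card (F - F') = card F"
      using F'(1) finF by (metis card_Diff_subset card_mono finite_subset le_add_diff_inverse)
    have "\<Union>F' \<union> \<Union>(F - F') = \<Union>F" using F'(1) by blast
    then have V: "card (\<Union>F') + card (\<Union>(F - F')) \<le> card (\<Union>F) + 1"
      using card_Un_Int[OF finU[of F'] finU[of "F - F'"]] F'(1,4) by simp
    have "(g - 2) * card F + 2 * g \<le> g * (card (\<Union>F') + card (\<Union>(F - F')))"
      using 1 unfolding E[symmetric] by (simp add: algebra_simps)
    also have "\<dots> \<le> g * (card (\<Union>F) + 1)" using V by (rule mult_le_mono2)
    finally show ?thesis by simp
  next
    case False
    have nonsep: "2 \<le> card (\<Union>F' \<inter> \<Union>(F - F'))" if F': "F' \<subseteq> F" "F' \<noteq> {}" "F' \<noteq> F" for F'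
    proof (rule ccontr)
      assume "\<not> ?thesis"
      then have "card (\<Union>F' \<inter> \<Union>(F - F')) \<le> 1" by simp
      with F' have "\<exists>F' \<subseteq> F. F' \<noteq> {} \<and> F' \<noteq> F \<and> card (\<Union>F' \<inter> \<Union>(F - F')) \<le> 1" by (intro exI[of _ F'] conjI)
      with False show False by (rule notE)
    qed
    show ?thesis
    proof (cases "\<exists>e. F = {e}")
      case True
      then obtain e where "F = {e}" by blast
      then show ?thesis using card2F[of e] \<open>3 \<le> g\<close> by simp
    next
      case False
      have "\<exists>f \<in> F. f \<noteq> e \<and> v \<in> f" if e: "e \<in> F" "v \<in> e" for e v
      proof -
        have "2 \<le> card (\<Union>{e} \<inter> \<Union>(F - {e}))" by (rule nonsep) (use e False in auto)
        then have "card e \<le> card (e \<inter> \<Union>(F - {e}))" using card2F[OF e(1)] by simp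
        moreover have "finite e" using card2F[OF e(1)] by (intro card_ge_0_finite) simp
        ultimately have "e \<inter> \<Union>(F - {e}) = e" by (intro card_seteq) auto
        then show ?thesis using e(2) by blast
      qed
      then have "\<exists>xs. is_cycle F xs" by (intro cycle_exists finF less.prems(2) card2F)
      then obtain xs where "is_cycle F xs" ..
      from whole_inequality[OF nonsep less.prems(3) \<open>3 \<le> g\<close> this] show ?thesis .
    qed
  qed
qed

section \<open>The planar case\<close>

lemma cycle_pendant_cycle_0:
  assumes "is_cycle F xs"
  shows "pendant_cycle F (length xs) 0"
  unfolding pendant_cycle_def
proof (intro exI[of _ "\<lambda>i. xs ! i"] conjI allI impI)
  show "inj_on (\<lambda>i. xs ! i) {..<length xs + 0}"
    using assms by (auto simp: is_cycle_def intro: inj_on_nth)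
  fix i assume i: "i < length xs"
  have "{(xs @ [hd xs]) ! i, (xs @ [hd xs]) ! Suc i} \<in> F"
    using path_edges_nth[of i "xs @ [hd xs]"] i assms by (auto simp: is_cycle_def cycle_edges_def)
  moreover have "hd xs = xs ! 0" using i by (intro hd_conv_nth) auto
  then have "(xs @ [hd xs]) ! Suc i = xs ! (Suc i mod length xs)"
    using i by (cases "Suc i = length xs") (simp_all add: nth_append)
  ultimately show "{xs ! i, xs ! (Suc i mod length xs)} \<in> F" using i by (simp add: nth_append)
qed simp

lemma girth_le:
  assumes "simple_graph G" "3 \<le> n" "pendant_cycle (edges G) n k"
  shows "girth G \<le> enat n"
proof -
  have "pendant_cycle (edges G) n 0"
    using assms(3) unfolding pendant_cycle_def by (elim ex_forward) (auto intro: inj_on_subset)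
  then have "contains_subgraph G (cycle_with_pendants n 0)"
    using contains_cycle_with_pendants[OF assms(1)] assms(2) by simp
  moreover have "cycle_with_pendants n 0 = cycle_graph n"
    by (simp add: cycle_with_pendants_def cycle_graph_def)
  ultimately show ?thesis unfolding girth_def using assms(2) by (intro INF_lower) simp
qed

lemma plane_edges_drawing:
  assumes G: "simple_graph G" and d: "plane_drawing G p \<gamma>"
  shows "plane_edges (edges G) p \<gamma>"
proof
  have V: "\<Union>(edges G) \<subseteq> verts G" using simple_graph_finite(4)[OF G] by blast
  show "finite (edges G)" using G by (rule simple_graph_finite)
  show "inj_on p (\<Union>(edges G))" using d V by (auto simp: plane_drawing_def intro: inj_on_subset)
  fix e assume e: "e \<in> edges G"
  show "card e = 2" using G e by (rule simple_graph_finite)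
  show "arc (\<gamma> e)" "{pathstart (\<gamma> e), pathfinish (\<gamma> e)} = p ` e"
    using d e by (auto simp: plane_drawing_def)
  have "path_image (\<gamma> e) \<inter> p ` verts G = p ` e" using d e by (auto simp: plane_drawing_def)
  then show "path_image (\<gamma> e) \<inter> p ` \<Union>(edges G) = p ` e" using V e by blast
  show "path_image (\<gamma> e) \<inter> path_image (\<gamma> f) = p ` (e \<inter> f)" if "f \<in> edges G" "e \<noteq> f" for f
    using d e that by (auto simp: plane_drawing_def)
qed

lemma planar_part:
  assumes G: "simple_graph G" "subcubic G" and "planar G" and girth: "30 \<le> girth G"
  shows "strong_chromatic_index G \<le> 5"
proof (rule strong_chromatic_index_le_5[OF G(1) sparse_colorable])
  \<comment> \<open>The three forbidden subgraphs contain cycles of length 3, 4 and 7, so large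
    girth excludes them as well.\<close>
  have long: "30 \<le> n" if "3 \<le> n" "pendant_cycle (edges G) n k" for n k
  proof -
    have "30 \<le> enat n" using girth girth_le[OF G(1) that] by (rule order_trans)
    then show ?thesis by (simp add: numeral_eq_enat)
  qed
  show "\<not> pendant_cycle (edges G) 3 3" "\<not> pendant_cycle (edges G) 4 2" "\<not> pendant_cycle (edges G) 7 7"
    using long[of 3 3] long[of 4 2] long[of 7 7] by auto
  obtain p \<gamma> where "plane_drawing G p \<gamma>" using \<open>planar G\<close> by (auto simp: planar_def)
  note plane = plane_edges_drawing[OF G(1) this]
  fix F assume F: "F \<subseteq> edges G" "F \<noteq> {}"
  have "30 \<le> length xs" if "is_cycle F xs" for xs
  proof (rule long)
    show "3 \<le> length xs" using that by (simp add: is_cycle_def)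
    show "pendant_cycle (edges G) (length xs) 0"
      using cycle_pendant_cycle_0[OF that] F(1) by (rule pendant_cycle_mono)
  qed
  \<comment> \<open>Halving this gives the density condition of \<open>sparse_colorable\<close>; the
    ratio 28 : 30 is where girth 30 is needed.\<close>
  then have "(30 - 2) * card F + 30 \<le> 30 * card (\<Union>F)"
    by (intro plane_girth_bound[OF plane_edges_subset[OF plane F(1)] F(2)]) simp_all
  then show "14 * card F < 15 * card (\<Union>F)" by simp
qed (use simple_graph_finite[OF G(1)] subcubic_nbs[OF G] in auto)

theorem theorem1p8:
  fixes G :: "'a ugraph"
  assumes "simple_graph G" and "subcubic G"
  shows "(\<not> contains_subgraph G S3 \<and> \<not> contains_subgraph G S4 \<and> \<not> contains_subgraph G S7 \<and>
            mad G < 2 + 1 / 7 \<longrightarrow> strong_chromatic_index G \<le> 5) \<and>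
         (planar G \<and> girth G \<ge> 30 \<longrightarrow> strong_chromatic_index G \<le> 5)"
  using mad_part[OF assms] planar_part[OF assms] by blast

end
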